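(* Let $N\in\mathbb{N}$, $d\in\mathbb{N}$, and let $S_0,S_1,\dots,S_d$ be complex $N\times N$ matrices. Consider the truncated matrix trigonometric moment problem with moments $\{S_n\}_{n=0}^d$: find all solutions $M$, i.e. all non-decreasing $\mathbb{C}_{N\times N}$-valued functions $M(t)=(m_{k,l}(t))_{k,l=0}^{N-1}$, $t\in[0,2\pi]$, with $M(0)=0$, left-continuous in $(0,2\pi]$, such that $$\int_0^{2\pi} e^{int}\,dM(t)=S_n,\qquad n=0,1,\dots,d.$$ Assume that $T_d=(S_{i-j})_{i,j=0}^d\ge 0$, where $S_{-n}:=S_n^*$ for $n=1,\dots,d$. Let $H$, $\{x_n\}_{n=0}^{(d+1)N-1}$ and the isometric operator $A$ in $H$ be constructed from the moments as described in the context. Then all solutions of the moment problem have the form $$M(t)=(m_{k,j}(t))_{k,j=0}^{N-1},\qquad m_{k,j}(t)=(\mathbf{E}_t x_k,x_j)_H,\qquad t\in[0,2\pi],$$ where $\mathbf{E}_t$ is a left-continuous spectral function of the isometric operator $A$. Conversely, an arbitrary left-continuous spectral function $\mathbf{E}_t$ of $A$ generates by this formula a solution of the moment problem. Moreover, the correspondence between all left-continuous spectral functions of $A$ and all solutions of the moment problem is bijective.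
   Context: $\mathbb{C}_{N\times N}$ is the set of complex $N\times N$ matrices. A matrix function $M$ on $[0,2\pi]$ is non-decreasing if $M(t)-M(s)\ge 0$ (positive semidefinite) whenever $s\le t$. Scalar products are linear in the first argument and conjugate-linear in the second. $P_H^{\widehat H}$ denotes the orthogonal projection in $\widehat H$ onto its subspace $H$. The block matrix $T_d=(S_{i-j})_{i,j=0}^d$ (block row index $i$, block column index $j$) is of size $(d+1)N\times(d+1)N$. Write $T_d=(\gamma_{n,m})_{n,m=0}^{(d+1)N-1}$ with complex entries $\gamma_{n,m}$, and $S_k=(S_{k;s,l})_{s,l=0}^{N-1}$ for $-d\le k\le d$, so that $\gamma_{kN+s,rN+l}=S_{k-r;s,l}$ for $0\le k,r\le d$, $0\le s,l\le N-1$. Construction of $H$, $x_n$ and $A$ (for $d\in\mathbb{N}$ and $T_d\ge 0$): since $T_d\ge0$, there exist a Hilbert space $H$ and elements $\{x_n\}_{n=0}^{(d+1)N-1}$ of $H$ such that $(x_n,x_m)_H=\gamma_{n,m}$ for $0\le n,m\le (d+1)N-1$ and $H$ is the linear span of $\{x_n\}_{n=0}^{(d+1)N-1}$; fix such a choice. Set $D(A)=H_0:=\mathrm{Lin}\{x_n\}_{n=0}^{dN-1}$ and $$A x=\sum_{k=0}^{dN-1}\alpha_k x_{k+N}\quad\text{for } x=\sum_{k=0}^{dN-1}\alpha_k x_k,\ \alpha_k\in\mathbb{C}.$$ This is a well-defined isometric operator from $D(A)\subseteq H$ into $H$. Spectral functions: let $\widehat U\supseteq A$ be a unitary extension of $A$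 in some Hilbert space $\widehat H\supseteq H$ (that is, $\widehat U$ is unitary on $\widehat H$ and $\widehat U x=Ax$ for $x\in D(A)$), and let $\{\widehat E_t\}_{t\in[0,2\pi]}$ be the left-continuous orthogonal resolution of unity of $\widehat U$, i.e. the spectral family of orthogonal projections, non-decreasing and strongly left-continuous in $(0,2\pi]$, with $\widehat E_0=0$, $\widehat E_{2\pi}=E_{\widehat H}$ (identity operator on $\widehat H$) and $\widehat U=\int_0^{2\pi}e^{it}\,d\widehat E_t$. The operator-valued function $\mathbf{E}_t=P_H^{\widehat H}\widehat E_t$, $t\in[0,2\pi]$ (regarded as operators in $H$), is called a (left-continuous) spectral function of $A$. The left-continuous spectral functions of $A$ are all functions arising in this way from all unitary extensions $\widehat U$ in all Hilbert spaces $\widehat H\supseteq H$. *)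

theory Defs
  imports
    "HOL-Analysis.Tagged_Division"
    "HOL-Analysis.Abstract_Metric_Spaces"
    "Jordan_Normal_Form.VS_Connect"
    "Jordan_Normal_Form.Schur_Decomposition"
begin

section \<open>Complex Hilbert spaces with explicit carrier\<close>

text \<open>
  Hilbert spaces are carrier-based, so that one can quantify existentially over them.
  The fields \<open>mult\<close> and \<open>one\<close> inherited from the module record play no role.
\<close>

record 'a hspace = "(complex, 'a) module" +
  sprod :: "'a \<Rightarrow> 'a \<Rightarrow> complex"

definition hnorm :: "'a hspace \<Rightarrow> 'a \<Rightarrow> real" where
  "hnorm H x = sqrt (Re (sprod H x x))"

text \<open>The value outside the carrier is fixed because \<^locale>\<open>Metric_space\<close> asks for symmetry
  and nonnegativity on the whole type.\<close>

definition hdist :: "'a hspace \<Rightarrow> 'a \<Rightarrow> 'a \<Rightarrow> real" where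
  "hdist H x y = (if x \<in> carrier H \<and> y \<in> carrier H then hnorm H (x \<ominus>\<^bsub>H\<^esub> y) else 0)"

text \<open>The order on \<^typ>\<open>complex\<close> is that of \<^theory>\<open>HOL-Library.Complex_Order\<close>:
  \<open>0 \<le> z\<close> means that \<open>z\<close> is real and nonnegative.\<close>

locale hilbert_space = vectorspace "class_ring :: complex ring" H for H :: "'a hspace" +
  assumes sprod_add_left:
    "\<lbrakk>x \<in> carrier H; y \<in> carrier H; z \<in> carrier H\<rbrakk>
      \<Longrightarrow> sprod H (x \<oplus>\<^bsub>H\<^esub> y) z = sprod H x z + sprod H y z"
  and sprod_smult_left:
    "\<lbrakk>x \<in> carrier H; y \<in> carrier H\<rbrakk> \<Longrightarrow> sprod H (c \<odot>\<^bsub>H\<^esub> x) y = c * sprod H x y"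
  and sprod_commute:
    "\<lbrakk>x \<in> carrier H; y \<in> carrier H\<rbrakk> \<Longrightarrow> sprod H y x = cnj (sprod H x y)"
  and sprod_nonneg: "x \<in> carrier H \<Longrightarrow> 0 \<le> sprod H x x"
  and sprod_definite: "\<lbrakk>x \<in> carrier H; sprod H x x = 0\<rbrakk> \<Longrightarrow> x = \<zero>\<^bsub>H\<^esub>"
  and complete: "Metric_space.mcomplete (carrier H) (hdist H)"

definition isometric_embedding :: "'a hspace \<Rightarrow> 'b hspace \<Rightarrow> ('a \<Rightarrow> 'b) \<Rightarrow> bool" where
  "isometric_embedding H K J \<longleftrightarrow> linear_map class_ring H K J \<and>
     (\<forall>x\<in>carrier H. \<forall>y\<in>carrier H. sprod K (J x) (J y) = sprod H x y)"

definition unitary_op :: "'a hspace \<Rightarrow> ('a \<Rightarrow> 'a) \<Rightarrow> bool" where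
  "unitary_op K U \<longleftrightarrow> isometric_embedding K K U \<and> U ` carrier K = carrier K"

definition orth_projection :: "'a hspace \<Rightarrow> ('a \<Rightarrow> 'a) \<Rightarrow> bool" where
  "orth_projection K P \<longleftrightarrow> linear_map class_ring K K P \<and>
     (\<forall>x\<in>carrier K. P (P x) = P x) \<and>
     (\<forall>x\<in>carrier K. \<forall>y\<in>carrier K. sprod K (P x) y = sprod K x (P y))"

text \<open>The orthogonal projection of \<open>v\<close> onto the closed subspace \<open>L\<close> of \<open>K\<close>.\<close>

definition proj_onto :: "'a hspace \<Rightarrow> 'a set \<Rightarrow> 'a \<Rightarrow> 'a" where
  "proj_onto K L v = (THE y. y \<in> L \<and> (\<forall>z\<in>L. sprod K (v \<ominus>\<^bsub>K\<^esub> y) z = 0))"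


section \<open>The Riemann--Stieltjes integral\<close>

text \<open>\<open>\<integral> f dg = I\<close> over \<open>[a, b]\<close>, as limit of Riemann--Stieltjes sums when the mesh tends to 0
  (a uniform gauge of radius \<open>\<delta>\<close> bounds the mesh by \<open>2 \<delta>\<close>).\<close>

definition has_RS_integral ::
  "(real \<Rightarrow> complex) \<Rightarrow> (real \<Rightarrow> complex) \<Rightarrow> real \<Rightarrow> real \<Rightarrow> complex \<Rightarrow> bool" where
  "has_RS_integral f g a b I \<longleftrightarrow>
     (\<forall>e>0. \<exists>\<delta>>0. \<forall>p. p tagged_division_of {a..b} \<and> (\<lambda>x. ball x \<delta>) fine p \<longrightarrow>
        cmod ((\<Sum>(x, K)\<in>p. f x * (g (Sup K) - g (Inf K))) - I) < e)"


section \<open>Unitary extensions and spectral functions\<close>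

text \<open>The left-continuous orthogonal resolution of unity \<open>F\<close> of a unitary operator \<open>U\<close>.
  The operator integral \<open>U = \<integral> e\<^sup>i\<^sup>t dF\<^sub>t\<close> is understood weakly.\<close>

definition resolution_of_unity ::
  "'a hspace \<Rightarrow> ('a \<Rightarrow> 'a) \<Rightarrow> (real \<Rightarrow> 'a \<Rightarrow> 'a) \<Rightarrow> bool" where
  "resolution_of_unity K U F \<longleftrightarrow>
     (\<forall>t\<in>{0..2*pi}. orth_projection K (F t)) \<and>
     (\<forall>s\<in>{0..2*pi}. \<forall>t\<in>{0..2*pi}. s \<le> t \<longrightarrow>
        (\<forall>v\<in>carrier K. sprod K (F s v) v \<le> sprod K (F t v) v)) \<and>
     (\<forall>t\<in>{0<..2*pi}. \<forall>v\<in>carrier K.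
        ((\<lambda>s. hnorm K (F s v \<ominus>\<^bsub>K\<^esub> F t v)) \<longlongrightarrow> 0) (at_left t)) \<and>
     (\<forall>v\<in>carrier K. F 0 v = \<zero>\<^bsub>K\<^esub>) \<and>
     (\<forall>v\<in>carrier K. F (2*pi) v = v) \<and>
     (\<forall>v\<in>carrier K. \<forall>w\<in>carrier K.
        has_RS_integral (\<lambda>t. exp (\<i> * complex_of_real t)) (\<lambda>t. sprod K (F t v) w) 0 (2*pi)
          (sprod K (U v) w))"

text \<open>
  Left-continuous spectral functions of an operator \<open>A\<close> with domain \<open>D\<close> in \<open>H\<close>, arising from
  unitary extensions \<open>U\<close> in Hilbert spaces \<open>K\<close> whose vectors are taken from the type
  \<^typ>\<open>'b\<close>.  The inclusion of \<open>H\<close> in \<open>K\<close> is an isometric embedding \<open>J\<close>, along which \<open>H\<close> is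
  identified with \<open>J ` carrier H\<close>.  The extension space ranges over all types only through the
  type parameter \<^typ>\<open>'b\<close>; the set obtained from \<^typ>\<open>'a\<close> itself is to contain the one
  obtained from any other type, and then comprises all spectral functions.  Spectral functions are made undefined outside
  \<open>[0, 2\<pi>]\<close> and outside the carrier of \<open>H\<close>, so that they are equal iff they agree there.
\<close>

definition spectral_functions ::
  "'b itself \<Rightarrow> 'a hspace \<Rightarrow> 'a set \<Rightarrow> ('a \<Rightarrow> 'a) \<Rightarrow> (real \<Rightarrow> 'a \<Rightarrow> 'a) set" where
  "spectral_functions _ H D A =
     {E. \<exists>(K :: 'b hspace) J U F.
        hilbert_space K \<and> isometric_embedding H K J \<and>
        unitary_op K U \<and> (\<forall>v\<in>D. U (J v) = J (A v)) \<and>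
        resolution_of_unity K U F \<and>
        E = (\<lambda>t\<in>{0..2*pi}. \<lambda>v\<in>carrier H.
               inv_into (carrier H) J (proj_onto K (J ` carrier H) (F t (J v))))}"


section \<open>The truncated matrix trigonometric moment problem\<close>

definition psd :: "nat \<Rightarrow> complex mat \<Rightarrow> bool" where
  "psd n B \<longleftrightarrow> B \<in> carrier_mat n n \<and> (\<forall>v\<in>carrier_vec n. 0 \<le> (B *\<^sub>v v) \<bullet>c v)"

text \<open>Solutions are made undefined outside \<open>[0, 2\<pi>]\<close>.\<close>

definition solutions :: "nat \<Rightarrow> nat \<Rightarrow> (nat \<Rightarrow> complex mat) \<Rightarrow> (real \<Rightarrow> complex mat) set" where
  "solutions N d S =
     {M \<in> {0..2*pi} \<rightarrow>\<^sub>E carrier_mat N N.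
        (\<forall>s\<in>{0..2*pi}. \<forall>t\<in>{0..2*pi}. s \<le> t \<longrightarrow> psd N (M t - M s)) \<and>
        M 0 = 0\<^sub>m N N \<and>
        (\<forall>t\<in>{0<..2*pi}. \<forall>k<N. \<forall>l<N.
           ((\<lambda>s. M s $$ (k, l)) \<longlongrightarrow> M t $$ (k, l)) (at_left t)) \<and>
        (\<forall>n\<le>d. \<forall>k<N. \<forall>l<N.
           has_RS_integral (\<lambda>t. exp (\<i> * of_nat n * complex_of_real t)) (\<lambda>t. M t $$ (k, l))
             0 (2*pi) (S n $$ (k, l)))}"

text \<open>The moments extended by \<open>S\<^sub>-\<^sub>n = S\<^sub>n\<^sup>*\<close>, and the block Toeplitz matrix \<open>T\<^sub>d\<close>.\<close>

definition moment :: "(nat \<Rightarrow> complex mat) \<Rightarrow> int \<Rightarrow> complex mat" where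
  "moment S n = (if 0 \<le> n then S (nat n) else mat_adjoint (S (nat (- n))))"

definition block_toeplitz :: "nat \<Rightarrow> nat \<Rightarrow> (nat \<Rightarrow> complex mat) \<Rightarrow> complex mat" where
  "block_toeplitz N d S =
     mat ((d + 1) * N) ((d + 1) * N)
       (\<lambda>(n, m). moment S (int (n div N) - int (m div N)) $$ (n mod N, m mod N))"

text \<open>\<open>Lin {x\<^sub>0, \<dots>, x\<^sub>n\<^sub>-\<^sub>1}\<close>\<close>

definition lin_hull :: "'a hspace \<Rightarrow> (nat \<Rightarrow> 'a) \<Rightarrow> nat \<Rightarrow> 'a set" where
  "lin_hull H x n = module.span class_ring H (x ` {..<n})"

text \<open>The operator \<open>\<Sum> \<alpha>\<^sub>k x\<^sub>k \<mapsto> \<Sum> \<alpha>\<^sub>k x\<^sub>k\<^sub>+\<^sub>N\<close> (sums over \<open>k < n\<close>) with domain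
  \<^term>\<open>lin_hull H x n\<close>; the \<open>x\<^sub>k\<close> may be linearly dependent.\<close>

definition shift_op :: "'a hspace \<Rightarrow> (nat \<Rightarrow> 'a) \<Rightarrow> nat \<Rightarrow> nat \<Rightarrow> 'a \<Rightarrow> 'a" where
  "shift_op H x N n v =
     (THE w. \<exists>\<alpha>. v = (\<Oplus>\<^bsub>H\<^esub> k\<in>{..<n}. \<alpha> k \<odot>\<^bsub>H\<^esub> x k) \<and>
                  w = (\<Oplus>\<^bsub>H\<^esub> k\<in>{..<n}. \<alpha> k \<odot>\<^bsub>H\<^esub> x (k + N)))"

definition spectral_matrix ::
  "'a hspace \<Rightarrow> (nat \<Rightarrow> 'a) \<Rightarrow> nat \<Rightarrow> (real \<Rightarrow> 'a \<Rightarrow> 'a) \<Rightarrow> real \<Rightarrow> complex mat" where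
  "spectral_matrix H x N E =
     (\<lambda>t\<in>{0..2*pi}. mat N N (\<lambda>(k, j). sprod H (E t (x k)) (x j)))"

end

theory Submission
  imports
    Defs
    "HOL-Analysis.Complex_Transcendental"
    "HOL-Analysis.Abstract_Topology_2"
begin

text \<open>
  A unitary extension \<open>U\<close> of \<open>A\<close> satisfies \<open>U\<^sup>n x\<^sub>k = x\<^sub>k\<^sub>+\<^sub>n\<^sub>N\<close> for \<open>k < N\<close>, \<open>n \<le> d\<close>, so
  \<open>\<integral> e\<^sup>i\<^sup>n\<^sup>t d(E\<^sub>t x\<^sub>k, x\<^sub>j) = (x\<^sub>k\<^sub>+\<^sub>n\<^sub>N, x\<^sub>j)\<close> is the required moment.  A spectral function is determined by
  the numbers \<open>(E\<^sub>t x\<^sub>k, x\<^sub>j)\<close> with \<open>k, j < N\<close>, since \<open>(E\<^sub>t x\<^sub>k\<^sub>+\<^sub>N, w)\<close> is the integral of \<open>e\<^sup>i\<^sup>\<tau>\<close> against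
  \<open>\<tau> \<mapsto> (E\<^sub>m\<^sub>i\<^sub>n\<^sub>(\<^sub>\<tau>\<^sub>,\<^sub>t\<^sub>) x\<^sub>k, w)\<close>.

  Conversely, a solution \<open>M\<close> gives the positive semidefinite kernel \<open>m\<^sub>k\<^sub>j(min s t)\<close> on pairs \<open>(s, k)\<close>,
  \<open>(t, j)\<close>.  An infinite Cholesky factorisation over rational times, followed by limits from the
  left, represents it as a Gram matrix \<open>(e\<^sub>s\<^sub>k, e\<^sub>t\<^sub>j)\<close> in \<open>l\<^sup>2\<close>.  The projections that stop these
  curves at time \<open>t\<close> form a resolution of unity, the associated unitary operator \<open>U\<close> is the limit
  of Riemann sums, and \<open>x\<^sub>k\<^sub>+\<^sub>n\<^sub>N \<mapsto> U\<^sup>n e\<^sub>2\<^sub>\<pi>\<^sub>k\<close> embeds \<open>H\<close> isometrically.  The space \<open>l\<^sup>2\<close> has the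
  cardinality of the continuum, hence fits into the type of any nonzero \<open>H\<close>; this is why all
  spectral functions already arise from extension spaces over that type.
\<close>

section \<open>Inner product spaces\<close>

text \<open>A resolution of unity determines \<open>U\<close> only through a weak integral, one pair
  of vectors at a time, whereas the moments involve powers of \<open>U\<close> and the converse
  needs an operator that is onto. Both are settled by one estimate: for an integrand with Lipschitz
  constant 1, Riemann sums over divisions of fineness \<delta> and \<eta> differ in operator norm by
  at most \<delta> + \<eta>. It holds because the increments of a spectral family over a division
  are mutually orthogonal projections, so that no variation of the integrator enters. Riemann sums
  therefore converge strongly, and their algebra (products, adjoints, isometry) survives in the
  limit. The kernel with the minimum is forced: a spectral family satisfies (F_s y, F_t w) =
  (F_min(s,t) y, w), so the vectors F_t y_k to be found must have exactly this Gram matrix. Times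
  are first restricted to rationals because the Cholesky recursion runs over the natural numbers;
  left continuity of M recovers the other times.\<close>

locale inner_space = vectorspace "class_ring :: complex ring" H for H :: "'a hspace" (structure) +
  assumes sprod_add_left:
    "\<lbrakk>x \<in> carrier H; y \<in> carrier H; z \<in> carrier H\<rbrakk>
      \<Longrightarrow> sprod H (x \<oplus>\<^bsub>H\<^esub> y) z = sprod H x z + sprod H y z"
  and sprod_smult_left:
    "\<lbrakk>x \<in> carrier H; y \<in> carrier H\<rbrakk> \<Longrightarrow> sprod H (c \<odot>\<^bsub>H\<^esub> x) y = c * sprod H x y"
  and sprod_commute:
    "\<lbrakk>x \<in> carrier H; y \<in> carrier H\<rbrakk> \<Longrightarrow> sprod H y x = cnj (sprod H x y)"
  and sprod_nonneg: "x \<in> carrier H \<Longrightarrow> 0 \<le> sprod H x x"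
  and sprod_definite: "\<lbrakk>x \<in> carrier H; sprod H x x = 0\<rbrakk> \<Longrightarrow> x = \<zero>\<^bsub>H\<^esub>"
begin

lemma smult_carrier [simp]: "x \<in> carrier H \<Longrightarrow> c \<odot> x \<in> carrier H"
  by (rule smult_closed) auto

lemma sprod_smult_right [simp]:
  "\<lbrakk>x \<in> carrier H; y \<in> carrier H\<rbrakk> \<Longrightarrow> sprod H x (c \<odot> y) = cnj c * sprod H x y"
  using sprod_smult_left[of y x c] sprod_commute[of "c \<odot> y" x] sprod_commute[of y x] by simp

lemma sprod_add_right [simp]:
  "\<lbrakk>x \<in> carrier H; y \<in> carrier H; z \<in> carrier H\<rbrakk>
    \<Longrightarrow> sprod H x (y \<oplus> z) = sprod H x y + sprod H x z"
  using sprod_add_left[of y z x] sprod_commute[of "y \<oplus> z" x] sprod_commute[of y x]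
    sprod_commute[of z x] by simp

declare sprod_add_left [simp] sprod_smult_left [simp]

lemma minus_eq_smult: "x \<in> carrier H \<Longrightarrow> y \<in> carrier H \<Longrightarrow> x \<ominus> y = x \<oplus> (- 1) \<odot> y"
proof -
  assume "x \<in> carrier H" "y \<in> carrier H"
  have "\<ominus>\<^bsub>class_ring\<^esub> (1::complex) = - 1"
    by (simp add: class_ring_simps)
  then show "y \<in> carrier H \<Longrightarrow> x \<ominus> y = x \<oplus> (- 1) \<odot> y"
    using smult_minus_1[of y] by (simp add: a_minus_def)
qed

lemma minus_carrier [simp]: "x \<in> carrier H \<Longrightarrow> y \<in> carrier H \<Longrightarrow> x \<ominus> y \<in> carrier H"
  by simp

lemma sprod_minus_left [simp]:
  "\<lbrakk>x \<in> carrier H; y \<in> carrier H; z \<in> carrier H\<rbrakk>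
    \<Longrightarrow> sprod H (x \<ominus> y) z = sprod H x z - sprod H y z"
  by (simp add: minus_eq_smult)

lemma sprod_minus_right [simp]:
  "\<lbrakk>x \<in> carrier H; y \<in> carrier H; z \<in> carrier H\<rbrakk>
    \<Longrightarrow> sprod H x (y \<ominus> z) = sprod H x y - sprod H x z"
  by (simp add: minus_eq_smult)

lemma sprod_zero_left [simp]: "x \<in> carrier H \<Longrightarrow> sprod H \<zero> x = 0"
  using sprod_add_left[of "\<zero>" "\<zero>" x] by simp

lemma sprod_zero_right [simp]: "x \<in> carrier H \<Longrightarrow> sprod H x \<zero> = 0"
  using sprod_add_right[of x "\<zero>" "\<zero>"] by simp

lemma sprod_finsum_left:
  assumes "\<And>i. i \<in> I \<Longrightarrow> v i \<in> carrier H" "z \<in> carrier H"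
  shows "sprod H (\<Oplus>i\<in>I. v i) z = (\<Sum>i\<in>I. sprod H (v i) z)"
  using assms
proof (induction I rule: infinite_finite_induct)
  case (insert i I)
  then show ?case by (subst finsum_insert) (auto simp: Pi_def)
qed auto

lemma sprod_finsum_right:
  assumes "\<And>i. i \<in> I \<Longrightarrow> v i \<in> carrier H" "z \<in> carrier H"
  shows "sprod H z (\<Oplus>i\<in>I. v i) = (\<Sum>i\<in>I. sprod H z (v i))"
  using assms
proof (induction I rule: infinite_finite_induct)
  case (insert i I)
  then show ?case by (subst finsum_insert) (auto simp: Pi_def)
qed auto

text \<open>Most vector identities below are proved by testing against an arbitrary z: the
  simplification rules for \<open>sprod\<close> then leave an identity of complex numbers.\<close>

lemma vec_eqI:
  assumes "x \<in> carrier H" "y \<in> carrier H" "\<And>z. z \<in> carrier H \<Longrightarrow> sprod H x z = sprod H y z"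
  shows "x = y"
proof -
  have "sprod H (x \<ominus> y) (x \<ominus> y) = 0"
    using assms(1,2) assms(3)[of x] assms(3)[of y] by simp
  then have "x \<ominus> y = \<zero>" using assms by (intro sprod_definite) auto
  then have "x \<ominus> y \<oplus> y = \<zero> \<oplus> y" by simp
  then show ?thesis using assms(1,2) by (simp add: a_minus_def a_assoc l_neg)
qed

lemma minus_zero [simp]: "x \<in> carrier H \<Longrightarrow> x \<ominus> \<zero> = x"
  by (intro vec_eqI) auto

lemma minus_eq_zero_iff: "x \<in> carrier H \<Longrightarrow> y \<in> carrier H \<Longrightarrow> x \<ominus> y = \<zero> \<longleftrightarrow> x = y"
proof
  assume c: "x \<in> carrier H" "y \<in> carrier H" and "x \<ominus> y = \<zero>"
  then have "sprod H x z - sprod H y z = 0" if "z \<in> carrier H" for z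
    using that sprod_minus_left[of x y z] by simp
  then show "x = y" using c by (intro vec_eqI) auto
qed (intro vec_eqI, auto)

lemma hnorm_nonneg [simp]: "x \<in> carrier H \<Longrightarrow> 0 \<le> hnorm H x"
  using sprod_nonneg[of x] by (simp add: hnorm_def less_eq_complex_def)

lemma sprod_self: "x \<in> carrier H \<Longrightarrow> sprod H x x = complex_of_real ((hnorm H x)\<^sup>2)"
  using sprod_nonneg[of x] by (simp add: hnorm_def less_eq_complex_def complex_eq_iff)

lemma hnorm_sq: "x \<in> carrier H \<Longrightarrow> (hnorm H x)\<^sup>2 = Re (sprod H x x)"
  by (simp add: sprod_self)

lemma hnorm_eq_0: "x \<in> carrier H \<Longrightarrow> hnorm H x = 0 \<longleftrightarrow> x = \<zero>"
  using sprod_self[of x] sprod_definite[of x] sprod_zero_left[of \<zero>] by (auto simp: hnorm_def)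

lemma hnorm_smult [simp]: "x \<in> carrier H \<Longrightarrow> hnorm H (c \<odot> x) = cmod c * hnorm H x"
proof -
  assume x: "x \<in> carrier H"
  have "c * (cnj c * sprod H x x) = complex_of_real ((cmod c * hnorm H x)\<^sup>2)"
    by (simp add: sprod_self[OF x] power_mult_distrib complex_norm_square mult.assoc
        del: of_real_power)
  then have "complex_of_real ((hnorm H (c \<odot> x))\<^sup>2) = complex_of_real ((cmod c * hnorm H x)\<^sup>2)"
    using x by (simp add: sprod_self[symmetric] mult.left_commute del: of_real_power)
  then have "(hnorm H (c \<odot> x))\<^sup>2 = (cmod c * hnorm H x)\<^sup>2"
    by (simp only: of_real_eq_iff)
  then show ?thesis by (rule power2_eq_imp_eq) (use x in simp_all)
qed

lemma Cauchy_Schwarz: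
  assumes "x \<in> carrier H" "y \<in> carrier H"
  shows "cmod (sprod H x y) \<le> hnorm H x * hnorm H y"
proof (cases "y = \<zero>")
  case True
  then show ?thesis using assms by simp
next
  case False
  let ?b = "sprod H x y" and ?n = "(hnorm H y)\<^sup>2"
  have pos: "?n > 0" using False hnorm_eq_0[OF assms(2)] by simp
  \<comment> \<open>The component of x orthogonal to y, scaled by the squared norm of y so that no
    division occurs.\<close>
  let ?v = "complex_of_real ?n \<odot> x \<ominus> ?b \<odot> y"
  have "sprod H ?v ?v = of_real ?n * of_real ?n * sprod H x x - of_real ?n * ?b * cnj ?b
      - of_real ?n * ?b * cnj ?b + ?b * cnj ?b * sprod H y y"
    using assms by (simp add: sprod_commute[OF assms] algebra_simps)
  also have "\<dots> = complex_of_real (?n * (?n * (hnorm H x)\<^sup>2 - (cmod ?b)\<^sup>2))"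
  proof -
    have "n * n * X - n * b * cnj b - n * b * cnj b + b * cnj b * n = n * (n * X - b * cnj b)"
      for n X b :: complex
      by (simp add: algebra_simps)
    then show ?thesis
      unfolding of_real_mult of_real_diff complex_norm_square sprod_self[OF assms(1)]
        sprod_self[OF assms(2)] .
  qed
  finally have v: "sprod H ?v ?v = complex_of_real (?n * (?n * (hnorm H x)\<^sup>2 - (cmod ?b)\<^sup>2))" .
  have "0 \<le> sprod H ?v ?v" using assms by (intro sprod_nonneg) simp
  then have "0 \<le> ?n * (?n * (hnorm H x)\<^sup>2 - (cmod ?b)\<^sup>2)"
    unfolding v less_eq_complex_def by (simp only: Re_complex_of_real zero_complex.sel)
  then have "(cmod ?b)\<^sup>2 \<le> (hnorm H x * hnorm H y)\<^sup>2"
    using pos mult.commute[of ?n "(hnorm H x)\<^sup>2"]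
    by (simp add: zero_le_mult_iff power_mult_distrib)
  then show ?thesis by (rule power2_le_imp_le) (use assms in simp)
qed

lemma hnorm_triangle:
  assumes "x \<in> carrier H" "y \<in> carrier H"
  shows "hnorm H (x \<oplus> y) \<le> hnorm H x + hnorm H y"
proof -
  have "Re (sprod H x y) \<le> hnorm H x * hnorm H y"
    using Cauchy_Schwarz[OF assms] complex_Re_le_cmod order_trans by blast
  moreover have "Re (sprod H y x) \<le> hnorm H x * hnorm H y"
    using Cauchy_Schwarz[OF assms(2,1)] complex_Re_le_cmod order_trans by (metis mult.commute)
  ultimately have "(hnorm H (x \<oplus> y))\<^sup>2 \<le> (hnorm H x + hnorm H y)\<^sup>2"
    using assms by (simp add: hnorm_sq power2_sum)
  then show ?thesis by (rule power2_le_imp_le) (use assms in simp)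
qed

lemma minus_minus_add:
  assumes "x \<in> carrier H" "y \<in> carrier H" "z \<in> carrier H"
  shows "(x \<ominus> y) \<oplus> (y \<ominus> z) = x \<ominus> z"
  using assms by (intro vec_eqI) auto

lemma hnorm_minus_commute:
  assumes "x \<in> carrier H" "y \<in> carrier H"
  shows "hnorm H (x \<ominus> y) = hnorm H (y \<ominus> x)"
proof -
  have "x \<ominus> y = (- 1) \<odot> (y \<ominus> x)" using assms by (intro vec_eqI) auto
  then show ?thesis using assms by simp
qed

lemma hnorm_triangle_minus:
  assumes "x \<in> carrier H" "y \<in> carrier H" "z \<in> carrier H"
  shows "hnorm H (x \<ominus> z) \<le> hnorm H (x \<ominus> y) + hnorm H (y \<ominus> z)"
  using hnorm_triangle[of "x \<ominus> y" "y \<ominus> z"] assms by (simp add: minus_minus_add)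

lemma hnorm_zero [simp]: "hnorm H \<zero> = 0"
  by (simp add: hnorm_eq_0)

lemma hnorm_le_diff:
  assumes "x \<in> carrier H" "y \<in> carrier H"
  shows "\<bar>hnorm H x - hnorm H y\<bar> \<le> hnorm H (x \<ominus> y)"
  using hnorm_triangle_minus[of x y \<zero>] hnorm_triangle_minus[of y x \<zero>] assms
    hnorm_minus_commute[OF assms] by simp

definition converges :: "(nat \<Rightarrow> 'a) \<Rightarrow> 'a \<Rightarrow> bool" where
  "converges \<sigma> l \<longleftrightarrow> (\<forall>n. \<sigma> n \<in> carrier H) \<and> l \<in> carrier H \<and> (\<lambda>n. hnorm H (\<sigma> n \<ominus> l)) \<longlonglongrightarrow> 0"

definition Cauchy_seq :: "(nat \<Rightarrow> 'a) \<Rightarrow> bool" where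
  "Cauchy_seq \<sigma> \<longleftrightarrow> (\<forall>n. \<sigma> n \<in> carrier H) \<and>
     (\<forall>e>0. \<exists>n0. \<forall>m\<ge>n0. \<forall>n\<ge>n0. hnorm H (\<sigma> m \<ominus> \<sigma> n) < e)"

lemma Metric_space: "Metric_space (carrier H) (hdist H)"
proof
  fix x y z
  show "0 \<le> hdist H x y" by (simp add: hdist_def)
  show "hdist H x y = hdist H y x" by (simp add: hdist_def hnorm_minus_commute)
  assume "x \<in> carrier H" "y \<in> carrier H"
  then show "(hdist H x y = 0) = (x = y)"
    by (auto simp: hdist_def hnorm_eq_0 minus_eq_zero_iff)
  assume "z \<in> carrier H"
  then show "hdist H x z \<le> hdist H x y + hdist H y z"
    using \<open>x \<in> carrier H\<close> \<open>y \<in> carrier H\<close> by (simp add: hdist_def hnorm_triangle_minus)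
qed

text \<open>Cauchy sequences of the metric space lie in the carrier, where \<open>hdist\<close> is
  the norm distance, so the conventional value outside the carrier never interferes. All later
  completeness arguments use the sequential form.\<close>

lemma mcomplete_iff:
  "Metric_space.mcomplete (carrier H) (hdist H) \<longleftrightarrow> (\<forall>\<sigma>. Cauchy_seq \<sigma> \<longrightarrow> (\<exists>l. converges \<sigma> l))"
proof -
  interpret M: Metric_space "carrier H" "hdist H" by (rule Metric_space)
  have C: "M.MCauchy \<sigma> \<longleftrightarrow> Cauchy_seq \<sigma>" for \<sigma>
    by (auto simp: M.MCauchy_def Cauchy_seq_def hdist_def image_subset_iff)
  have L: "limitin M.mtopology \<sigma> l sequentially \<longleftrightarrow> converges \<sigma> l"
    if "Cauchy_seq \<sigma>" for \<sigma> l
  proof -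
    have "\<sigma> n \<in> carrier H" for n using that by (simp add: Cauchy_seq_def)
    then show ?thesis
      by (auto simp: M.limitin_metric_dist_null converges_def hdist_def)
  qed
  show ?thesis unfolding M.mcomplete_def using C L by blast
qed

lemma converges_carrier: "converges \<sigma> l \<Longrightarrow> l \<in> carrier H" "converges \<sigma> l \<Longrightarrow> \<sigma> n \<in> carrier H"
  by (auto simp: converges_def)

lemma converges_Cauchy: "converges \<sigma> l \<Longrightarrow> Cauchy_seq \<sigma>"
  unfolding Cauchy_seq_def
proof safe
  assume c: "converges \<sigma> l"
  then show "\<sigma> n \<in> carrier H" for n by (simp add: converges_def)
  fix e :: real assume "e > 0"
  then obtain n0 where n0: "\<And>n. n \<ge> n0 \<Longrightarrow> hnorm H (\<sigma> n \<ominus> l) < e / 2"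
    using c unfolding converges_def LIMSEQ_iff
    by (metis diff_zero half_gt_zero hnorm_nonneg minus_carrier real_norm_def abs_of_nonneg)
  have "hnorm H (\<sigma> m \<ominus> \<sigma> n) < e" if "m \<ge> n0" "n \<ge> n0" for m n
    using hnorm_triangle_minus[of "\<sigma> m" l "\<sigma> n"] n0[OF that(1)] n0[OF that(2)]
      hnorm_minus_commute[of l "\<sigma> n"] c by (simp add: converges_def)
  then show "\<exists>n0. \<forall>m\<ge>n0. \<forall>n\<ge>n0. hnorm H (\<sigma> m \<ominus> \<sigma> n) < e" by blast
qed

lemma converges_sprod:
  assumes "converges \<sigma> l" "w \<in> carrier H"
  shows "(\<lambda>n. sprod H (\<sigma> n) w) \<longlonglongrightarrow> sprod H l w"
proof -
  have *: "(\<lambda>n. hnorm H (\<sigma> n \<ominus> l) * hnorm H w) \<longlonglongrightarrow> 0"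
    using assms by (auto simp: converges_def intro: tendsto_mult_left_zero)
  have "(\<lambda>n. sprod H (\<sigma> n) w - sprod H l w) \<longlonglongrightarrow> 0"
  proof (rule Lim_null_comparison[OF _ *], rule always_eventually, safe)
    fix n
    have "\<sigma> n \<in> carrier H" "l \<in> carrier H" using assms by (auto simp: converges_def)
    then show "norm (sprod H (\<sigma> n) w - sprod H l w) \<le> hnorm H (\<sigma> n \<ominus> l) * hnorm H w"
      using Cauchy_Schwarz[of "\<sigma> n \<ominus> l" w] assms(2) by simp
  qed
  then show ?thesis by (simp add: Lim_null[symmetric])
qed

lemma converges_hnorm:
  assumes "converges \<sigma> l"
  shows "(\<lambda>n. hnorm H (\<sigma> n)) \<longlonglongrightarrow> hnorm H l"
proof -
  have *: "(\<lambda>n. hnorm H (\<sigma> n \<ominus> l)) \<longlonglongrightarrow> 0" using assms by (simp add: converges_def)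
  have "(\<lambda>n. hnorm H (\<sigma> n) - hnorm H l) \<longlonglongrightarrow> 0"
    using assms hnorm_le_diff
    by (intro Lim_null_comparison[OF _ *] always_eventually) (auto simp: converges_def)
  then show ?thesis by (simp add: Lim_null[symmetric])
qed

lemma converges_unique: "converges \<sigma> l \<Longrightarrow> converges \<sigma> l' \<Longrightarrow> l = l'"
  by (rule vec_eqI) (blast dest: converges_carrier(1), blast dest: converges_carrier(1),
    blast intro: LIMSEQ_unique converges_sprod)

lemma converges_sprod2:
  assumes "converges \<sigma> l" "converges \<tau> m"
  shows "(\<lambda>n. sprod H (\<sigma> n) (\<tau> n)) \<longlonglongrightarrow> sprod H l m"
proof -
  have c: "\<sigma> n \<in> carrier H" "\<tau> n \<in> carrier H" "l \<in> carrier H" "m \<in> carrier H" for n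
    using assms by (auto simp: converges_def)
  have "(\<lambda>n. hnorm H (\<sigma> n) * hnorm H (\<tau> n \<ominus> m)) \<longlonglongrightarrow> hnorm H l * 0"
    by (rule tendsto_mult[OF converges_hnorm[OF assms(1)]]) (use assms in \<open>simp add: converges_def\<close>)
  then have *: "(\<lambda>n. hnorm H (\<sigma> n) * hnorm H (\<tau> n \<ominus> m)) \<longlonglongrightarrow> 0" by simp
  have "(\<lambda>n. sprod H (\<sigma> n) (\<tau> n) - sprod H (\<sigma> n) m) \<longlonglongrightarrow> 0"
  proof (rule Lim_null_comparison[OF _ *], rule always_eventually, safe)
    show "norm (sprod H (\<sigma> n) (\<tau> n) - sprod H (\<sigma> n) m) \<le> hnorm H (\<sigma> n) * hnorm H (\<tau> n \<ominus> m)" for n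
      using Cauchy_Schwarz[of "\<sigma> n" "\<tau> n \<ominus> m"] c by simp
  qed
  from tendsto_add[OF this converges_sprod[OF assms(1) c(4)]] show ?thesis by simp
qed

lemma converges_add:
  assumes "converges \<sigma> l" "converges \<tau> m"
  shows "converges (\<lambda>n. \<sigma> n \<oplus> \<tau> n) (l \<oplus> m)"
proof -
  have c: "\<sigma> n \<in> carrier H" "\<tau> n \<in> carrier H" "l \<in> carrier H" "m \<in> carrier H" for n
    using assms by (auto simp: converges_def)
  have *: "(\<lambda>n. hnorm H (\<sigma> n \<ominus> l) + hnorm H (\<tau> n \<ominus> m)) \<longlonglongrightarrow> 0 + 0"
    by (rule tendsto_add) (use assms in \<open>simp_all add: converges_def\<close>)
  have e: "(\<sigma> n \<oplus> \<tau> n) \<ominus> (l \<oplus> m) = (\<sigma> n \<ominus> l) \<oplus> (\<tau> n \<ominus> m)" for n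
    using c by (intro vec_eqI) auto
  have "(\<lambda>n. hnorm H ((\<sigma> n \<oplus> \<tau> n) \<ominus> (l \<oplus> m))) \<longlonglongrightarrow> 0"
    unfolding e
    by (intro Lim_null_comparison[OF _ *[simplified]] always_eventually allI)
      (use c in \<open>simp add: hnorm_triangle\<close>)
  then show ?thesis using c by (simp add: converges_def)
qed

lemma converges_smult:
  assumes "converges \<sigma> l"
  shows "converges (\<lambda>n. c \<odot> \<sigma> n) (c \<odot> l)"
proof -
  have c: "\<sigma> n \<in> carrier H" "l \<in> carrier H" for n
    using assms by (auto simp: converges_def)
  have e: "(c \<odot> \<sigma> n) \<ominus> (c \<odot> l) = c \<odot> (\<sigma> n \<ominus> l)" for n
    using c by (intro vec_eqI) (auto simp: algebra_simps)
  have "(\<lambda>n. cmod c * hnorm H (\<sigma> n \<ominus> l)) \<longlonglongrightarrow> 0"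
    by (rule tendsto_mult_right_zero) (use assms in \<open>simp add: converges_def\<close>)
  then show ?thesis using c by (simp add: converges_def e)
qed

lemma finsum_carrier: "(\<And>i. i \<in> I \<Longrightarrow> v i \<in> carrier H) \<Longrightarrow> (\<Oplus>i\<in>I. v i) \<in> carrier H"
  by (rule finsum_closed) auto

end

sublocale hilbert_space \<subseteq> inner_space
  by unfold_locales (fact sprod_add_left sprod_smult_left sprod_commute sprod_nonneg sprod_definite)+

lemma (in inner_space) hilbert_spaceI:
  assumes "\<And>\<sigma>. Cauchy_seq \<sigma> \<Longrightarrow> \<exists>l. converges \<sigma> l"
  shows "hilbert_space H"
  by unfold_locales
    (fact sprod_add_left sprod_smult_left sprod_commute sprod_nonneg sprod_definite |
      simp add: mcomplete_iff assms)+

lemma (in hilbert_space) Cauchy_converges: "Cauchy_seq \<sigma> \<Longrightarrow> \<exists>l. converges \<sigma> l"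
  using complete mcomplete_iff by blast

lemma linear_mapI:
  assumes "inner_space H" "inner_space K"
    "\<And>v. v \<in> carrier H \<Longrightarrow> f v \<in> carrier K"
    "\<And>v w. v \<in> carrier H \<Longrightarrow> w \<in> carrier H \<Longrightarrow> f (v \<oplus>\<^bsub>H\<^esub> w) = f v \<oplus>\<^bsub>K\<^esub> f w"
    "\<And>c v. v \<in> carrier H \<Longrightarrow> f (c \<odot>\<^bsub>H\<^esub> v) = c \<odot>\<^bsub>K\<^esub> f v"
  shows "linear_map class_ring H K f"
  using assms
  by (auto simp: linear_map_def mod_hom_def mod_hom_axioms_def module_hom_def inner_space_def
      vectorspace_def)

lemma linear_map_facts:
  assumes "linear_map class_ring H K f"
  shows "v \<in> carrier H \<Longrightarrow> f v \<in> carrier K"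
    "v \<in> carrier H \<Longrightarrow> w \<in> carrier H \<Longrightarrow> f (v \<oplus>\<^bsub>H\<^esub> w) = f v \<oplus>\<^bsub>K\<^esub> f w"
    "v \<in> carrier H \<Longrightarrow> f (c \<odot>\<^bsub>H\<^esub> v) = c \<odot>\<^bsub>K\<^esub> f v"
  using assms
  by (auto simp: linear_map_def mod_hom_def mod_hom_axioms_def module_hom_def)

lemma orth_projection_facts:
  assumes "orth_projection K P"
  shows "v \<in> carrier K \<Longrightarrow> P v \<in> carrier K"
    "v \<in> carrier K \<Longrightarrow> w \<in> carrier K \<Longrightarrow> P (v \<oplus>\<^bsub>K\<^esub> w) = P v \<oplus>\<^bsub>K\<^esub> P w"
    "v \<in> carrier K \<Longrightarrow> P (c \<odot>\<^bsub>K\<^esub> v) = c \<odot>\<^bsub>K\<^esub> P v"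
    "v \<in> carrier K \<Longrightarrow> P (P v) = P v"
    "v \<in> carrier K \<Longrightarrow> w \<in> carrier K \<Longrightarrow> sprod K (P v) w = sprod K v (P w)"
  using assms linear_map_facts[of K K P] by (auto simp: orth_projection_def)

section \<open>Closed subspaces and orthogonal projections\<close>

context inner_space
begin

definition closed_subspace :: "'a set \<Rightarrow> bool" where
  "closed_subspace L \<longleftrightarrow> L \<subseteq> carrier H \<and> \<zero> \<in> L \<and> (\<forall>v\<in>L. \<forall>w\<in>L. v \<oplus> w \<in> L) \<and>
     (\<forall>c. \<forall>v\<in>L. c \<odot> v \<in> L) \<and> (\<forall>\<sigma> l. (\<forall>n. \<sigma> n \<in> L) \<longrightarrow> converges \<sigma> l \<longrightarrow> l \<in> L)"

lemma closed_subspaceD: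
  assumes "closed_subspace L"
  shows "v \<in> L \<Longrightarrow> v \<in> carrier H" "\<zero> \<in> L" "v \<in> L \<Longrightarrow> w \<in> L \<Longrightarrow> v \<oplus> w \<in> L" "v \<in> L \<Longrightarrow> c \<odot> v \<in> L"
    "(\<And>n. \<sigma> n \<in> L) \<Longrightarrow> converges \<sigma> l \<Longrightarrow> l \<in> L"
    "v \<in> L \<Longrightarrow> w \<in> L \<Longrightarrow> v \<ominus> w \<in> L"
proof -
  show 1: "v \<in> L \<Longrightarrow> v \<in> carrier H" "\<zero> \<in> L" "v \<in> L \<Longrightarrow> w \<in> L \<Longrightarrow> v \<oplus> w \<in> L"
    "v \<in> L \<Longrightarrow> c \<odot> v \<in> L" "(\<And>n. \<sigma> n \<in> L) \<Longrightarrow> converges \<sigma> l \<Longrightarrow> l \<in> L" for v w c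
    using assms unfolding closed_subspace_def by blast+
  show "v \<in> L \<Longrightarrow> w \<in> L \<Longrightarrow> v \<ominus> w \<in> L"
    using 1 by (simp add: minus_eq_smult)
qed

text \<open>By P = P P and symmetry. It lets an inequality between the forms of projections be read
  as one between norms, and conversely.\<close>

lemma sprod_projection_self:
  assumes P: "orth_projection H P" and v: "v \<in> carrier H"
  shows "sprod H (P v) v = complex_of_real ((hnorm H (P v))\<^sup>2)"
proof -
  note Pf = orth_projection_facts[OF P]
  have "sprod H (P v) v = sprod H (P (P v)) v" by (simp only: Pf(4)[OF v])
  also have "\<dots> = sprod H (P v) (P v)" by (rule Pf(5)[OF Pf(1)[OF v] v])
  finally show ?thesis by (simp only: sprod_self[OF Pf(1)[OF v]])
qed

lemma converges_const: "v \<in> carrier H \<Longrightarrow> converges (\<lambda>n. v) v"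
proof -
  assume v: "v \<in> carrier H"
  have "hnorm H (v \<ominus> v) = 0" using v minus_eq_zero_iff[of v v] hnorm_eq_0[of "v \<ominus> v"] by blast
  then show "converges (\<lambda>n. v) v" using v by (simp add: converges_def)
qed

lemma closed_subspace_orth:
  assumes "S \<subseteq> carrier H"
  shows "closed_subspace {v \<in> carrier H. \<forall>w\<in>S. sprod H v w = 0}"
proof -
  have "sprod H l w = 0"
    if "\<And>n. \<forall>w\<in>S. sprod H (\<sigma> n) w = 0" "converges \<sigma> l" "w \<in> S" for \<sigma> l w
  proof -
    have "(\<lambda>n. sprod H (\<sigma> n) w) \<longlonglongrightarrow> sprod H l w"
      using that(2,3) assms by (intro converges_sprod) auto
    then show ?thesis using that(1,3) by (simp add: LIMSEQ_const_iff)
  qed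
  then show ?thesis
    unfolding closed_subspace_def using assms
    by (auto simp: subset_iff converges_carrier(1)) blast
qed

text \<open>The parallelogram law for v - x and v - y. In this shape, a lower bound on the distance
  from v to the midpoint of x and y becomes an upper bound on the distance between x and y.\<close>

lemma parallelogram:
  assumes "x \<in> carrier H" "y \<in> carrier H" "v \<in> carrier H"
  shows "(hnorm H (x \<ominus> y))\<^sup>2 = 2 * (hnorm H (v \<ominus> x))\<^sup>2 + 2 * (hnorm H (v \<ominus> y))\<^sup>2
    - 4 * (hnorm H (v \<ominus> (1/2) \<odot> (x \<oplus> y)))\<^sup>2"
  using assms by (simp add: hnorm_sq algebra_simps)

lemma minimizer_orthogonal:
  assumes u: "u \<in> carrier H" and z: "z \<in> carrier H"
    and min: "\<And>c. (hnorm H u)\<^sup>2 \<le> (hnorm H (u \<ominus> c \<odot> z))\<^sup>2"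
  shows "sprod H u z = 0"
proof -
  let ?c = "sprod H u z"
  \<comment> \<open>Subtracting t (u, z) z from u changes the squared norm by t |(u, z)|^2 (t |z|^2
    - 2). This t makes the last factor negative, also for z = 0.\<close>
  define t where "t = 1 / ((hnorm H z)\<^sup>2 + 1)"
  have t: "t > 0" "t * (hnorm H z)\<^sup>2 < 2"
    by (auto simp: t_def divide_simps add_nonneg_pos add_pos_nonneg)
  let ?d = "of_real t * ?c"
  have zu: "sprod H z u = cnj ?c" by (rule sprod_commute[OF u z])
  have "(hnorm H (u \<ominus> ?d \<odot> z))\<^sup>2
      = Re (sprod H u u - cnj ?d * ?c - ?d * cnj ?c + ?d * cnj ?d * sprod H z z)"
    using u z by (simp add: hnorm_sq zu algebra_simps)
  also have "\<dots> = (hnorm H u)\<^sup>2 - 2 * t * (cmod ?c)\<^sup>2 + t * t * (cmod ?c)\<^sup>2 * (hnorm H z)\<^sup>2"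
    unfolding sprod_self[OF u] sprod_self[OF z] cmod_power2 by (simp add: algebra_simps power2_eq_square)
  finally have "0 \<le> t * ((cmod ?c)\<^sup>2 * (t * (hnorm H z)\<^sup>2 - 2))"
    using min[of ?d] by (simp add: algebra_simps)
  then have "0 \<le> (cmod ?c)\<^sup>2 * (t * (hnorm H z)\<^sup>2 - 2)"
    using t(1) by (simp add: zero_le_mult_iff)
  then have "(cmod ?c)\<^sup>2 \<le> 0"
    using t(2) by (simp add: zero_le_mult_iff)
  then show ?thesis by simp
qed

text \<open>Two candidates differ by a vector of L that is orthogonal to L, hence by zero. The
  description in \<open>proj_onto\<close> can thus be evaluated by exhibiting any candidate.\<close>

lemma proj_onto_eqI:
  assumes L: "closed_subspace L" and v: "v \<in> carrier H"
    and y: "y \<in> L" "\<And>z. z \<in> L \<Longrightarrow> sprod H v z = sprod H y z"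
  shows "proj_onto H L v = y"
  unfolding proj_onto_def
proof (rule the_equality)
  show "y \<in> L \<and> (\<forall>z\<in>L. sprod H (v \<ominus> y) z = 0)"
    using assms closed_subspaceD(1)[OF L] by simp
  fix y' assume y': "y' \<in> L \<and> (\<forall>z\<in>L. sprod H (v \<ominus> y') z = 0)"
  have "sprod H (y' \<ominus> y) z = 0" if "z \<in> L" for z
    using y(2)[OF that] y' that v closed_subspaceD(1)[OF L] y(1) by force
  from this[of "y' \<ominus> y"] have "y' \<ominus> y = \<zero>"
    using closed_subspaceD[OF L] y(1) y' by (intro sprod_definite) auto
  then show "y' = y"
    using minus_eq_zero_iff closed_subspaceD(1)[OF L] y(1) y' by blast
qed

end

context hilbert_space
begin

text \<open>A sequence in L that minimises the distance to v is Cauchy by the parallelogram law,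
  because midpoints stay in L. At its limit, minimality makes the residual orthogonal to L.\<close>

lemma projection_exists:
  assumes L: "closed_subspace L" and v: "v \<in> carrier H"
  shows "\<exists>y\<in>L. \<forall>z\<in>L. sprod H v z = sprod H y z"
proof -
  note LD = closed_subspaceD[OF L]
  define S where "S = (\<lambda>y. (hnorm H (v \<ominus>\<^bsub>H\<^esub> y))\<^sup>2) ` L"
  define d where "d = Inf S"
  have S: "S \<noteq> {}" "bdd_below S"
    using LD(2) by (auto simp: S_def intro!: bdd_belowI[of _ 0])
  have d: "d \<le> (hnorm H (v \<ominus>\<^bsub>H\<^esub> y))\<^sup>2" if "y \<in> L" for y
    unfolding d_def by (rule cInf_lower) (use that S in \<open>auto simp: S_def\<close>)
  have "\<exists>y\<in>L. (hnorm H (v \<ominus>\<^bsub>H\<^esub> y))\<^sup>2 < d + 1 / Suc n" for n :: nat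
    using cInf_lessD[OF S(1), of "d + 1 / Suc n"] by (auto simp: S_def d_def)
  then obtain y where y: "\<And>n. y n \<in> L" "\<And>n :: nat. (hnorm H (v \<ominus>\<^bsub>H\<^esub> y n))\<^sup>2 < d + 1 / Suc n"
    by metis
  have yc [simp]: "y n \<in> carrier H" for n using y(1) LD(1) by blast
  have bound: "(hnorm H (y m \<ominus>\<^bsub>H\<^esub> y n))\<^sup>2 \<le> 2 * (1 / Suc m) + 2 * (1 / Suc n)" for m n
    using d[of "(1/2) \<odot>\<^bsub>H\<^esub> (y m \<oplus>\<^bsub>H\<^esub> y n)"] y LD(3,4) y(2)[of m] y(2)[of n]
    unfolding parallelogram[OF yc yc v] by (smt (verit))
  have "Cauchy_seq y"
    unfolding Cauchy_seq_def
  proof (intro conjI allI impI)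
    fix e :: real assume e: "e > 0"
    obtain n0 :: nat where n0: "1 / Suc n0 < e\<^sup>2 / 4"
      using nat_approx_posE[of "e\<^sup>2 / 4"] e by auto
    have "hnorm H (y m \<ominus>\<^bsub>H\<^esub> y n) < e" if mn: "m \<ge> n0" "n \<ge> n0" for m n
    proof -
      have "1 / real (Suc m) \<le> 1 / Suc n0" "1 / real (Suc n) \<le> 1 / Suc n0"
        using mn by (auto intro!: divide_left_mono)
      then have "(hnorm H (y m \<ominus>\<^bsub>H\<^esub> y n))\<^sup>2 < e\<^sup>2"
        using bound[of m n] n0 by linarith
      then show ?thesis by (rule power2_less_imp_less) (use e in simp)
    qed
    then show "\<exists>n0. \<forall>m\<ge>n0. \<forall>n\<ge>n0. hnorm H (y m \<ominus>\<^bsub>H\<^esub> y n) < e" by blast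
  qed simp
  then obtain l where l: "converges y l" using Cauchy_converges by blast
  have lL: "l \<in> L" using LD(5) y(1) l by blast
  have lc: "l \<in> carrier H" using lL LD(1) by blast
  have cv: "converges (\<lambda>n. v \<oplus>\<^bsub>H\<^esub> (-1) \<odot>\<^bsub>H\<^esub> y n) (v \<oplus>\<^bsub>H\<^esub> (-1) \<odot>\<^bsub>H\<^esub> l)"
    using l v by (intro converges_add converges_smult converges_const)
  have "(\<lambda>n. (hnorm H (v \<ominus>\<^bsub>H\<^esub> y n))\<^sup>2) \<longlonglongrightarrow> (hnorm H (v \<ominus>\<^bsub>H\<^esub> l))\<^sup>2"
    using converges_hnorm[OF cv] v lc by (intro tendsto_power) (simp add: minus_eq_smult)
  moreover have "(\<lambda>n. d + 1 / Suc n) \<longlonglongrightarrow> d + 0"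
    by (intro tendsto_intros LIMSEQ_inverse_real_of_nat[unfolded inverse_eq_divide])
  ultimately have le: "(hnorm H (v \<ominus>\<^bsub>H\<^esub> l))\<^sup>2 \<le> d"
    using y(2) by (auto intro: LIMSEQ_le less_imp_le simp del: of_nat_Suc)
  have "sprod H (v \<ominus>\<^bsub>H\<^esub> l) z = 0" if z: "z \<in> L" for z
  proof (rule minimizer_orthogonal)
    fix c
    have "v \<ominus>\<^bsub>H\<^esub> l \<ominus>\<^bsub>H\<^esub> c \<odot>\<^bsub>H\<^esub> z = v \<ominus>\<^bsub>H\<^esub> (l \<oplus>\<^bsub>H\<^esub> c \<odot>\<^bsub>H\<^esub> z)"
      using v lc z LD(1) by (intro vec_eqI) auto
    then show "(hnorm H (v \<ominus>\<^bsub>H\<^esub> l))\<^sup>2 \<le> (hnorm H (v \<ominus>\<^bsub>H\<^esub> l \<ominus>\<^bsub>H\<^esub> c \<odot>\<^bsub>H\<^esub> z))\<^sup>2"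
      using d[of "l \<oplus>\<^bsub>H\<^esub> c \<odot>\<^bsub>H\<^esub> z"] le LD(3,4) lL z by auto
  qed (use v lc z LD(1) in auto)
  then show ?thesis using lL lc v LD(1) by (intro bexI[of _ l]) auto
qed

lemma proj_onto_props:
  assumes "closed_subspace L" "v \<in> carrier H"
  shows "proj_onto H L v \<in> L" "z \<in> L \<Longrightarrow> sprod H (proj_onto H L v) z = sprod H v z"
proof -
  obtain y where y: "y \<in> L" "\<forall>z\<in>L. sprod H v z = sprod H y z"
    using projection_exists[OF assms] by blast
  then have "proj_onto H L v = y" using assms by (intro proj_onto_eqI) auto
  then show "proj_onto H L v \<in> L" "z \<in> L \<Longrightarrow> sprod H (proj_onto H L v) z = sprod H v z"
    using y by auto
qed

lemma orth_projection_proj_onto: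
  assumes L: "closed_subspace L"
  shows "orth_projection H (proj_onto H L)"
proof -
  let ?P = "proj_onto H L"
  note LD = closed_subspaceD[OF L]
  note P = proj_onto_props[OF L]
  have Pc: "?P v \<in> carrier H" if "v \<in> carrier H" for v using P(1) LD(1) that by blast
  show ?thesis
    unfolding orth_projection_def
  proof (intro conjI ballI linear_mapI)
    fix v w assume v: "v \<in> carrier H" and w: "w \<in> carrier H"
    show "?P (v \<oplus>\<^bsub>H\<^esub> w) = ?P v \<oplus>\<^bsub>H\<^esub> ?P w"
      using v w P LD Pc by (intro proj_onto_eqI L) auto
    have "sprod H (?P v) w = cnj (sprod H w (?P v))" using v w Pc by (intro sprod_commute) auto
    also have "\<dots> = cnj (sprod H (?P w) (?P v))" using v w P by simp
    also have "\<dots> = sprod H (?P v) (?P w)" using v w Pc by (intro sprod_commute[symmetric]) auto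
    also have "\<dots> = sprod H v (?P w)" using v w P by simp
    finally show "sprod H (?P v) w = sprod H v (?P w)" .
  next
    fix v assume v: "v \<in> carrier H"
    show "?P v \<in> carrier H" by (rule Pc[OF v])
    show "?P (c \<odot>\<^bsub>H\<^esub> v) = c \<odot>\<^bsub>H\<^esub> ?P v" for c
      using v P LD Pc by (intro proj_onto_eqI L) auto
    show "?P (?P v) = ?P v"
      using v P LD Pc by (intro proj_onto_eqI L) auto
  qed (rule inner_space_axioms)+
qed

end

section \<open>Finite orthogonal decompositions of the identity\<close>

context inner_space
begin

text \<open>Some of the projections may vanish. This matters because a tagged division may contain
  degenerate intervals.\<close>

definition decomposition :: "'i set \<Rightarrow> ('i \<Rightarrow> 'a \<Rightarrow> 'a) \<Rightarrow> bool" where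
  "decomposition I P \<longleftrightarrow> finite I \<and> (\<forall>i\<in>I. orth_projection H (P i)) \<and>
     (\<forall>i\<in>I. \<forall>j\<in>I. i \<noteq> j \<longrightarrow> (\<forall>v\<in>carrier H. P i (P j v) = \<zero>)) \<and>
     (\<forall>v\<in>carrier H. (\<Oplus>i\<in>I. P i v) = v)"

definition comb :: "('i \<Rightarrow> complex) \<Rightarrow> 'i set \<Rightarrow> ('i \<Rightarrow> 'a \<Rightarrow> 'a) \<Rightarrow> 'a \<Rightarrow> 'a" where
  "comb c I P v = (\<Oplus>i\<in>I. c i \<odot> P i v)"

context
  fixes I :: "'i set" and P
  assumes dec: "decomposition I P"
begin

lemma decomposition_carrier: "i \<in> I \<Longrightarrow> v \<in> carrier H \<Longrightarrow> P i v \<in> carrier H"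
  using dec orth_projection_facts(1)[of H "P i"] by (auto simp: decomposition_def)

lemma decomposition_sym:
  "i \<in> I \<Longrightarrow> v \<in> carrier H \<Longrightarrow> w \<in> carrier H \<Longrightarrow> sprod H (P i v) w = sprod H v (P i w)"
  using dec orth_projection_facts(5)[of H "P i"] by (auto simp: decomposition_def)

lemma decomposition_sum:
  assumes "v \<in> carrier H" "w \<in> carrier H"
  shows "(\<Sum>i\<in>I. sprod H (P i v) w) = sprod H v w"
proof -
  have "(\<Sum>i\<in>I. sprod H (P i v) w) = sprod H (\<Oplus>i\<in>I. P i v) w"
    using assms decomposition_carrier by (simp add: sprod_finsum_left)
  also have "(\<Oplus>i\<in>I. P i v) = v"
    using assms dec by (auto simp: decomposition_def)
  finally show ?thesis .
qed

lemma comb_carrier: "v \<in> carrier H \<Longrightarrow> comb c I P v \<in> carrier H"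
  unfolding comb_def using decomposition_carrier by (intro finsum_carrier) auto

lemma sprod_comb:
  "v \<in> carrier H \<Longrightarrow> w \<in> carrier H \<Longrightarrow> sprod H (comb c I P v) w = (\<Sum>i\<in>I. c i * sprod H (P i v) w)"
  using decomposition_carrier by (simp add: comb_def sprod_finsum_left)

lemma comb_add:
  assumes "v \<in> carrier H" "w \<in> carrier H"
  shows "comb c I P (v \<oplus> w) = comb c I P v \<oplus> comb c I P w"
  using assms decomposition_carrier decomposition_sym
  by (intro vec_eqI) (simp_all add: comb_carrier sprod_comb sum.distrib distrib_left)

lemma comb_smult:
  assumes "v \<in> carrier H"
  shows "comb c I P (a \<odot> v) = a \<odot> comb c I P v"
  using assms decomposition_carrier decomposition_sym
  by (intro vec_eqI) (auto simp: comb_carrier sprod_comb sum_distrib_left mult.left_commute)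

lemma comb_minus:
  assumes "v \<in> carrier H" "w \<in> carrier H"
  shows "comb c I P (v \<ominus> w) = comb c I P v \<ominus> comb c I P w"
  using assms decomposition_carrier by (simp add: minus_eq_smult comb_add comb_smult comb_carrier)

text \<open>Mutual orthogonality leaves only the i-th term. Through it, \<open>comb\<close> becomes
  a functional calculus: products of combinations multiply the coefficients.\<close>

lemma proj_comb:
  assumes "v \<in> carrier H" "i \<in> I"
  shows "P i (comb c I P v) = c i \<odot> P i v"
proof (rule vec_eqI)
  fix w assume w: "w \<in> carrier H"
  have "sprod H (P i (comb c I P v)) w = (\<Sum>j\<in>I. c j * sprod H (P j v) (P i w))"
    using assms w by (simp add: decomposition_sym comb_carrier sprod_comb decomposition_carrier)
  also have "\<dots> = (\<Sum>j\<in>I. if j = i then c i * sprod H (P i v) w else 0)"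
  proof (rule sum.cong[OF refl])
    fix j assume j: "j \<in> I"
    have "sprod H (P j v) (P i w) = sprod H (P i (P j v)) w"
      using assms w j by (simp add: decomposition_sym decomposition_carrier)
    also have "P i (P j v) = (if j = i then P i v else \<zero>)"
      using dec assms j orth_projection_facts(4)[of H "P i" v] by (auto simp: decomposition_def)
    finally show "c j * sprod H (P j v) (P i w) = (if j = i then c i * sprod H (P i v) w else 0)"
      using w by simp
  qed
  also have "\<dots> = c i * sprod H (P i v) w"
    using assms dec by (simp add: decomposition_def)
  finally show "sprod H (P i (comb c I P v)) w = sprod H (c i \<odot> P i v) w"
    using assms w by (simp add: decomposition_carrier)
qed (use assms in \<open>auto simp: decomposition_carrier comb_carrier\<close>)

lemma comb_comb:
  assumes "v \<in> carrier H"
  shows "comb c I P (comb d I P v) = comb (\<lambda>i. c i * d i) I P v"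
  using assms
  by (intro vec_eqI) (auto simp: comb_carrier sprod_comb proj_comb decomposition_carrier mult.assoc)

lemma comb_one: "v \<in> carrier H \<Longrightarrow> (\<And>i. i \<in> I \<Longrightarrow> c i = 1) \<Longrightarrow> comb c I P v = v"
  by (intro vec_eqI) (auto simp: comb_carrier sprod_comb decomposition_sum)

lemma sprod_comb_right:
  assumes "v \<in> carrier H" "w \<in> carrier H"
  shows "sprod H v (comb c I P w) = sprod H (comb (\<lambda>i. cnj (c i)) I P v) w"
proof -
  have "sprod H v (comb c I P w) = cnj (sprod H (comb c I P w) v)"
    using assms by (intro sprod_commute) (auto simp: comb_carrier)
  also have "\<dots> = (\<Sum>i\<in>I. cnj (c i) * sprod H v (P i w))"
    using assms sprod_commute[OF _ assms(1)] by (simp add: sprod_comb decomposition_carrier)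
  finally show ?thesis using assms by (simp add: sprod_comb decomposition_sym)
qed

lemma comb_isometric:
  assumes "v \<in> carrier H" "w \<in> carrier H" "\<And>i. i \<in> I \<Longrightarrow> cmod (c i) = 1"
  shows "sprod H (comb c I P v) (comb c I P w) = sprod H v w"
proof -
  have "cnj (c i) * c i = 1" if "i \<in> I" for i
    using complex_norm_square[of "c i"] assms(3)[OF that] by (simp add: mult.commute[of "cnj (c i)"])
  then show ?thesis
    using assms by (simp add: sprod_comb_right comb_carrier comb_comb comb_one)
qed

lemma hnorm_comb_isometric:
  assumes "v \<in> carrier H" "\<And>i. i \<in> I \<Longrightarrow> cmod (c i) = 1"
  shows "hnorm H (comb c I P v) = hnorm H v"
  using comb_isometric[of v v c] assms by (simp add: hnorm_def)

text \<open>By Pythagoras the squared norm is the sum of |c i|^2 |P i v|^2. Coefficients of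
  vanishing projections are left unrestricted, since on a common refinement most pairs of
  projections have product zero.\<close>

lemma hnorm_comb_le:
  assumes "v \<in> carrier H" "0 \<le> e"
    "\<And>i. i \<in> I \<Longrightarrow> cmod (c i) \<le> e \<or> (\<forall>v\<in>carrier H. P i v = \<zero>)"
  shows "hnorm H (comb c I P v) \<le> e * hnorm H v"
proof (rule power2_le_imp_le)
  have sq: "sprod H (P i v) v = complex_of_real ((hnorm H (P i v))\<^sup>2)" if "i \<in> I" for i
    using dec assms(1) that by (intro sprod_projection_self) (auto simp: decomposition_def)
  have "sprod H (comb c I P v) (comb c I P v) = sprod H (comb (\<lambda>i. cnj (c i) * c i) I P v) v"
    using assms(1) by (simp add: comb_carrier sprod_comb_right comb_comb)
  then have "(hnorm H (comb c I P v))\<^sup>2 = Re (\<Sum>i\<in>I. cnj (c i) * c i * sprod H (P i v) v)"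
    using assms(1) by (simp only: hnorm_sq comb_carrier sprod_comb)
  also have "\<dots> = (\<Sum>i\<in>I. (cmod (c i))\<^sup>2 * (hnorm H (P i v))\<^sup>2)"
    unfolding Re_sum
  proof (rule sum.cong[OF refl])
    fix i assume "i \<in> I"
    have "cnj (c i) * c i * sprod H (P i v) v = of_real ((cmod (c i))\<^sup>2 * (hnorm H (P i v))\<^sup>2)"
      unfolding sq[OF \<open>i \<in> I\<close>] of_real_mult complex_norm_square by simp
    then show "Re (cnj (c i) * c i * sprod H (P i v) v) = (cmod (c i))\<^sup>2 * (hnorm H (P i v))\<^sup>2"
      by (simp only: Re_complex_of_real)
  qed
  also have "\<dots> \<le> (\<Sum>i\<in>I. e\<^sup>2 * (hnorm H (P i v))\<^sup>2)"
  proof (rule sum_mono)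
    fix i assume "i \<in> I"
    then have "cmod (c i) \<le> e \<or> P i v = \<zero>" using assms(3)[of i] assms(1) by blast
    then show "(cmod (c i))\<^sup>2 * (hnorm H (P i v))\<^sup>2 \<le> e\<^sup>2 * (hnorm H (P i v))\<^sup>2"
      by (elim disjE) (simp_all add: mult_right_mono power_mono)
  qed
  also have "\<dots> = e\<^sup>2 * Re (\<Sum>i\<in>I. sprod H (P i v) v)"
    by (simp add: sq sum_distrib_left)
  also have "\<dots> = (e * hnorm H v)\<^sup>2"
    using assms(1) by (simp add: decomposition_sum hnorm_sq power_mult_distrib)
  finally show "(hnorm H (comb c I P v))\<^sup>2 \<le> (e * hnorm H v)\<^sup>2" .
qed (use assms in auto)

end

text \<open>The common refinement of two commuting decompositions, on which combinations of either
  one can be compared.\<close>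

lemma decomposition_product:
  assumes P: "decomposition I P" and Q: "decomposition J Q"
    and com: "\<And>i j v. i \<in> I \<Longrightarrow> j \<in> J \<Longrightarrow> v \<in> carrier H \<Longrightarrow> P i (Q j v) = Q j (P i v)"
  shows "decomposition (I \<times> J) (\<lambda>(i, j) v. P i (Q j v))"
  unfolding decomposition_def
proof (intro conjI ballI impI)
  show "finite (I \<times> J)" using P Q by (auto simp: decomposition_def)
next
  fix ij assume "ij \<in> I \<times> J"
  then obtain i j where ij: "ij = (i, j)" "i \<in> I" "j \<in> J" by auto
  then have Pi: "orth_projection H (P i)" and Qj: "orth_projection H (Q j)"
    using P Q by (auto simp: decomposition_def)
  show "orth_projection H (case ij of (i, j) \<Rightarrow> \<lambda>v. P i (Q j v))"
    unfolding orth_projection_def ij(1) prod.case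
    by (intro conjI ballI linear_mapI inner_space_axioms)
      (simp_all add: orth_projection_facts[OF Pi] orth_projection_facts[OF Qj] ij com)
next
  fix ij kl v assume "ij \<in> I \<times> J" "kl \<in> I \<times> J" and ne: "ij \<noteq> kl" and v: "v \<in> carrier H"
  then obtain i j k l where ij: "ij = (i, j)" "i \<in> I" "j \<in> J" "kl = (k, l)" "k \<in> I" "l \<in> J" by auto
  have Pi: "orth_projection H (P i)" "orth_projection H (P k)"
    and Qj: "orth_projection H (Q j)" "orth_projection H (Q l)"
    using P Q ij by (auto simp: decomposition_def)
  note c = orth_projection_facts(1)[OF Pi(1)] orth_projection_facts(1)[OF Pi(2)]
    orth_projection_facts(1)[OF Qj(1)] orth_projection_facts(1)[OF Qj(2)]

  \<comment> \<open>The fourfold product is regrouped once with the P adjacent and once with the Q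
    adjacent. Distinct index pairs differ in some component, and the two projections of that
    component annihilate each other.\<close>
  have "P i (Q j (P k (Q l v))) = P i (P k (Q j (Q l v)))"
    using ij v c com by simp
  moreover have "P i (Q j (P k (Q l v))) = Q j (Q l (P i (P k v)))"
    using ij v c com by simp
  moreover have "P i (P k (Q j (Q l v))) = \<zero> \<or> Q j (Q l (P i (P k v))) = \<zero>"
  proof (cases "i = k")
    case True
    then have "j \<noteq> l" using ne ij by auto
    then show ?thesis using Q ij v c by (simp add: decomposition_def)
  next
    case False
    then show ?thesis using P ij v c by (simp add: decomposition_def)
  qed
  ultimately have "P i (Q j (P k (Q l v))) = \<zero>" by metis
  then show "(case ij of (i, j) \<Rightarrow> \<lambda>v. P i (Q j v)) ((case kl of (i, j) \<Rightarrow> \<lambda>v. P i (Q j v)) v) = \<zero>"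
    by (simp add: ij)
next
  fix v assume v: "v \<in> carrier H"
  note c = decomposition_carrier[OF P] decomposition_carrier[OF Q]
  show "(\<Oplus>ij\<in>I \<times> J. (case ij of (i, j) \<Rightarrow> \<lambda>v. P i (Q j v)) v) = v"
  proof (rule vec_eqI)
    fix w assume w: "w \<in> carrier H"
    have "sprod H (\<Oplus>ij\<in>I \<times> J. (case ij of (i, j) \<Rightarrow> \<lambda>v. P i (Q j v)) v) w
        = (\<Sum>(i, j)\<in>I \<times> J. sprod H (P i (Q j v)) w)"
      using v w c by (subst sprod_finsum_left) (auto simp: case_prod_unfold)
    also have "\<dots> = (\<Sum>i\<in>I. \<Sum>j\<in>J. sprod H (Q j v) (P i w))"
      using v w c by (simp add: sum.cartesian_product[symmetric] decomposition_sym[OF P])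
    also have "\<dots> = sprod H v w"
    proof -
      have "(\<Sum>j\<in>J. sprod H (Q j v) (P i w)) = sprod H (P i v) w" if "i \<in> I" for i
        using that v w c by (simp add: decomposition_sum[OF Q] decomposition_sym[OF P])
      then show ?thesis using v w by (simp add: decomposition_sum[OF P])
    qed
    finally show "sprod H (\<Oplus>ij\<in>I \<times> J. (case ij of (i, j) \<Rightarrow> \<lambda>v. P i (Q j v)) v) w = sprod H v w" .
  qed (use v c in \<open>auto intro!: finsum_carrier\<close>)
qed

text \<open>On the common refinement the difference has the coefficients c i - d j, and only pairs
  with a nonzero product count.\<close>

lemma hnorm_comb_diff_le:
  assumes P: "decomposition I P" and Q: "decomposition J Q"
    and com: "\<And>i j v. i \<in> I \<Longrightarrow> j \<in> J \<Longrightarrow> v \<in> carrier H \<Longrightarrow> P i (Q j v) = Q j (P i v)"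
    and close: "\<And>i j. i \<in> I \<Longrightarrow> j \<in> J \<Longrightarrow>
      cmod (c i - d j) \<le> e \<or> (\<forall>v\<in>carrier H. P i (Q j v) = \<zero>)"
    and v: "v \<in> carrier H" and e: "0 \<le> e"
  shows "hnorm H (comb c I P v \<ominus> comb d J Q v) \<le> e * hnorm H v"
proof -
  let ?R = "\<lambda>(i, j) v. P i (Q j v)" and ?c = "\<lambda>(i, j). c i - d j"
  have R: "decomposition (I \<times> J) ?R" by (rule decomposition_product[OF P Q com])
  note cc = decomposition_carrier[OF P] decomposition_carrier[OF Q]
  have "comb c I P v \<ominus> comb d J Q v = comb ?c (I \<times> J) ?R v"
  proof (rule vec_eqI)
    fix w assume w: "w \<in> carrier H"
    have "sprod H (comb ?c (I \<times> J) ?R v) w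
        = (\<Sum>i\<in>I. \<Sum>j\<in>J. c i * sprod H (P i (Q j v)) w - d j * sprod H (P i (Q j v)) w)"
      unfolding sprod_comb[OF R v w] sum.cartesian_product
      by (simp add: case_prod_unfold ring_distribs)
    also have "\<dots> = (\<Sum>i\<in>I. c i * (\<Sum>j\<in>J. sprod H (Q j v) (P i w)))
        - (\<Sum>j\<in>J. d j * (\<Sum>i\<in>I. sprod H (P i (Q j v)) w))"
      unfolding sum_subtractf sum_distrib_left
      using v w cc sum.swap[of "\<lambda>i j. d j * sprod H (P i (Q j v)) w" J I]
      by (simp add: decomposition_sym[OF P])
    also have "\<dots> = sprod H (comb c I P v \<ominus> comb d J Q v) w"
    proof -
      have "(\<Sum>j\<in>J. sprod H (Q j v) (P i w)) = sprod H (P i v) w" if "i \<in> I" for i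
        using that v w cc by (simp add: decomposition_sum[OF Q] decomposition_sym[OF P])
      moreover have "(\<Sum>i\<in>I. sprod H (P i (Q j v)) w) = sprod H (Q j v) w" if "j \<in> J" for j
        using that v w cc by (simp add: decomposition_sum[OF P])
      ultimately show ?thesis
        using v w by (simp add: sprod_comb[OF P] sprod_comb[OF Q] comb_carrier[OF P] comb_carrier[OF Q])
    qed
    finally show "sprod H (comb c I P v \<ominus> comb d J Q v) w = sprod H (comb ?c (I \<times> J) ?R v) w" by simp
  qed (use v in \<open>simp_all add: comb_carrier[OF P] comb_carrier[OF Q] comb_carrier[OF R]\<close>)
  moreover have "hnorm H (comb ?c (I \<times> J) ?R v) \<le> e * hnorm H v"
    using close by (intro hnorm_comb_le[OF R v e]) auto
  ultimately show ?thesis by simp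
qed

end

section \<open>Tagged divisions and elementary facts about the Riemann--Stieltjes integral\<close>

lemma tagged_division_interval:
  assumes "p tagged_division_of {a..b::real}" "(x, k) \<in> p"
  obtains u v where "k = {u..v}" "a \<le> u" "u \<le> x" "x \<le> v" "v \<le> b" "Inf k = u" "Sup k = v"
proof -
  obtain u v where k: "k = {u..v}"
    using tagged_division_ofD(4)[OF assms] by (auto simp: box_real)
  have "x \<in> k" "k \<subseteq> {a..b}"
    using tagged_division_ofD(2,3)[OF assms] by auto
  then show ?thesis using that[of u v] k by auto
qed

lemma fine_division_ball:
  fixes a b :: real
  assumes "0 < \<delta>"
  obtains p where "p tagged_division_of {a..b}" "(\<lambda>x. ball x \<delta>) fine p"
  by (rule fine_division_exists_real[OF gauge_ball[OF assms], of a b]) (rule that)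

lemma has_RS_integralD:
  assumes "has_RS_integral f g a b I" "e > 0"
  shows "\<exists>\<delta>>0. \<forall>p. p tagged_division_of {a..b} \<longrightarrow> (\<lambda>x. ball x \<delta>) fine p \<longrightarrow>
    cmod ((\<Sum>(x, K)\<in>p. f x * (g (Sup K) - g (Inf K))) - I) < e"
  using assms unfolding has_RS_integral_def imp_conjL by (elim allE impE)

lemma has_RS_integral_unique:
  assumes "has_RS_integral f g a b I" "has_RS_integral f g a b J"
  shows "I = J"
proof (rule ccontr)
  assume "I \<noteq> J"
  then have e: "cmod (I - J) / 2 > 0" by simp
  let ?S = "\<lambda>p. \<Sum>(x, K)\<in>p. f x * (g (Sup K) - g (Inf K))"
  obtain \<delta> where \<delta>: "\<delta> > 0"
    "\<forall>p. p tagged_division_of {a..b} \<longrightarrow> (\<lambda>x. ball x \<delta>) fine p \<longrightarrow> cmod (?S p - I) < cmod (I - J) / 2"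
    using has_RS_integralD[OF assms(1) e] by (elim exE conjE)
  obtain \<eta> where \<eta>: "\<eta> > 0"
    "\<forall>p. p tagged_division_of {a..b} \<longrightarrow> (\<lambda>x. ball x \<eta>) fine p \<longrightarrow> cmod (?S p - J) < cmod (I - J) / 2"
    using has_RS_integralD[OF assms(2) e] by (elim exE conjE)
  obtain p where p: "p tagged_division_of {a..b}" "(\<lambda>x. ball x (min \<delta> \<eta>)) fine p"
    by (rule fine_division_ball[of "min \<delta> \<eta>" a b]) (use \<delta>(1) \<eta>(1) in auto)
  have "(\<lambda>x. ball x \<delta>) fine p" "(\<lambda>x. ball x \<eta>) fine p"
    using p(2) by (auto simp: fine_def subset_iff)
  then have "cmod (?S p - I) < cmod (I - J) / 2" "cmod (?S p - J) < cmod (I - J) / 2"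
    using \<delta>(2)[rule_format, OF p(1)] \<eta>(2)[rule_format, OF p(1)] by simp_all
  moreover have "cmod (I - J) \<le> cmod (?S p - I) + cmod (?S p - J)"
    using norm_triangle_ineq4[of "?S p - J" "?S p - I"] by simp
  ultimately show False by linarith
qed

text \<open>Tags and endpoints of a division stay in [a, b]. This absorbs the fact that solutions
  and spectral functions carry no information outside [0, 2 pi].\<close>

lemma has_RS_integral_cong:
  assumes "\<And>t. t \<in> {a..b} \<Longrightarrow> f t = f' t" "\<And>t. t \<in> {a..b} \<Longrightarrow> g t = g' t"
  shows "has_RS_integral f g a b I \<longleftrightarrow> has_RS_integral f' g' a b I"
proof -
  have "(\<Sum>(x, K)\<in>p. f x * (g (Sup K) - g (Inf K))) = (\<Sum>(x, K)\<in>p. f' x * (g' (Sup K) - g' (Inf K)))"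
    if p: "p tagged_division_of {a..b}" for p
  proof (rule sum.cong[OF refl], clarify)
    fix x K assume "(x, K) \<in> p"
    obtain u v where "a \<le> u" "u \<le> x" "x \<le> v" "v \<le> b" "Inf K = u" "Sup K = v"
      by (rule tagged_division_interval[OF p \<open>(x, K) \<in> p\<close>])
    then show "f x * (g (Sup K) - g (Inf K)) = f' x * (g' (Sup K) - g' (Inf K))"
      using assms by simp
  qed
  then show ?thesis
    unfolding has_RS_integral_def by (intro iff_allI imp_cong ex_cong1 conj_cong refl) simp
qed

section \<open>Spectral families and Riemann sums\<close>

text \<open>The part of a resolution of unity that mentions no operator. It therefore serves both
  for a given unitary operator and for a family from which the operator is still to be
  built.\<close>

locale spectral_family = inner_space H for H :: "'a hspace" (structure) +
  fixes F :: "real \<Rightarrow> 'a \<Rightarrow> 'a"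
  assumes proj: "t \<in> {0..2*pi} \<Longrightarrow> orth_projection H (F t)"
    and mono: "\<lbrakk>s \<in> {0..2*pi}; t \<in> {0..2*pi}; s \<le> t; v \<in> carrier H\<rbrakk>
      \<Longrightarrow> sprod H (F s v) v \<le> sprod H (F t v) v"
    and zero: "v \<in> carrier H \<Longrightarrow> F 0 v = \<zero>"
    and full: "v \<in> carrier H \<Longrightarrow> F (2*pi) v = v"
begin

lemmas F_facts = orth_projection_facts[OF proj]

lemmas sprod_F_self = sprod_projection_self[OF proj]

text \<open>The vector u = v - F_t v is annihilated by F_t, so monotonicity of the forms gives (F_s
  u, u) \<le> 0 and hence F_s u = 0. The second identity is the adjoint of the first.\<close>

lemma F_F_le:
  assumes "s \<in> {0..2*pi}" "t \<in> {0..2*pi}" "s \<le> t" "v \<in> carrier H"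
  shows "F s (F t v) = F s v" "F t (F s v) = F s v"
proof -
  have 1: "F s (F t v) = F s v" if v: "v \<in> carrier H" for v
  proof -
    define u where "u = v \<ominus> F t v"
    have u: "u \<in> carrier H" using v assms F_facts(1) by (simp add: u_def)
    have "F t u = \<zero>"
    proof (rule vec_eqI)
      fix z assume "z \<in> carrier H"
      then show "sprod H (F t u) z = sprod H \<zero> z"
        using v assms u F_facts(1,4,5) by (simp add: u_def)
    qed (use u assms F_facts(1) in auto)
    then have "sprod H (F s u) u \<le> 0" using mono[OF assms(1,2,3) u] u by simp
    then have "hnorm H (F s u) = 0"
      unfolding sprod_F_self[OF assms(1) u] by (simp add: less_eq_complex_def)
    then have z: "F s u = \<zero>" using hnorm_eq_0 u assms F_facts(1) by blast
    show ?thesis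
    proof (rule vec_eqI)
      fix z assume "z \<in> carrier H"
      then have "sprod H (F s u) z = sprod H (F s v) z - sprod H (F s (F t v)) z"
        using v u assms F_facts(1,5) by (simp add: u_def)
      then show "sprod H (F s (F t v)) z = sprod H (F s v) z" using z \<open>z \<in> carrier H\<close> by simp
    qed (use v assms F_facts(1) in auto)
  qed
  then show "F s (F t v) = F s v" using assms(4) .
  show "F t (F s v) = F s v"
    using assms(1,2,4) F_facts(1,5) 1 by (intro vec_eqI) auto
qed

lemma F_F:
  assumes "s \<in> {0..2*pi}" "t \<in> {0..2*pi}" "v \<in> carrier H"
  shows "F s (F t v) = F (min s t) v"
proof (cases "s \<le> t")
  case True
  then show ?thesis using F_F_le(1)[OF assms(1,2) True assms(3)] by (simp add: min_def)
next
  case False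
  then show ?thesis using F_F_le(2)[OF assms(2,1) _ assms(3)] by (simp add: min_def)
qed

lemma sprod_F_F:
  assumes "s \<in> {0..2*pi}" "t \<in> {0..2*pi}" "v \<in> carrier H" "w \<in> carrier H"
  shows "sprod H (F s v) (F t w) = sprod H (F (min s t) v) w"
  using assms F_F[of t s v] F_facts(1,5)[OF assms(1)] F_facts(5)[OF assms(2), of "F s v" w]
  by (simp add: min.commute)

text \<open>Taking the endpoints from \<open>Sup\<close> and \<open>Inf\<close> makes this literally
  the increment in \<open>has_RS_integral\<close>, with the elements of a tagged division as
  indices.\<close>

definition inc :: "real set \<Rightarrow> 'a \<Rightarrow> 'a" where
  "inc k v = F (Sup k) v \<ominus> F (Inf k) v"

lemma inc_carrier:
  "\<lbrakk>Inf k \<in> {0..2*pi}; Sup k \<in> {0..2*pi}; v \<in> carrier H\<rbrakk> \<Longrightarrow> inc k v \<in> carrier H"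
  using F_facts(1) by (simp add: inc_def)

lemma sprod_inc:
  assumes "Inf k \<in> {0..2*pi}" "Sup k \<in> {0..2*pi}" "v \<in> carrier H" "w \<in> carrier H"
  shows "sprod H (inc k v) w = sprod H (F (Sup k) v) w - sprod H (F (Inf k) v) w"
  using assms F_facts(1) by (simp add: inc_def)

text \<open>Products of the F are F at minima, so commutation and orthogonality of increments reduce
  to comparing endpoints.\<close>

lemma sprod_inc_inc:
  assumes k: "Inf k \<in> {0..2*pi}" "Sup k \<in> {0..2*pi}" and l: "Inf l \<in> {0..2*pi}" "Sup l \<in> {0..2*pi}"
    and v: "v \<in> carrier H" and w: "w \<in> carrier H"
  shows "sprod H (inc k (inc l v)) w =
    sprod H (F (min (Sup k) (Sup l)) v) w - sprod H (F (min (Sup k) (Inf l)) v) w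
    - sprod H (F (min (Inf k) (Sup l)) v) w + sprod H (F (min (Inf k) (Inf l)) v) w"
proof -
  have c: "sprod H (F s (inc l v)) w = sprod H (F (min s (Sup l)) v) w - sprod H (F (min s (Inf l)) v) w"
    if "s \<in> {0..2*pi}" for s
  proof -
    have "sprod H (F s (inc l v)) w = sprod H (inc l v) (F s w)"
      using that l v w inc_carrier F_facts(5) by simp
    also have "\<dots> = sprod H (F (Sup l) v) (F s w) - sprod H (F (Inf l) v) (F s w)"
      using that l v w F_facts(1) by (intro sprod_inc) auto
    also have "\<dots> = sprod H (F (min (Sup l) s) v) w - sprod H (F (min (Inf l) s) v) w"
      using that l v w by (simp add: sprod_F_F)
    finally show ?thesis by (simp add: min.commute)
  qed
  show ?thesis
    using sprod_inc[OF k inc_carrier[OF l v] w] c[OF k(1)] c[OF k(2)] by simp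
qed

lemma inc_commute:
  assumes "Inf k \<in> {0..2*pi}" "Sup k \<in> {0..2*pi}" "Inf l \<in> {0..2*pi}" "Sup l \<in> {0..2*pi}"
    "v \<in> carrier H"
  shows "inc k (inc l v) = inc l (inc k v)"
  using assms by (intro vec_eqI inc_carrier) (simp_all add: sprod_inc_inc inc_carrier min.commute)

text \<open>The last two alternatives are needed for divisions: a degenerate interval may lie inside
  another one without common interior points, and then its own increment vanishes.\<close>

lemma inc_inc_zero:
  assumes "Inf k \<in> {0..2*pi}" "Sup k \<in> {0..2*pi}" "Inf l \<in> {0..2*pi}" "Sup l \<in> {0..2*pi}"
    "Inf k \<le> Sup k" "Inf l \<le> Sup l" "v \<in> carrier H"
    and "Sup k \<le> Inf l \<or> Sup l \<le> Inf k \<or> Inf k = Sup k \<or> Inf l = Sup l"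
  shows "inc k (inc l v) = \<zero>"
proof (rule vec_eqI)
  fix w assume "w \<in> carrier H"
  then show "sprod H (inc k (inc l v)) w = sprod H \<zero> w"
    using assms by (elim disjE) (simp_all add: sprod_inc_inc min.absorb1 min.absorb2)
qed (use assms in \<open>auto intro!: inc_carrier\<close>)

lemma inc_projection:
  assumes k: "Inf k \<in> {0..2*pi}" "Sup k \<in> {0..2*pi}" "Inf k \<le> Sup k"
  shows "orth_projection H (inc k)"
  unfolding orth_projection_def
proof (intro conjI ballI linear_mapI inner_space_axioms)
  note c = inc_carrier[OF k(1,2)]
  fix v w assume v: "v \<in> carrier H" and w: "w \<in> carrier H"
  show "sprod H (inc k v) w = sprod H v (inc k w)"
    using k v w F_facts(1,5) by (simp add: inc_def)
  show "inc k (v \<oplus> w) = inc k v \<oplus> inc k w"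
    by (rule vec_eqI) (use k v w c F_facts(1,5) in \<open>simp_all add: sprod_inc\<close>)
next
  note c = inc_carrier[OF k(1,2)]
  fix v assume v: "v \<in> carrier H"
  show "inc k v \<in> carrier H" by (rule c[OF v])
  show "inc k (a \<odot> v) = a \<odot> inc k v" for a
    by (rule vec_eqI) (use k v c F_facts(1,3) in \<open>simp_all add: sprod_inc right_diff_distrib\<close>)
  show "inc k (inc k v) = inc k v"
  proof (rule vec_eqI)
    fix w assume w: "w \<in> carrier H"
    show "sprod H (inc k (inc k v)) w = sprod H (inc k v) w"
      unfolding sprod_inc_inc[OF k(1,2) k(1,2) v w] sprod_inc[OF k(1,2) v w]
      using k(3) by (simp add: min.absorb1 min.absorb2)
  qed (use v c in auto)
qed

context
  fixes p assumes p: "p tagged_division_of {0..2*pi}"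
begin

lemma division_bounds:
  assumes "(x, k) \<in> p"
  shows "Inf k \<in> {0..2*pi}" "Sup k \<in> {0..2*pi}" "Inf k \<le> Sup k" "k = {Inf k..Sup k}"
proof -
  obtain u v where "k = {u..v}" "0 \<le> u" "u \<le> x" "x \<le> v" "v \<le> 2*pi" "Inf k = u" "Sup k = v"
    by (rule tagged_division_interval[OF p assms])
  then show "Inf k \<in> {0..2*pi}" "Sup k \<in> {0..2*pi}" "Inf k \<le> Sup k" "k = {Inf k..Sup k}" by auto
qed

text \<open>Disjoint interiors give orthogonality of the increments, and their sum telescopes to
  F_2pi - F_0, the identity.\<close>

lemma decomposition_division: "decomposition p (\<lambda>(x, k). inc k)"
  unfolding decomposition_def
proof (intro conjI ballI impI)
  show fin: "finite p" using p by blast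
  show "orth_projection H (case xk of (x, k) \<Rightarrow> inc k)" if "xk \<in> p" for xk
    using inc_projection division_bounds that by (cases xk) auto
  fix v assume v: "v \<in> carrier H"
  show "(\<Oplus>xk\<in>p. (case xk of (x, k) \<Rightarrow> inc k) v) = v"
  proof (rule vec_eqI)
    fix w assume w: "w \<in> carrier H"
    have "sprod H (\<Oplus>xk\<in>p. (case xk of (x, k) \<Rightarrow> inc k) v) w
        = (\<Sum>(x, k)\<in>p. sprod H (F (Sup k) v) w - sprod H (F (Inf k) v) w)"
      using v w division_bounds
      by (subst sprod_finsum_left) (auto intro!: inc_carrier sum.cong sprod_inc)
    also have "\<dots> = sprod H (F (2*pi) v) w - sprod H (F 0 v) w"
      by (rule additive_tagged_division_1[OF _ p]) simp
    finally show "sprod H (\<Oplus>xk\<in>p. (case xk of (x, k) \<Rightarrow> inc k) v) w = sprod H v w"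
      using v w by (simp add: zero full)
  qed (use v division_bounds in \<open>auto intro!: finsum_carrier inc_carrier\<close>)
  fix xk yl assume xk: "xk \<in> p" and yl: "yl \<in> p" and ne: "xk \<noteq> yl"
  obtain x k y l where [simp]: "xk = (x, k)" "yl = (y, l)" by (cases xk, cases yl)
  have k: "k = {Inf k..Sup k}" "Inf k \<le> Sup k" and l: "l = {Inf l..Sup l}" "Inf l \<le> Sup l"
    using division_bounds xk yl by auto
  have "interior k \<inter> interior l = {}"
    using tagged_division_ofD(5)[OF p, of x k y l] xk yl ne by simp
  then have e: "{Inf k<..<Sup k} \<inter> {Inf l<..<Sup l} = {}"
    using k l by (metis interior_atLeastAtMost_real)
  have "Sup k \<le> Inf l \<or> Sup l \<le> Inf k \<or> Inf k = Sup k \<or> Inf l = Sup l"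
  proof (rule ccontr)
    assume n: "\<not> ?thesis"
    then have "max (Inf k) (Inf l) < min (Sup k) (Sup l)" using k l by auto
    then obtain z where "max (Inf k) (Inf l) < z" "z < min (Sup k) (Sup l)" using dense by blast
    then have "z \<in> {Inf k<..<Sup k} \<inter> {Inf l<..<Sup l}" by auto
    then show False using e by blast
  qed
  then show "(case xk of (x, k) \<Rightarrow> inc k) ((case yl of (x, k) \<Rightarrow> inc k) v) = \<zero>"
    using division_bounds[of x k] division_bounds[of y l] xk yl v by (simp add: inc_inc_zero)
qed

end

definition RS_sum :: "(real \<Rightarrow> complex) \<Rightarrow> (real \<times> real set) set \<Rightarrow> 'a \<Rightarrow> 'a" where
  "RS_sum f p = comb (\<lambda>(x, k). f x) p (\<lambda>(x, k). inc k)"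

lemma sprod_RS_sum:
  assumes p: "p tagged_division_of {0..2*pi}" and v: "v \<in> carrier H" "w \<in> carrier H"
  shows "sprod H (RS_sum f p v) w
    = (\<Sum>(x, k)\<in>p. f x * (sprod H (F (Sup k) v) w - sprod H (F (Inf k) v) w))"
  unfolding RS_sum_def sprod_comb[OF decomposition_division[OF p] v]
  using division_bounds[OF p] v by (intro sum.cong) (auto simp: sprod_inc)

lemma RS_sum_carrier: "p tagged_division_of {0..2*pi} \<Longrightarrow> v \<in> carrier H \<Longrightarrow> RS_sum f p v \<in> carrier H"
  unfolding RS_sum_def by (intro comb_carrier decomposition_division)

text \<open>Increments over k and l have a nonzero product only if k and l share a point. That point
  is \<delta>-close to the tag of k and \<eta>-close to the tag of l, so the values of f at the tags
  differ by at most \<delta> + \<eta>.\<close>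

lemma hnorm_RS_sum_diff_le:
  assumes p: "p tagged_division_of {0..2*pi}" "(\<lambda>x. ball x \<delta>) fine p"
    and q: "q tagged_division_of {0..2*pi}" "(\<lambda>x. ball x \<eta>) fine q"
    and f: "\<And>s t. cmod (f s - f t) \<le> \<bar>s - t\<bar>"
    and pos: "0 \<le> \<delta>" "0 \<le> \<eta>" and v: "v \<in> carrier H"
  shows "hnorm H (RS_sum f p v \<ominus> RS_sum f q v) \<le> (\<delta> + \<eta>) * hnorm H v"
  unfolding RS_sum_def
proof (rule hnorm_comb_diff_le[OF decomposition_division[OF p(1)] decomposition_division[OF q(1)]])
  note bp = division_bounds[OF p(1)] and bq = division_bounds[OF q(1)]
  fix xk yl assume xk: "xk \<in> p" and yl: "yl \<in> q"
  obtain x k y l where [simp]: "xk = (x, k)" "yl = (y, l)" by (cases xk, cases yl)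
  show "(case xk of (x, k) \<Rightarrow> inc k) ((case yl of (x, k) \<Rightarrow> inc k) v)
      = (case yl of (x, k) \<Rightarrow> inc k) ((case xk of (x, k) \<Rightarrow> inc k) v)" if "v \<in> carrier H" for v
    using bp[of x k] bq[of y l] xk yl that by (simp add: inc_commute)
  show "cmod ((case xk of (x, k) \<Rightarrow> f x) - (case yl of (x, k) \<Rightarrow> f x)) \<le> \<delta> + \<eta> \<or>
    (\<forall>v\<in>carrier H. (case xk of (x, k) \<Rightarrow> inc k) ((case yl of (x, k) \<Rightarrow> inc k) v) = \<zero>)"
  proof (cases "Sup k \<le> Inf l \<or> Sup l \<le> Inf k")
    case True
    then have "inc k (inc l v) = \<zero>" if "v \<in> carrier H" for v
      using bp[of x k] bq[of y l] xk yl that by (intro inc_inc_zero) auto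
    then show ?thesis by simp
  next
    case False
    define z where "z = max (Inf k) (Inf l)"
    have "z \<in> {Inf k..Sup k}" "z \<in> {Inf l..Sup l}"
      using False bp(3)[of x k] bq(3)[of y l] xk yl by (auto simp: z_def)
    then have "z \<in> k" "z \<in> l"
      using bp(4)[of x k] bq(4)[of y l] xk yl by auto
    moreover have "k \<subseteq> ball x \<delta>" "l \<subseteq> ball y \<eta>"
      using p(2) q(2) xk yl by (auto simp: fine_def)
    ultimately have "\<bar>x - z\<bar> < \<delta>" "\<bar>y - z\<bar> < \<eta>" by (auto simp: dist_real_def)
    then have "\<bar>x - y\<bar> \<le> \<delta> + \<eta>" by linarith
    then show ?thesis using f[of x y] by auto
  qed
qed (use v pos in auto)

end

lemma (in inner_space) resolution_spectral_family:
  assumes "resolution_of_unity H U F"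
  shows "spectral_family H F"
  using assms unfolding resolution_of_unity_def
  by unfold_locales auto

section \<open>Operators as integrals of Lipschitz functions against a spectral family\<close>

lemma exp_i_Lipschitz: "cmod (exp (\<i> * of_real s) - exp (\<i> * of_real t)) \<le> \<bar>s - t\<bar>"
proof -
  have "exp (\<i> * of_real s) - exp (\<i> * of_real t)
      = exp (\<i> * of_real t) * (exp (\<i> * of_real (s - t)) - 1)"
    by (simp add: algebra_simps exp_add[symmetric])
  then have "cmod (exp (\<i> * of_real s) - exp (\<i> * of_real t)) = 2 * \<bar>sin ((s - t) / 2)\<bar>"
    by (simp only: norm_mult norm_exp_i_times dist_exp_i_1)
  also have "\<dots> \<le> \<bar>s - t\<bar>"
    using abs_sin_x_le_abs_x[of "(s - t) / 2"] by simp
  finally show ?thesis .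
qed

context inner_space
begin

lemma hnorm_le_of_sprod_le:
  assumes u: "u \<in> carrier H" and le: "cmod (sprod H u u) \<le> c * hnorm H u" and c: "0 \<le> c"
  shows "hnorm H u \<le> c"
proof (cases "hnorm H u = 0")
  case False
  then have "hnorm H u > 0" using hnorm_nonneg[OF u] by linarith
  moreover have "hnorm H u * hnorm H u \<le> c * hnorm H u"
    using le u by (simp add: sprod_self norm_power power2_eq_square norm_mult)
  ultimately show ?thesis by simp
qed (use c in simp)

end

context spectral_family
begin

text \<open>Passage from the weak integral to a norm estimate. The weak integral supplies, for each
  w, a fine division q whose sum is close to u when tested against w. Replacing p by q costs
  \<delta> + \<eta>, with a factor depending on w only through its norm. Once \<eta> is gone, w may
  be the difference of the two vectors itself.\<close>

lemma RS_sum_near_operator: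
  assumes f: "\<And>s t. cmod (f s - f t) \<le> \<bar>s - t\<bar>"
    and v: "v \<in> carrier H" "u \<in> carrier H"
    and RS: "\<And>w. w \<in> carrier H \<Longrightarrow> has_RS_integral f (\<lambda>t. sprod H (F t v) w) 0 (2*pi) (sprod H u w)"
    and p: "p tagged_division_of {0..2*pi}" "(\<lambda>x. ball x \<delta>) fine p" and \<delta>: "0 < \<delta>"
  shows "hnorm H (RS_sum f p v \<ominus> u) \<le> \<delta> * hnorm H v"
proof -
  let ?S = "\<lambda>p. RS_sum f p v"
  note Sc = RS_sum_carrier[OF _ v(1)]
  have "cmod (sprod H (?S p \<ominus> u) w) \<le> \<delta> * (hnorm H v * hnorm H w)" if w: "w \<in> carrier H" for w
  proof (rule field_le_epsilon)
    fix e :: real assume e: "e > 0"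
    define C where "C = hnorm H v * hnorm H w"
    have C: "C \<ge> 0" using v w by (simp add: C_def)
    \<comment> \<open>The total error is (\<delta> + \<eta>) C + \<eta> = \<delta> C + \<eta> (C +
      1), which this choice turns into \<delta> C + e.\<close>
    define \<eta> where "\<eta> = e / (C + 1)"
    have \<eta>: "\<eta> > 0" using e C by (simp add: \<eta>_def)
    obtain \<theta> where \<theta>: "\<theta> > 0" "\<forall>q. q tagged_division_of {0..2*pi} \<longrightarrow> (\<lambda>x. ball x \<theta>) fine q \<longrightarrow>
        cmod ((\<Sum>(x, K)\<in>q. f x * (sprod H (F (Sup K) v) w - sprod H (F (Inf K) v) w)) - sprod H u w) < \<eta>"
      using has_RS_integralD[OF RS[OF w] \<eta>] by (elim exE conjE)
    obtain q where q: "q tagged_division_of {0..2*pi}" "(\<lambda>x. ball x (min \<theta> \<eta>)) fine q"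
      by (rule fine_division_ball[of "min \<theta> \<eta>" 0 "2*pi"]) (use \<theta>(1) \<eta> in auto)
    have fq: "(\<lambda>x. ball x \<theta>) fine q" "(\<lambda>x. ball x \<eta>) fine q"
      using q(2) by (auto simp: fine_def subset_iff)
    have 1: "cmod (sprod H (?S q) w - sprod H u w) < \<eta>"
      using \<theta>(2) fq(1) q(1) v w by (simp add: sprod_RS_sum)
    have "cmod (sprod H (?S p \<ominus> ?S q) w) \<le> hnorm H (?S p \<ominus> ?S q) * hnorm H w"
      using Sc p(1) q(1) w by (intro Cauchy_Schwarz) auto
    also have "\<dots> \<le> (\<delta> + \<eta>) * hnorm H v * hnorm H w"
      using hnorm_RS_sum_diff_le[OF p q(1) fq(2) f _ _ v(1)] \<delta> \<eta> w by (intro mult_right_mono) auto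
    finally have 2: "cmod (sprod H (?S p) w - sprod H (?S q) w) \<le> (\<delta> + \<eta>) * C"
      using Sc p(1) q(1) w by (simp add: C_def mult.assoc)
    have "cmod (sprod H (?S p \<ominus> u) w)
        \<le> cmod (sprod H (?S p) w - sprod H (?S q) w) + cmod (sprod H (?S q) w - sprod H u w)"
      using Sc p(1) w v norm_triangle_ineq[of "sprod H (?S p) w - sprod H (?S q) w" "sprod H (?S q) w - sprod H u w"]
      by simp
    also have "\<dots> \<le> \<delta> * C + \<eta> * (C + 1)" using 1 2 by (simp add: algebra_simps)
    also have "\<eta> * (C + 1) = e" using C by (simp add: \<eta>_def)
    finally show "cmod (sprod H (?S p \<ominus> u) w) \<le> \<delta> * (hnorm H v * hnorm H w) + e" by (simp add: C_def)
  qed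
  from this[of "?S p \<ominus> u"] show ?thesis
    using v \<delta> Sc[OF p(1)] by (intro hnorm_le_of_sprod_le) (auto simp: mult.assoc)
qed

lemma RS_sum_mult:
  assumes "p tagged_division_of {0..2*pi}" "v \<in> carrier H"
  shows "RS_sum f p (RS_sum g p v) = RS_sum (\<lambda>x. f x * g x) p v"
  unfolding RS_sum_def comb_comb[OF decomposition_division[OF assms(1)] assms(2)]
  by (simp add: case_prod_unfold)

lemma RS_sum_one:
  assumes "p tagged_division_of {0..2*pi}" "v \<in> carrier H" "\<And>x. f x = 1"
  shows "RS_sum f p v = v"
  unfolding RS_sum_def using assms by (intro comb_one decomposition_division) auto

lemma RS_sum_minus:
  assumes "p tagged_division_of {0..2*pi}" "v \<in> carrier H" "w \<in> carrier H"
  shows "RS_sum f p (v \<ominus> w) = RS_sum f p v \<ominus> RS_sum f p w"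
  unfolding RS_sum_def using assms by (intro comb_minus decomposition_division) auto

lemma hnorm_RS_sum:
  assumes "p tagged_division_of {0..2*pi}" "v \<in> carrier H" "\<And>x. cmod (f x) = 1"
  shows "hnorm H (RS_sum f p v) = hnorm H v"
  unfolding RS_sum_def using assms by (intro hnorm_comb_isometric decomposition_division) auto

text \<open>The integrand is left open because the inverse of the unitary operator is obtained by
  integrating the conjugate function.\<close>

definition integrates :: "(real \<Rightarrow> complex) \<Rightarrow> ('a \<Rightarrow> 'a) \<Rightarrow> bool" where
  "integrates f U \<longleftrightarrow> (\<forall>v\<in>carrier H. U v \<in> carrier H \<and>
     (\<forall>w\<in>carrier H. has_RS_integral f (\<lambda>t. sprod H (F t v) w) 0 (2*pi) (sprod H (U v) w)))"

text \<open>Over one division, Riemann sums are multiplicative, so the sum for the n-th power of f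
  is the n-th power of the sum for f. These operators are isometric, hence replacing the factors by
  \<open>U\<close> one at a time accumulates an error that is only linear in n.\<close>

lemma has_RS_integral_power:
  assumes f: "\<And>s t. cmod (f s - f t) \<le> \<bar>s - t\<bar>" "\<And>x. cmod (f x) = 1"
    and U: "integrates f U" "\<And>v. v \<in> carrier H \<Longrightarrow> hnorm H (U v) = hnorm H v"
    and v: "v \<in> carrier H" "w \<in> carrier H"
  shows "has_RS_integral (\<lambda>t. f t ^ n) (\<lambda>t. sprod H (F t v) w) 0 (2*pi) (sprod H ((U ^^ n) v) w)"
proof -
  have Uc: "(U ^^ n) v \<in> carrier H" for n
    using U(1) v by (induction n) (auto simp: integrates_def)
  have nU: "hnorm H ((U ^^ n) v) = hnorm H v" for n
    using U(2) Uc by (induction n) auto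
  have approx: "hnorm H (RS_sum (\<lambda>t. f t ^ n) p v \<ominus> (U ^^ n) v) \<le> real n * \<delta> * hnorm H v"
    if p: "p tagged_division_of {0..2*pi}" "(\<lambda>x. ball x \<delta>) fine p" and \<delta>: "0 < \<delta>" for p n \<delta>
  proof (induction n)
    case 0
    have "RS_sum (\<lambda>t. f t ^ 0) p v = v" using p v by (intro RS_sum_one) auto
    moreover have "v \<ominus> v = \<zero>" using v minus_eq_zero_iff by blast
    ultimately show ?case by (simp del: power_0) 
  next
    case (Suc n)
    let ?S = "RS_sum (\<lambda>t. f t ^ n) p v" and ?u = "(U ^^ n) v"
    have c: "?S \<in> carrier H" "RS_sum f p ?S \<in> carrier H" "RS_sum f p ?u \<in> carrier H" "U ?u \<in> carrier H"
      using RS_sum_carrier p v Uc[of n] Uc[of "Suc n"] by auto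
    have "hnorm H (RS_sum f p ?S \<ominus> U ?u)
        \<le> hnorm H (RS_sum f p ?S \<ominus> RS_sum f p ?u) + hnorm H (RS_sum f p ?u \<ominus> U ?u)"
      using c by (intro hnorm_triangle_minus)
    also have "hnorm H (RS_sum f p ?S \<ominus> RS_sum f p ?u) = hnorm H (?S \<ominus> ?u)"
      using hnorm_RS_sum[OF p(1) _ f(2), of "?S \<ominus> ?u"] RS_sum_minus[OF p(1) c(1) Uc] c Uc by simp
    also have "hnorm H (RS_sum f p ?u \<ominus> U ?u) \<le> \<delta> * hnorm H ?u"
      using U(1) Uc p \<delta> f(1) c(4) by (intro RS_sum_near_operator) (auto simp: integrates_def)
    finally have "hnorm H (RS_sum f p ?S \<ominus> U ?u) \<le> real (Suc n) * \<delta> * hnorm H v"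
      using Suc by (simp add: nU algebra_simps)
    then show ?case using RS_sum_mult[OF p(1) v(1)] by simp
  qed
  show ?thesis
    unfolding has_RS_integral_def
  proof (intro allI impI)
    fix e :: real assume e: "e > 0"
    define C where "C = real n * (hnorm H v * hnorm H w)"
    have C: "C \<ge> 0" using v by (simp add: C_def)
    have \<delta>: "0 < e / (C + 1)" using e C by simp
    show "\<exists>\<delta>>0. \<forall>p. p tagged_division_of {0..2*pi} \<and> (\<lambda>x. ball x \<delta>) fine p \<longrightarrow>
      cmod ((\<Sum>(x, K)\<in>p. f x ^ n * (sprod H (F (Sup K) v) w - sprod H (F (Inf K) v) w))
        - sprod H ((U ^^ n) v) w) < e"
    proof (rule exI[of _ "e / (C + 1)"], intro conjI allI impI \<delta>)
      fix p assume p: "p tagged_division_of {0..2*pi} \<and> (\<lambda>x. ball x (e / (C + 1))) fine p"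
      let ?S = "RS_sum (\<lambda>t. f t ^ n) p v"
      have Sc: "?S \<in> carrier H" using p v RS_sum_carrier by blast
      have "cmod (sprod H (?S \<ominus> (U ^^ n) v) w) \<le> hnorm H (?S \<ominus> (U ^^ n) v) * hnorm H w"
        using Sc Uc v by (intro Cauchy_Schwarz) auto
      also have "\<dots> \<le> real n * (e / (C + 1)) * hnorm H v * hnorm H w"
        using approx[of p "e / (C + 1)" n] p \<delta> v by (intro mult_right_mono) auto
      also have "\<dots> = e * C / (C + 1)" by (simp add: C_def)
      also have "\<dots> < e" using e C by (simp add: divide_simps)
      finally have "cmod (sprod H ?S w - sprod H ((U ^^ n) v) w) < e" using Sc Uc v by simp
      then show "cmod ((\<Sum>(x, K)\<in>p. f x ^ n * (sprod H (F (Sup K) v) w - sprod H (F (Inf K) v) w))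
        - sprod H ((U ^^ n) v) w) < e"
        using p v by (simp add: sprod_RS_sum)
    qed
  qed
qed

definition part :: "nat \<Rightarrow> (real \<times> real set) set" where
  "part n = (SOME p. p tagged_division_of {0..2*pi} \<and> (\<lambda>x. ball x (1 / Suc n)) fine p)"

lemma part: "part n tagged_division_of {0..2*pi}" "(\<lambda>x. ball x (1 / Suc n)) fine part n"
proof -
  have "\<exists>p. p tagged_division_of {0..2*pi} \<and> (\<lambda>x. ball x (1 / Suc n)) fine p"
    by (rule fine_division_ball[of "1 / Suc n" 0 "2*pi"]) auto
  from someI_ex[OF this] show "part n tagged_division_of {0..2*pi}"
    "(\<lambda>x. ball x (1 / Suc n)) fine part n" unfolding part_def by auto
qed

lemma integrates_converges:
  assumes "integrates f U" "\<And>s t. cmod (f s - f t) \<le> \<bar>s - t\<bar>" and v: "v \<in> carrier H"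
  shows "converges (\<lambda>n. RS_sum f (part n) v) (U v)"
proof -
  have *: "(\<lambda>n. 1 / Suc n * hnorm H v) \<longlonglongrightarrow> 0"
    by (rule tendsto_mult_left_zero, rule LIMSEQ_Suc, rule lim_1_over_n)
  have U: "U v \<in> carrier H" using assms by (simp add: integrates_def)
  have "(\<lambda>n. hnorm H (RS_sum f (part n) v \<ominus> U v)) \<longlonglongrightarrow> 0"
  proof (rule Lim_null_comparison[OF _ *], rule always_eventually, rule allI)
    fix n
    have "hnorm H (RS_sum f (part n) v \<ominus> U v) \<le> 1 / Suc n * hnorm H v"
      using assms part[of n] U by (intro RS_sum_near_operator) (auto simp: integrates_def)
    then show "norm (hnorm H (RS_sum f (part n) v \<ominus> U v)) \<le> 1 / Suc n * hnorm H v"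
      using RS_sum_carrier[OF part(1) v] U by simp
  qed
  then show ?thesis using RS_sum_carrier[OF part(1) v] U by (simp add: converges_def)
qed

end

locale hilbert_spectral_family = hilbert_space H + spectral_family H F for H :: "'a hspace" and F
begin

text \<open>The sums over \<open>part n\<close> are Cauchy by \<open>hnorm_RS_sum_diff_le\<close>.
  The same estimate with one division held fixed and n tending to infinity shows that every
  sufficiently fine sum is close to the limit, as the integral demands.\<close>

lemma integrates_exists:
  assumes f: "\<And>s t. cmod (f s - f t) \<le> \<bar>s - t\<bar>"
  shows "\<exists>U. integrates f U"
proof -
  let ?S = "\<lambda>n. RS_sum f (part n)"
  note Sc = RS_sum_carrier[OF part(1)]
  have "\<exists>u. converges (\<lambda>n. ?S n v) u" if v: "v \<in> carrier H" for v
  proof (rule Cauchy_converges, unfold Cauchy_seq_def, intro conjI allI impI)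
    show "?S n v \<in> carrier H" for n by (rule Sc[OF v])
    fix e :: real assume e: "e > 0"
    define C where "C = 2 * hnorm H v + 1"
    have C: "C > 0" using hnorm_nonneg[OF v] by (simp add: C_def)
    obtain n0 :: nat where n0: "1 / Suc n0 < e / C"
      using nat_approx_posE[of "e / C"] e C by auto
    have "hnorm H (?S m v \<ominus>\<^bsub>H\<^esub> ?S n v) < e" if mn: "m \<ge> n0" "n \<ge> n0" for m n
    proof -
      have "hnorm H (?S m v \<ominus>\<^bsub>H\<^esub> ?S n v) \<le> (1 / Suc m + 1 / Suc n) * hnorm H v"
        by (intro hnorm_RS_sum_diff_le part f v) auto
      also have "\<dots> \<le> (1 / Suc n0 + 1 / Suc n0) * hnorm H v"
        using mn v by (intro mult_right_mono add_mono divide_left_mono) auto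
      also have "\<dots> \<le> 1 / Suc n0 * C" by (simp add: C_def field_simps)
      also have "\<dots> < e" using n0 C by (simp add: field_simps)
      finally show ?thesis .
    qed
    then show "\<exists>n0. \<forall>m\<ge>n0. \<forall>n\<ge>n0. hnorm H (?S m v \<ominus>\<^bsub>H\<^esub> ?S n v) < e" by blast
  qed
  then obtain U where U: "\<And>v. v \<in> carrier H \<Longrightarrow> converges (\<lambda>n. ?S n v) (U v)" by metis
  have "integrates f U"
    unfolding integrates_def has_RS_integral_def
  proof (intro ballI conjI allI impI)
    fix v assume v: "v \<in> carrier H"
    show Uv: "U v \<in> carrier H" using U[OF v] converges_carrier by blast
    fix w e assume w: "w \<in> carrier H" and e: "(e::real) > 0"
    define C where "C = hnorm H v * hnorm H w"
    have C: "C \<ge> 0" using v w by (simp add: C_def)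
    have \<delta>: "0 < e / (C + 1)" using e C by simp
    show "\<exists>\<delta>>0. \<forall>p. p tagged_division_of {0..2*pi} \<and> (\<lambda>x. ball x \<delta>) fine p \<longrightarrow>
      cmod ((\<Sum>(x, K)\<in>p. f x * (sprod H (F (Sup K) v) w - sprod H (F (Inf K) v) w))
        - sprod H (U v) w) < e"
    proof (rule exI[of _ "e / (C + 1)"], intro conjI allI impI \<delta>)
      let ?\<delta> = "e / (C + 1)"
      fix p assume p: "p tagged_division_of {0..2*pi} \<and> (\<lambda>x. ball x ?\<delta>) fine p"
      have pc: "RS_sum f p v \<in> carrier H" using p v RS_sum_carrier by blast
      have lim: "(\<lambda>n. cmod (sprod H (RS_sum f p v) w - sprod H (?S n v) w))
          \<longlonglongrightarrow> cmod (sprod H (RS_sum f p v) w - sprod H (U v) w)"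
        by (intro tendsto_intros converges_sprod U v w)
      have lim2: "(\<lambda>n. (?\<delta> + 1 / Suc n) * C) \<longlonglongrightarrow> (?\<delta> + 0) * C"
        by (intro tendsto_intros LIMSEQ_Suc[OF lim_1_over_n])
      have "cmod (sprod H (RS_sum f p v) w - sprod H (?S n v) w) \<le> (?\<delta> + 1 / Suc n) * C" for n
      proof -
        have "cmod (sprod H (RS_sum f p v \<ominus>\<^bsub>H\<^esub> ?S n v) w) \<le> hnorm H (RS_sum f p v \<ominus>\<^bsub>H\<^esub> ?S n v) * hnorm H w"
          using pc Sc v w by (intro Cauchy_Schwarz) auto
        also have "\<dots> \<le> ((?\<delta> + 1 / Suc n) * hnorm H v) * hnorm H w"
          using p \<delta> part[of n] v w by (intro mult_right_mono hnorm_RS_sum_diff_le f) auto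
        finally show ?thesis using pc Sc v w by (simp add: C_def mult.assoc)
      qed
      then have "cmod (sprod H (RS_sum f p v) w - sprod H (U v) w) \<le> (?\<delta> + 0) * C"
        by (intro LIMSEQ_le[OF lim lim2]) auto
      also have "\<dots> < e" using e C by (simp add: divide_simps)
      finally show "cmod ((\<Sum>(x, K)\<in>p. f x * (sprod H (F (Sup K) v) w - sprod H (F (Inf K) v) w))
        - sprod H (U v) w) < e"
        using p v w by (simp add: sprod_RS_sum)
    qed
  qed
  then show ?thesis by blast
qed

text \<open>Riemann sums of a unimodular function are linear and isometric. Since they converge in
  norm on each vector, scalar products pass to the limit in both arguments at once.\<close>

lemma integrates_isometric_embedding:
  assumes f: "\<And>s t. cmod (f s - f t) \<le> \<bar>s - t\<bar>" "\<And>x. cmod (f x) = 1" and U: "integrates f U"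
  shows "isometric_embedding H H U"
proof -
  note conv = integrates_converges[OF U f(1)]
  have Uc: "U v \<in> carrier H" if "v \<in> carrier H" for v using U that by (simp add: integrates_def)
  note dec = decomposition_division[OF part(1)]
  show ?thesis
    unfolding isometric_embedding_def
  proof (intro conjI ballI linear_mapI)
    fix v w assume v: "v \<in> carrier H" and w: "w \<in> carrier H"
    have "RS_sum f (part n) (v \<oplus>\<^bsub>H\<^esub> w) = RS_sum f (part n) v \<oplus>\<^bsub>H\<^esub> RS_sum f (part n) w" for n
      unfolding RS_sum_def by (rule comb_add[OF dec v w])
    then show "U (v \<oplus>\<^bsub>H\<^esub> w) = U v \<oplus>\<^bsub>H\<^esub> U w"
      using conv[of "v \<oplus>\<^bsub>H\<^esub> w"] converges_add[OF conv[OF v] conv[OF w]] v w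
      by (intro converges_unique[of "\<lambda>n. RS_sum f (part n) (v \<oplus>\<^bsub>H\<^esub> w)"]) simp_all
    have "sprod H (RS_sum f (part n) v) (RS_sum f (part n) w) = sprod H v w" for n
      unfolding RS_sum_def using f(2) by (intro comb_isometric[OF dec v w]) auto
    then show "sprod H (U v) (U w) = sprod H v w"
      using converges_sprod2[OF conv[OF v] conv[OF w]] by (simp add: LIMSEQ_const_iff)
  next
    fix c v assume v: "v \<in> carrier H"
    have "RS_sum f (part n) (c \<odot>\<^bsub>H\<^esub> v) = c \<odot>\<^bsub>H\<^esub> RS_sum f (part n) v" for n
      unfolding RS_sum_def by (rule comb_smult[OF dec v])
    then show "U (c \<odot>\<^bsub>H\<^esub> v) = c \<odot>\<^bsub>H\<^esub> U v"
      using conv[of "c \<odot>\<^bsub>H\<^esub> v"] converges_smult[OF conv[OF v], of c] v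
      by (intro converges_unique[of "\<lambda>n. RS_sum f (part n) (c \<odot>\<^bsub>H\<^esub> v)"]) simp_all
  qed (use Uc inner_space_axioms in auto)
qed

text \<open>The operator V that integrates the conjugate function is a right inverse of U. Over one
  division the Riemann sums of f and of its conjugate are isometric and inverse to each other, so
  \<open>RS_sum f (part n) (V v)\<close> is as far from v as \<open>RS_sum ?g (part n) v\<close> is
  from V v, and that distance tends to 0.\<close>

lemma integrates_unitary_op:
  assumes f: "\<And>s t. cmod (f s - f t) \<le> \<bar>s - t\<bar>" "\<And>x. cmod (f x) = 1" and U: "integrates f U"
  shows "unitary_op H U"
proof -
  let ?g = "\<lambda>x. cnj (f x)"
  have g: "cmod (?g s - ?g t) \<le> \<bar>s - t\<bar>" for s t
    using f(1)[of s t] by (metis complex_cnj_diff complex_mod_cnj)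
  obtain V where V: "integrates ?g V" using integrates_exists[of ?g] g by blast
  have Uc: "U v \<in> carrier H" "V v \<in> carrier H" if "v \<in> carrier H" for v
    using U V that by (auto simp: integrates_def)
  have "U (V v) = v" if v: "v \<in> carrier H" for v
  proof (rule converges_unique)
    show "converges (\<lambda>n. RS_sum f (part n) (V v)) (U (V v))"
      by (intro integrates_converges U f Uc v)
    have Sc: "RS_sum h (part n) w \<in> carrier H" if "w \<in> carrier H" for h n w
      by (rule RS_sum_carrier[OF part(1) that])
    have "hnorm H (RS_sum f (part n) (V v) \<ominus>\<^bsub>H\<^esub> v) = hnorm H (RS_sum ?g (part n) v \<ominus>\<^bsub>H\<^esub> V v)" for n
    proof -
      have "f x * ?g x = 1" for x
        using complex_norm_square[of "f x"] f(2)[of x] by simp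
      then have "RS_sum f (part n) (RS_sum ?g (part n) v) = v"
        using v part(1) by (simp add: RS_sum_mult RS_sum_one)
      then have "RS_sum f (part n) (V v) \<ominus>\<^bsub>H\<^esub> v = RS_sum f (part n) (V v \<ominus>\<^bsub>H\<^esub> RS_sum ?g (part n) v)"
        using RS_sum_minus[OF part(1)] v Uc Sc by simp
      then have "hnorm H (RS_sum f (part n) (V v) \<ominus>\<^bsub>H\<^esub> v) = hnorm H (V v \<ominus>\<^bsub>H\<^esub> RS_sum ?g (part n) v)"
        using hnorm_RS_sum[OF part(1) _ f(2)] v Uc Sc by simp
      then show ?thesis using hnorm_minus_commute v Uc Sc by simp
    qed
    moreover have "converges (\<lambda>n. RS_sum ?g (part n) v) (V v)"
      using integrates_converges[OF V] g v by blast
    ultimately show "converges (\<lambda>n. RS_sum f (part n) (V v)) v"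
      using v Uc Sc by (simp add: converges_def)
  qed
  then have "U ` carrier H = carrier H"
    using Uc by (auto simp: image_iff) (metis)
  then show ?thesis
    using integrates_isometric_embedding[OF f U] by (simp add: unitary_op_def)
qed

end

section \<open>Square-summable sequences\<close>

definition l2 :: "(nat \<Rightarrow> complex) set" where
  "l2 = {a. summable (\<lambda>n. (cmod (a n))\<^sup>2)}"

lemma power2_sum_le: "(x + y)\<^sup>2 \<le> 2 * x\<^sup>2 + 2 * (y::real)\<^sup>2"
  using zero_le_power2[of "x - y"] by (simp add: power2_eq_square algebra_simps)

lemma l2_add: "a \<in> l2 \<Longrightarrow> b \<in> l2 \<Longrightarrow> (\<lambda>n. a n + b n) \<in> l2"
proof -
  assume "a \<in> l2" "b \<in> l2"
  then have *: "summable (\<lambda>n. 2 * (cmod (a n))\<^sup>2 + 2 * (cmod (b n))\<^sup>2)"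
    by (intro summable_add summable_mult) (auto simp: l2_def)
  have "(cmod (a n + b n))\<^sup>2 \<le> 2 * (cmod (a n))\<^sup>2 + 2 * (cmod (b n))\<^sup>2" for n
    using power_mono[OF norm_triangle_ineq[of "a n" "b n"] norm_ge_zero, of 2]
      power2_sum_le[of "cmod (a n)" "cmod (b n)"]
    by linarith
  then show "(\<lambda>n. a n + b n) \<in> l2"
    unfolding l2_def mem_Collect_eq by (intro summable_comparison_test'[OF *, of 0]) simp
qed

lemma l2_scale: "a \<in> l2 \<Longrightarrow> (\<lambda>n. c * a n) \<in> l2"
  by (simp add: l2_def norm_mult power_mult_distrib)

lemma l2_zero: "(\<lambda>n. 0) \<in> l2"
  by (simp add: l2_def)

lemma l2_summable:
  assumes "a \<in> l2" "b \<in> l2"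
  shows "summable (\<lambda>n. a n * cnj (b n))"
proof -
  have *: "summable (\<lambda>n. (cmod (a n))\<^sup>2 + (cmod (b n))\<^sup>2)"
    using assms by (intro summable_add) (auto simp: l2_def)
  have "cmod (a n) * cmod (b n) \<le> (cmod (a n))\<^sup>2 + (cmod (b n))\<^sup>2" for n
    using zero_le_power2[of "cmod (a n) - cmod (b n)"] zero_le_power2[of "cmod (a n)"]
      zero_le_power2[of "cmod (b n)"] unfolding power2_diff by linarith
  then show ?thesis
    by (intro summable_comparison_test'[OF *, of 0]) (simp add: norm_mult)
qed

text \<open>Transported along \<open>\<phi>\<close>, since the carrier has to live in a given type.\<close>

definition l2_space :: "((nat \<Rightarrow> complex) \<Rightarrow> 'a) \<Rightarrow> 'a hspace" where
  "l2_space \<phi> = \<lparr>carrier = \<phi> ` l2, monoid.mult = undefined, one = undefined, zero = \<phi> (\<lambda>n. 0),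
     add = (\<lambda>x y. \<phi> (\<lambda>n. inv_into UNIV \<phi> x n + inv_into UNIV \<phi> y n)), module.smult = (\<lambda>c x. \<phi> (\<lambda>n. c * inv_into UNIV \<phi> x n)),
     sprod = (\<lambda>x y. \<Sum>n. inv_into UNIV \<phi> x n * cnj (inv_into UNIV \<phi> y n))\<rparr>"

context
  fixes \<phi> :: "(nat \<Rightarrow> complex) \<Rightarrow> 'a"
  assumes \<phi>: "inj \<phi>"
begin

lemma l2_space_simps:
  "carrier (l2_space \<phi>) = \<phi> ` l2"
  "\<zero>\<^bsub>l2_space \<phi>\<^esub> = \<phi> (\<lambda>n. 0)"
  "\<phi> a \<oplus>\<^bsub>l2_space \<phi>\<^esub> \<phi> b = \<phi> (\<lambda>n. a n + b n)"
  "c \<odot>\<^bsub>l2_space \<phi>\<^esub> \<phi> a = \<phi> (\<lambda>n. c * a n)"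
  "sprod (l2_space \<phi>) (\<phi> a) (\<phi> b) = (\<Sum>n. a n * cnj (b n))"
  by (simp_all add: l2_space_def inv_f_f[OF \<phi>])

lemma l2_sprod_self:
  "a \<in> l2 \<Longrightarrow> sprod (l2_space \<phi>) (\<phi> a) (\<phi> a) = complex_of_real (\<Sum>n. (cmod (a n))\<^sup>2)"
  by (simp add: l2_space_simps complex_norm_square[symmetric] suminf_of_real l2_def
      del: of_real_power)

lemma l2_inner_space: "inner_space (l2_space \<phi>)"
proof -
  have "abelian_group (l2_space \<phi>)"
  proof (rule abelian_groupI, goal_cases)
    \<comment> \<open>The sixth obligation is the existence of additive inverses, the only one that
      calls for a witness.\<close>
    case (6 x)
    then obtain a where a: "a \<in> l2" "x = \<phi> a" by (auto simp: l2_space_simps)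
    show ?case
      by (rule bexI[of _ "\<phi> (\<lambda>n. - 1 * a n)"])
        (use l2_scale[OF a(1), of "- 1"] in \<open>simp_all add: a l2_space_simps\<close>)
  qed (auto simp: l2_space_simps l2_add l2_zero algebra_simps)
  then have "module (class_ring :: complex ring) (l2_space \<phi>)"
    by (intro moduleI class_cring.cring_axioms)
      (auto simp: l2_space_simps l2_scale algebra_simps)
  then interpret vectorspace "class_ring :: complex ring" "l2_space \<phi>"
    by (intro vectorspace.intro class_field)
  show ?thesis
  proof
    fix x y z and c :: complex
    assume x: "x \<in> carrier (l2_space \<phi>)"
    then obtain a where a: "a \<in> l2" "x = \<phi> a" by (auto simp: l2_space_simps)
    have sa: "summable (\<lambda>n. (cmod (a n))\<^sup>2)" using a by (simp add: l2_def)
    show "0 \<le> sprod (l2_space \<phi>) x x"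
      using sa by (simp add: a l2_sprod_self less_eq_complex_def suminf_nonneg del: of_real_power)
    show "x = \<zero>\<^bsub>l2_space \<phi>\<^esub>" if "sprod (l2_space \<phi>) x x = 0"
    proof -
      have "(\<Sum>n. (cmod (a n))\<^sup>2) = 0" using that by (simp add: a l2_sprod_self del: of_real_power)
      then have "a = (\<lambda>n. 0)" using suminf_eq_zero_iff[OF sa] by auto
      then show ?thesis by (simp add: a l2_space_simps)
    qed
    assume y: "y \<in> carrier (l2_space \<phi>)"
    then obtain b where b: "b \<in> l2" "y = \<phi> b" by (auto simp: l2_space_simps)
    show "sprod (l2_space \<phi>) (c \<odot>\<^bsub>l2_space \<phi>\<^esub> x) y = c * sprod (l2_space \<phi>) x y"
      using l2_summable[OF a(1) b(1)] by (simp add: a b l2_space_simps suminf_mult mult.assoc)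
    have "(\<lambda>n. cnj (a n * cnj (b n))) sums cnj (\<Sum>n. a n * cnj (b n))"
      using l2_summable[OF a(1) b(1)] by (simp only: sums_cnj summable_sums)
    then have "(\<Sum>n. b n * cnj (a n)) = cnj (\<Sum>n. a n * cnj (b n))"
      by (simp add: sums_unique[symmetric] mult.commute)
    then show "sprod (l2_space \<phi>) y x = cnj (sprod (l2_space \<phi>) x y)"
      by (simp add: a b l2_space_simps)
    assume "z \<in> carrier (l2_space \<phi>)"
    then obtain d where d: "d \<in> l2" "z = \<phi> d" by (auto simp: l2_space_simps)
    show "sprod (l2_space \<phi>) (x \<oplus>\<^bsub>l2_space \<phi>\<^esub> y) z = sprod (l2_space \<phi>) x z + sprod (l2_space \<phi>) y z"
      using suminf_add[OF l2_summable[OF a(1) d(1)] l2_summable[OF b(1) d(1)]]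
      by (simp add: a b d l2_space_simps algebra_simps)
  qed
qed

lemma l2_minus:
  assumes "a \<in> l2" "b \<in> l2"
  shows "\<phi> a \<ominus>\<^bsub>l2_space \<phi>\<^esub> \<phi> b = \<phi> (\<lambda>n. a n - b n)"
  using assms l2_scale[of b "-1"]
  by (subst inner_space.minus_eq_smult[OF l2_inner_space]) (auto simp: l2_space_simps)

text \<open>Together with \<open>l2_hnorm_leI\<close> this trades the norm for bounds on all finite
  sections, which pass to coordinatewise limits.\<close>

lemma l2_hnorm_le:
  assumes "a \<in> l2" "hnorm (l2_space \<phi>) (\<phi> a) \<le> e"
  shows "(\<Sum>n<k. (cmod (a n))\<^sup>2) \<le> e\<^sup>2"
proof -
  have sa: "summable (\<lambda>n. (cmod (a n))\<^sup>2)" using assms by (simp add: l2_def)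
  have "(\<Sum>n<k. (cmod (a n))\<^sup>2) \<le> (\<Sum>n. (cmod (a n))\<^sup>2)"
    using sa by (intro sum_le_suminf) auto
  also have "\<dots> = (hnorm (l2_space \<phi>) (\<phi> a))\<^sup>2"
    using suminf_nonneg[OF sa] by (simp add: hnorm_def l2_sprod_self[OF assms(1)] del: of_real_power)
  also have "\<dots> \<le> e\<^sup>2"
    using assms inner_space.hnorm_nonneg[OF l2_inner_space, of "\<phi> a"]
    by (intro power_mono) (auto simp: l2_space_simps)
  finally show ?thesis .
qed

lemma l2_hnorm_leI:
  assumes "\<And>k. (\<Sum>n<k. (cmod (a n))\<^sup>2) \<le> e\<^sup>2" "0 \<le> e"
  shows "a \<in> l2" "hnorm (l2_space \<phi>) (\<phi> a) \<le> e"
proof -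
  have sa: "summable (\<lambda>n. (cmod (a n))\<^sup>2)"
    using assms by (intro summableI_nonneg_bounded) auto
  then show "a \<in> l2" by (simp add: l2_def)
  then have "hnorm (l2_space \<phi>) (\<phi> a) = sqrt (\<Sum>n. (cmod (a n))\<^sup>2)"
    by (simp add: hnorm_def l2_sprod_self del: of_real_power)
  also have "\<dots> \<le> e"
    using suminf_le_const[OF sa assms(1)] assms(2) by (intro real_le_lsqrt) (auto intro!: suminf_nonneg sa)
  finally show "hnorm (l2_space \<phi>) (\<phi> a) \<le> e" .
qed

lemma l2_hilbert_space: "hilbert_space (l2_space \<phi>)"
proof -
  interpret inner_space "l2_space \<phi>" by (rule l2_inner_space)
  show ?thesis
  proof (rule hilbert_spaceI)
    fix \<sigma> assume \<sigma>: "Cauchy_seq \<sigma>"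
    have "\<exists>a\<in>l2. \<sigma> n = \<phi> a" for n
      using \<sigma> by (auto simp: Cauchy_seq_def l2_space_simps)
    then obtain a where a: "\<And>n. a n \<in> l2" "\<And>n. \<sigma> n = \<phi> (a n)" by metis
    have d2: "(\<lambda>k. a m k - a n k) \<in> l2" for m n
      using l2_add[OF a(1)[of m] l2_scale[OF a(1)[of n], of "-1"]] by simp
    have close: "\<exists>n0. \<forall>m\<ge>n0. \<forall>n\<ge>n0. \<forall>k. (\<Sum>i<k. (cmod (a m i - a n i))\<^sup>2) \<le> e\<^sup>2" if "e > 0" for e
    proof -
      have "\<forall>e>0. \<exists>n0. \<forall>m\<ge>n0. \<forall>n\<ge>n0. hnorm (l2_space \<phi>) (\<sigma> m \<ominus>\<^bsub>l2_space \<phi>\<^esub> \<sigma> n) < e"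
        using \<sigma> unfolding Cauchy_seq_def by (rule conjunct2)
      then obtain n0 where n0: "\<forall>m\<ge>n0. \<forall>n\<ge>n0. hnorm (l2_space \<phi>) (\<sigma> m \<ominus>\<^bsub>l2_space \<phi>\<^esub> \<sigma> n) < e"
        using \<open>e > 0\<close> by auto
      have "(\<Sum>i<k. (cmod (a m i - a n i))\<^sup>2) \<le> e\<^sup>2" if "m \<ge> n0" "n \<ge> n0" for m n k
      proof (rule l2_hnorm_le[OF d2])
        show "hnorm (l2_space \<phi>) (\<phi> (\<lambda>k. a m k - a n k)) \<le> e"
          using n0 that by (simp add: a l2_minus less_imp_le)
      qed
      then show ?thesis by blast
    qed
    have "Cauchy (\<lambda>n. a n i)" for i
    proof (rule metric_CauchyI)
      fix e :: real assume "e > 0"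
      then obtain n0 where n0: "\<forall>m\<ge>n0. \<forall>n\<ge>n0. \<forall>k. (\<Sum>i<k. (cmod (a m i - a n i))\<^sup>2) \<le> (e/2)\<^sup>2"
        using close[of "e/2"] by auto
      have "dist (a m i) (a n i) < e" if "m \<ge> n0" "n \<ge> n0" for m n
      proof -
        have "(cmod (a m i - a n i))\<^sup>2 \<le> (\<Sum>i<Suc i. (cmod (a m i - a n i))\<^sup>2)"
          by (rule member_le_sum) auto
        also have "\<dots> \<le> (e/2)\<^sup>2" using n0 that by blast
        finally have "cmod (a m i - a n i) \<le> e / 2"
          by (rule power2_le_imp_le) (use \<open>e > 0\<close> in simp)
        then show ?thesis using \<open>e > 0\<close> by (simp add: dist_norm)
      qed
      then show "\<exists>n0. \<forall>m\<ge>n0. \<forall>n\<ge>n0. dist (a m i) (a n i) < e" by blast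
    qed
    then have "\<exists>b. (\<lambda>n. a n i) \<longlonglongrightarrow> b" for i
      using Cauchy_convergent_iff convergent_def by blast
    then obtain b where b: "\<And>i. (\<lambda>n. a n i) \<longlonglongrightarrow> b i" by metis
    have lim: "\<exists>n0. \<forall>m\<ge>n0. \<forall>k. (\<Sum>i<k. (cmod (a m i - b i))\<^sup>2) \<le> e\<^sup>2" if "e > 0" for e
    proof -
      obtain n0 where n0: "\<forall>m\<ge>n0. \<forall>n\<ge>n0. \<forall>k. (\<Sum>i<k. (cmod (a m i - a n i))\<^sup>2) \<le> e\<^sup>2"
        using close[OF \<open>e > 0\<close>] by auto
      have "(\<Sum>i<k. (cmod (a m i - b i))\<^sup>2) \<le> e\<^sup>2" if "m \<ge> n0" for m k
      proof (rule LIMSEQ_le_const2)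
        show "(\<lambda>n. \<Sum>i<k. (cmod (a m i - a n i))\<^sup>2) \<longlonglongrightarrow> (\<Sum>i<k. (cmod (a m i - b i))\<^sup>2)"
          by (intro tendsto_intros b)
      qed (use n0 that in blast)
      then show ?thesis by blast
    qed
    \<comment> \<open>For b to lie in \<open>l2\<close>, one member of the sequence with finite
      distance from b is enough, because b is that member minus the difference.\<close>
    have "\<exists>n0. \<forall>k. (\<Sum>i<k. (cmod (a n0 i - b i))\<^sup>2) \<le> 1\<^sup>2"
      using lim[of 1] by auto
    then obtain n0 where "\<And>k. (\<Sum>i<k. (cmod (a n0 i - b i))\<^sup>2) \<le> 1\<^sup>2" by auto
    then have "(\<lambda>i. a n0 i - b i) \<in> l2" by (rule l2_hnorm_leI(1)) auto
    from l2_add[OF a(1)[of n0] l2_scale[OF this, of "-1"]] have bl: "b \<in> l2" by simp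
    have "converges \<sigma> (\<phi> b)"
      unfolding converges_def
    proof (intro conjI allI)
      show "\<sigma> n \<in> carrier (l2_space \<phi>)" for n using a by (simp add: l2_space_simps)
      show "\<phi> b \<in> carrier (l2_space \<phi>)" using bl by (simp add: l2_space_simps)
      show "(\<lambda>n. hnorm (l2_space \<phi>) (\<sigma> n \<ominus>\<^bsub>l2_space \<phi>\<^esub> \<phi> b)) \<longlonglongrightarrow> 0"
      proof (rule LIMSEQ_I)
        fix r :: real assume r: "r > 0"
        obtain n0 where n0: "\<forall>m\<ge>n0. \<forall>k. (\<Sum>i<k. (cmod (a m i - b i))\<^sup>2) \<le> (r/2)\<^sup>2"
          using lim[of "r/2"] r by auto
        have "norm (hnorm (l2_space \<phi>) (\<sigma> m \<ominus>\<^bsub>l2_space \<phi>\<^esub> \<phi> b) - 0) < r" if "m \<ge> n0" for m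
        proof -
          have "hnorm (l2_space \<phi>) (\<phi> (\<lambda>i. a m i - b i)) \<le> r / 2"
            using n0 that r by (intro l2_hnorm_leI(2)) auto
          moreover have "0 \<le> hnorm (l2_space \<phi>) (\<sigma> m \<ominus>\<^bsub>l2_space \<phi>\<^esub> \<phi> b)"
            using a bl by (intro hnorm_nonneg minus_carrier) (auto simp: l2_space_simps)
          ultimately show ?thesis using r by (simp add: a bl l2_minus)
        qed
        then show "\<exists>n0. \<forall>m\<ge>n0. norm (hnorm (l2_space \<phi>) (\<sigma> m \<ominus>\<^bsub>l2_space \<phi>\<^esub> \<phi> b) - 0) < r" by blast
      qed
    qed
    then show "\<exists>l. converges \<sigma> l" by blast
  qed
qed

end

text \<open>A real number is determined by the rationals below it. A complex sequence is thereby
  coded as a subset of the countable set of triples of a position, a flag for real or imaginary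
  part, and a rational; sets of natural numbers inject into the reals.\<close>

lemma inj_sequences_complex: "\<exists>j :: (nat \<Rightarrow> complex) \<Rightarrow> complex. inj j"
proof -
  let ?g = "\<lambda>a::nat \<Rightarrow> complex. {(n, b, q :: rat). if b then of_rat q < Re (a n) else of_rat q < Im (a n)}"
  have "inj ?g"
  proof (rule injI)
    fix a b assume eq: "?g a = ?g b"
    have re: "(of_rat q < Re (a n)) = (of_rat q < Re (b n))" for n and q :: rat
      using eqset_imp_iff[OF eq, of "(n, True, q)"] by simp
    have im: "(of_rat q < Im (a n)) = (of_rat q < Im (b n))" for n and q :: rat
      using eqset_imp_iff[OF eq, of "(n, False, q)"] by simp
    have *: "x = y" if "\<And>q. (of_rat q < x) = (of_rat q < y)" for x y :: real
    proof (rule linorder_cases)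
      assume "x < y"
      then obtain q where "x < of_rat q" "of_rat q < y" using of_rat_dense by blast
      then show ?thesis using that[of q] by simp
    next
      assume "y < x"
      then obtain q where "y < of_rat q" "of_rat q < x" using of_rat_dense by blast
      then show ?thesis using that[of q] by simp
    qed
    show "a = b"
      by (intro ext complex_eqI; rule *; rule re im)
  qed
  moreover obtain h :: "nat set \<Rightarrow> real" where "inj h"
    using eqpoll_imp_lepoll[OF nat_sets_eqpoll_reals] unfolding lepoll_def by (elim exE conjE)
  moreover have "inj (\<lambda>X :: (nat \<times> bool \<times> rat) set. to_nat ` X)"
    by (rule injI) (rule inj_image_eq_iff[OF inj_to_nat, THEN iffD1])
  moreover have "inj complex_of_real" by (rule injI) (rule of_real_eq_iff[THEN iffD1])
  ultimately have "inj (complex_of_real \<circ> (h \<circ> ((\<lambda>X. to_nat ` X) \<circ> ?g)))"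
    by (intro inj_compose)
  then show "\<exists>j :: (nat \<Rightarrow> complex) \<Rightarrow> complex. inj j" by (intro exI)
qed

section \<open>Positive semidefinite kernels\<close>

text \<open>The placement of the conjugate fits a product linear in its first argument: for a Gram
  matrix with entries (e_n, e_m), the sum is the squared norm of the combination with coefficients c
  n.\<close>

definition psd_kernel :: "(nat \<Rightarrow> nat \<Rightarrow> complex) \<Rightarrow> bool" where
  "psd_kernel \<kappa> \<longleftrightarrow> (\<forall>A c. finite A \<longrightarrow> 0 \<le> (\<Sum>n\<in>A. \<Sum>m\<in>A. c n * cnj (c m) * \<kappa> n m))"

lemma psd_kernel_diag: "psd_kernel \<kappa> \<Longrightarrow> 0 \<le> \<kappa> n n"
  unfolding psd_kernel_def by (drule spec[of _ "{n}"], drule spec[of _ "\<lambda>_. 1"]) simp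

lemma psd_kernel_pair:
  assumes "psd_kernel \<kappa>" "n \<noteq> m"
  shows "0 \<le> \<kappa> n n + cnj z * \<kappa> n m + z * \<kappa> m n + z * cnj z * \<kappa> m m"
  using assms(1)[unfolded psd_kernel_def, rule_format, of "{n, m}" "\<lambda>i. if i = n then 1 else z"] assms(2)
  by (simp add: add_ac)

text \<open>Nonnegative complex numbers are real. For z = 1 this relates the imaginary parts of the
  two entries, for z = \<i> the real parts.\<close>

lemma psd_kernel_hermitian:
  assumes "psd_kernel \<kappa>"
  shows "\<kappa> m n = cnj (\<kappa> n m)"
proof (cases "n = m")
  case True
  then show ?thesis using psd_kernel_diag[OF assms, of n] by (simp add: less_eq_complex_def complex_eq_iff)
next
  case False
  show ?thesis
    using psd_kernel_pair[OF assms False, of 1] psd_kernel_pair[OF assms False, of \<i>]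
      psd_kernel_diag[OF assms, of n] psd_kernel_diag[OF assms, of m]
    by (simp add: less_eq_complex_def complex_eq_iff)
qed

text \<open>If the quadratic term \<kappa> k k vanishes, the form along z = - t \<kappa> n k is
  affine in the real number t. Being bounded below, it has slope 0, and the slope is a multiple of
  the squared modulus of \<kappa> n k.\<close>

lemma psd_kernel_zero:
  assumes "psd_kernel \<kappa>" "\<kappa> k k = 0"
  shows "\<kappa> n k = 0"
proof (cases "n = k")
  case False
  let ?r = "(cmod (\<kappa> n k))\<^sup>2"
  have le: "2 * t * ?r \<le> Re (\<kappa> n n)" for t
  proof -
    let ?a = "\<kappa> n k"
    have "0 \<le> \<kappa> n n + cnj (- of_real t * ?a) * ?a + - of_real t * ?a * cnj ?a"
      using psd_kernel_pair[OF assms(1) False, of "- of_real t * ?a"]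
      unfolding assms(2) psd_kernel_hermitian[OF assms(1), of k n]
      by (simp only: mult_zero_right add_0_right)
    also have "\<dots> = \<kappa> n n - of_real (2 * t) * (?a * cnj ?a)"
    proof -
      have "x + - s * b * a + - s * a * b = x - (2 * s) * (a * b)" for x s a b :: complex
        by (simp add: algebra_simps)
      then show ?thesis
        by (simp only: complex_cnj_mult complex_cnj_minus complex_cnj_complex_of_real of_real_mult
            of_real_numeral)
    qed
    also have "\<dots> = \<kappa> n n - complex_of_real (2 * t * ?r)"
      by (simp only: complex_norm_square[symmetric] of_real_mult)
    finally have "0 \<le> Re (\<kappa> n n) - 2 * t * ?r"
      by (simp only: less_eq_complex_def minus_complex.sel Re_complex_of_real zero_complex.sel)
    then show ?thesis by linarith
  qed
  show ?thesis
  proof (rule ccontr)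
    assume "\<kappa> n k \<noteq> 0"
    then have r: "?r > 0" by simp
    \<comment> \<open>This value of t makes 2 t ?r exceed the real part of \<kappa> n n by 1,
      against \<open>le\<close>.\<close>
    have "2 * ((y + 1) / (2 * r)) * r = y + 1" if "r > 0" for y r :: real
      using that by (simp add: field_simps)
    from this[OF r, of "Re (\<kappa> n n)"] show False using le[of "(Re (\<kappa> n n) + 1) / (2 * ?r)"] by linarith
  qed
qed (use assms in simp)

text \<open>The Gram matrix that remains when the components along the k-th vector are removed. For
  a zero pivot the quotient is 0 and nothing changes, which is right for positive semidefinite
  \<kappa>, as row and column k are then zero already.\<close>

definition schur_complement :: "(nat \<Rightarrow> nat \<Rightarrow> complex) \<Rightarrow> nat \<Rightarrow> nat \<Rightarrow> nat \<Rightarrow> complex" where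
  "schur_complement \<kappa> k n m = \<kappa> n m - \<kappa> n k * \<kappa> k m / \<kappa> k k"

text \<open>Completing the square: the form of the complement at d is the form of \<kappa> at d with
  the k-th coefficient lowered by \<beta>, the choice that minimises over this coefficient.\<close>

lemma psd_schur_complement:
  assumes psd: "psd_kernel \<kappa>"
  shows "psd_kernel (schur_complement \<kappa> k)"
  unfolding psd_kernel_def schur_complement_def
proof (intro allI impI)
  fix A :: "nat set" and c :: "nat \<Rightarrow> complex" assume A: "finite A"
  \<comment> \<open>The square is completed in the k-th coefficient, so k is adjoined to the index
    set, with coefficient 0 if it was missing.\<close>
  define B where "B = insert k A"
  define d :: "nat \<Rightarrow> complex" where "d n = (if n \<in> A then c n else 0)" for n
  have B: "finite B" "k \<in> B" "A \<subseteq> B" using A by (auto simp: B_def)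
  have AB: "(\<Sum>n\<in>A. \<Sum>m\<in>A. c n * cnj (c m) * f n m) = (\<Sum>n\<in>B. \<Sum>m\<in>B. d n * cnj (d m) * f n m)"
    for f :: "nat \<Rightarrow> nat \<Rightarrow> complex"
  proof -
    have "(\<Sum>m\<in>A. c n * cnj (c m) * f n m) = (\<Sum>m\<in>B. c n * cnj (d m) * f n m)" for n
      using B by (intro sum.mono_neutral_cong_left) (auto simp: d_def)
    then have "(\<Sum>n\<in>A. \<Sum>m\<in>A. c n * cnj (c m) * f n m) = (\<Sum>n\<in>A. \<Sum>m\<in>B. c n * cnj (d m) * f n m)"
      by simp
    also have "\<dots> = (\<Sum>n\<in>B. \<Sum>m\<in>B. d n * cnj (d m) * f n m)"
      using B by (intro sum.mono_neutral_cong_left) (auto simp: d_def)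
    finally show ?thesis .
  qed
  show "0 \<le> (\<Sum>n\<in>A. \<Sum>m\<in>A. c n * cnj (c m) * (\<kappa> n m - \<kappa> n k * \<kappa> k m / \<kappa> k k))"
  proof (cases "\<kappa> k k = 0")
    case True
    then show ?thesis using psd A by (simp add: psd_kernel_def)
  next
    case False
    define b where "b = (\<Sum>n\<in>B. d n * \<kappa> n k)"
    define \<beta> where "\<beta> = b / \<kappa> k k"
    have b': "(\<Sum>m\<in>B. cnj (d m) * \<kappa> k m) = cnj b"
      unfolding b_def cnj_sum by (rule sum.cong) (simp_all add: psd_kernel_hermitian[OF psd, of k])
    have kk: "cnj (\<kappa> k k) = \<kappa> k k" by (rule psd_kernel_hermitian[OF psd, symmetric])
    let ?e = "\<lambda>n. d n - (if n = k then \<beta> else 0)"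
    have "(\<Sum>n\<in>B. \<Sum>m\<in>B. ?e n * cnj (?e m) * \<kappa> n m)
       = (\<Sum>n\<in>B. ?e n * ((\<Sum>m\<in>B. cnj (d m) * \<kappa> n m) - cnj \<beta> * \<kappa> n k))"
    proof (rule sum.cong[OF refl])
      fix n
      have "(\<Sum>m\<in>B. ?e n * cnj (?e m) * \<kappa> n m)
          = (\<Sum>m\<in>B. ?e n * (cnj (d m) * \<kappa> n m) - (if m = k then ?e n * (cnj \<beta> * \<kappa> n k) else 0))"
        by (rule sum.cong) (auto simp: algebra_simps)
      also have "\<dots> = ?e n * (\<Sum>m\<in>B. cnj (d m) * \<kappa> n m) - ?e n * (cnj \<beta> * \<kappa> n k)"
        unfolding sum_subtractf sum_distrib_left using B by simp
      finally show "(\<Sum>m\<in>B. ?e n * cnj (?e m) * \<kappa> n m)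
          = ?e n * ((\<Sum>m\<in>B. cnj (d m) * \<kappa> n m) - cnj \<beta> * \<kappa> n k)"
        by (simp add: right_diff_distrib)
    qed
    also have "\<dots> = (\<Sum>n\<in>B. d n * ((\<Sum>m\<in>B. cnj (d m) * \<kappa> n m) - cnj \<beta> * \<kappa> n k)
        - (if n = k then \<beta> * ((\<Sum>m\<in>B. cnj (d m) * \<kappa> k m) - cnj \<beta> * \<kappa> k k) else 0))"
      by (rule sum.cong) (auto simp: left_diff_distrib)
    also have "\<dots> = (\<Sum>n\<in>B. d n * (\<Sum>m\<in>B. cnj (d m) * \<kappa> n m)) - cnj \<beta> * b
        - \<beta> * (cnj b - cnj \<beta> * \<kappa> k k)"
    proof -
      have "(\<Sum>n\<in>B. d n * ((\<Sum>m\<in>B. cnj (d m) * \<kappa> n m) - cnj \<beta> * \<kappa> n k))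
          = (\<Sum>n\<in>B. d n * (\<Sum>m\<in>B. cnj (d m) * \<kappa> n m)) - cnj \<beta> * b"
        unfolding b_def sum_distrib_left[of "cnj \<beta>"] sum_subtractf[symmetric]
        by (rule sum.cong) (simp_all add: right_diff_distrib mult.left_commute)
      then show ?thesis
        unfolding sum_subtractf b' using B by simp
    qed
    also have "\<dots> = (\<Sum>n\<in>B. d n * (\<Sum>m\<in>B. cnj (d m) * \<kappa> n m)) - b * cnj b / \<kappa> k k"
      using False by (simp add: \<beta>_def kk right_diff_distrib)
    also have "b * cnj b / \<kappa> k k = (\<Sum>n\<in>B. \<Sum>m\<in>B. (d n * \<kappa> n k) * (cnj (d m) * \<kappa> k m)) / \<kappa> k k"
      unfolding b'[symmetric] unfolding b_def by (simp add: sum_product)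
    also have "(\<Sum>n\<in>B. d n * (\<Sum>m\<in>B. cnj (d m) * \<kappa> n m)) - \<dots>
        = (\<Sum>n\<in>B. \<Sum>m\<in>B. d n * cnj (d m) * (\<kappa> n m - \<kappa> n k * \<kappa> k m / \<kappa> k k))"
      unfolding sum_divide_distrib sum_distrib_left sum_subtractf[symmetric]
      by (intro sum.cong refl) (simp add: algebra_simps)
    finally have eq: "(\<Sum>n\<in>B. \<Sum>m\<in>B. ?e n * cnj (?e m) * \<kappa> n m)
      = (\<Sum>n\<in>B. \<Sum>m\<in>B. d n * cnj (d m) * (\<kappa> n m - \<kappa> n k * \<kappa> k m / \<kappa> k k))" .
    show ?thesis
      unfolding AB eq[symmetric] by (rule psd[unfolded psd_kernel_def, rule_format, OF B(1)])
  qed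
qed

primrec schur :: "(nat \<Rightarrow> nat \<Rightarrow> complex) \<Rightarrow> nat \<Rightarrow> nat \<Rightarrow> nat \<Rightarrow> complex" where
  "schur \<kappa> 0 = \<kappa>"
| "schur \<kappa> (Suc k) = schur_complement (schur \<kappa> k) k"

lemma psd_schur:
  assumes "psd_kernel \<kappa>"
  shows "psd_kernel (schur \<kappa> k)"
  using assms by (induction k) (simp_all add: psd_schur_complement)

text \<open>Rows eliminated earlier stay zero. Row k cancels in step k, or is zero beforehand when
  its pivot is zero, by \<open>psd_kernel_zero\<close>.\<close>

lemma schur_zero:
  assumes "psd_kernel \<kappa>"
  shows "n < k \<Longrightarrow> schur \<kappa> k n m = 0"
proof (induction k arbitrary: n m)
  case (Suc k)
  have "schur \<kappa> k k k = 0 \<Longrightarrow> schur \<kappa> k k m = 0"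
    using psd_kernel_zero[OF psd_schur[OF assms], of k k m]
      psd_kernel_hermitian[OF psd_schur[OF assms], of k k m] by simp
  then show ?case using Suc by (cases "n = k") (auto simp: schur_complement_def)
qed simp

text \<open>The rows of an infinite Cholesky factor of \<open>\<kappa>\<close>; a vanishing pivot gives a zero column,
  because then \<open>x / 0 = 0\<close>.\<close>

definition cholesky :: "(nat \<Rightarrow> nat \<Rightarrow> complex) \<Rightarrow> nat \<Rightarrow> nat \<Rightarrow> complex" where
  "cholesky \<kappa> n k = schur \<kappa> k n k / complex_of_real (sqrt (Re (schur \<kappa> k k k)))"

lemma cholesky_support: "psd_kernel \<kappa> \<Longrightarrow> n < k \<Longrightarrow> cholesky \<kappa> n k = 0"
  by (simp add: cholesky_def schur_zero)

lemma cholesky_l2: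
  assumes "psd_kernel \<kappa>"
  shows "cholesky \<kappa> n \<in> l2"
  unfolding l2_def mem_Collect_eq
  by (rule summable_finite[of "{..n}"]) (use assms in \<open>auto simp: cholesky_support not_le\<close>)

text \<open>Each summand is the amount by which one elimination step lowers the (n, m) entry. The
  sum telescopes and ends after step n, when row n has become zero.\<close>

lemma cholesky_gram:
  assumes psd: "psd_kernel \<kappa>"
  shows "(\<Sum>k. cholesky \<kappa> n k * cnj (cholesky \<kappa> m k)) = \<kappa> n m"
proof -
  have step: "cholesky \<kappa> n k * cnj (cholesky \<kappa> m k) = schur \<kappa> k n m - schur \<kappa> (Suc k) n m" for k
  proof -
    let ?d = "schur \<kappa> k k k"
    have d: "0 \<le> ?d" by (rule psd_kernel_diag[OF psd_schur[OF psd]])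
    have "complex_of_real (sqrt (Re ?d)) * complex_of_real (sqrt (Re ?d)) = ?d"
      using d by (simp add: less_eq_complex_def complex_eq_iff flip: of_real_mult)
    then show ?thesis
      using psd_kernel_hermitian[OF psd_schur[OF psd], of k m k]
      by (simp add: cholesky_def schur_complement_def)
  qed
  have "(\<Sum>k. cholesky \<kappa> n k * cnj (cholesky \<kappa> m k)) = (\<Sum>k<Suc n. cholesky \<kappa> n k * cnj (cholesky \<kappa> m k))"
    using psd by (intro suminf_finite) (auto simp: cholesky_support)
  also have "\<dots> = schur \<kappa> 0 n m - schur \<kappa> (Suc n) n m"
    unfolding step by (rule sum_lessThan_telescope')
  also have "schur \<kappa> (Suc n) n m = 0" by (rule schur_zero[OF psd]) simp
  finally show ?thesis by simp
qed

theorem psd_kernel_gram: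
  fixes x0 :: 'a
  assumes H: "inner_space (H :: 'a hspace)" and x0: "x0 \<in> carrier H" "x0 \<noteq> \<zero>\<^bsub>H\<^esub>"
    and psd: "psd_kernel \<kappa>"
  shows "\<exists>(K :: 'a hspace) e. hilbert_space K \<and> (\<forall>n. e n \<in> carrier K) \<and>
    (\<forall>n m. sprod K (e n) (e m) = \<kappa> n m)"
proof -
  interpret inner_space H by fact
  obtain j :: "(nat \<Rightarrow> complex) \<Rightarrow> complex" where j: "inj j"
    using inj_sequences_complex by blast
  \<comment> \<open>The multiples of one nonzero vector form a copy of the complex numbers inside
    the type of \<open>H\<close>; complex sequences are then injected into that copy.\<close>
  have "inj (\<lambda>c. c \<odot>\<^bsub>H\<^esub> x0)"
  proof (rule injI)
    fix c d assume "c \<odot>\<^bsub>H\<^esub> x0 = d \<odot>\<^bsub>H\<^esub> x0"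
    then have "c * sprod H x0 x0 = d * sprod H x0 x0"
      using sprod_smult_left[OF x0(1) x0(1)] by metis
    then show "c = d" using sprod_definite[OF x0(1)] x0(2) by auto
  qed
  then have \<phi>: "inj ((\<lambda>c. c \<odot>\<^bsub>H\<^esub> x0) \<circ> j)" using j by (rule inj_compose)
  let ?\<phi> = "(\<lambda>c. c \<odot>\<^bsub>H\<^esub> x0) \<circ> j"
  show ?thesis
  proof (intro exI conjI allI)
    show "hilbert_space (l2_space ?\<phi>)" by (rule l2_hilbert_space[OF \<phi>])
    show "?\<phi> (cholesky \<kappa> n) \<in> carrier (l2_space ?\<phi>)" for n
      using cholesky_l2[OF psd] by (simp only: l2_space_simps[OF \<phi>] imageI)
    show "sprod (l2_space ?\<phi>) (?\<phi> (cholesky \<kappa> n)) (?\<phi> (cholesky \<kappa> m)) = \<kappa> n m" for n m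
      by (simp only: l2_space_simps[OF \<phi>] cholesky_gram[OF psd])
  qed
qed

section \<open>Dilation of increasing matrix functions\<close>

text \<open>Positivity of increments is stated for families in which an index \<kappa> a may be
  repeated, because the kernel lives on pairs of a time and an index and several times can share an
  index.\<close>

locale increasing_function =
  fixes N :: nat and m :: "real \<Rightarrow> nat \<Rightarrow> nat \<Rightarrow> complex"
  assumes incr: "\<And>s t A \<kappa> c. \<lbrakk>s \<in> {0..2*pi}; t \<in> {0..2*pi}; s \<le> t; finite A; \<And>a. a \<in> A \<Longrightarrow> \<kappa> a < N\<rbrakk>
      \<Longrightarrow> 0 \<le> (\<Sum>a\<in>A. \<Sum>b\<in>A. c a * cnj (c b) * (m t (\<kappa> a) (\<kappa> b) - m s (\<kappa> a) (\<kappa> (b::nat))))"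
    and at_zero: "\<lbrakk>k < N; j < N\<rbrakk> \<Longrightarrow> m 0 k j = 0"
    and left: "\<lbrakk>t \<in> {0<..2*pi}; k < N; j < N\<rbrakk> \<Longrightarrow> ((\<lambda>s. m s k j) \<longlongrightarrow> m t k j) (at_left t)"
    and N_pos: "0 < N"
begin

text \<open>Points are added in order of decreasing time, so the new point x has the smallest one.
  Relative to the base time q x all terms involving x vanish, which leaves the induction hypothesis
  with r raised to q x. What remains is the form of the single increment from r to q x.\<close>

lemma kernel_nonneg:
  assumes "finite A"
  shows "\<And>r. \<lbrakk>0 \<le> r; r \<le> 2*pi; \<And>a. a \<in> A \<Longrightarrow> r \<le> q a \<and> q a \<le> 2*pi \<and> \<kappa> a < N\<rbrakk> \<Longrightarrow>
    0 \<le> (\<Sum>a\<in>A. \<Sum>b\<in>A. c a * cnj (c b) * (m (min (q a) (q b)) (\<kappa> a) (\<kappa> b) - m r (\<kappa> a) (\<kappa> (b::nat))))"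
  using assms
proof (induction A rule: finite_ranking_induct[where f = "\<lambda>a. - q a"])
  case (insert x S)
  show ?case
  proof (cases "x \<in> S")
    case True
    then show ?thesis using insert.IH[of r] insert.prems by (simp add: insert_absorb)
  next
    case False
    let ?T = "insert x S"
    let ?d = "\<lambda>u v a b. c a * cnj (c b) * (m u (\<kappa> a) (\<kappa> b) - m v (\<kappa> a) (\<kappa> b))"
    have qx: "0 \<le> q x" "r \<le> q x" "q x \<le> 2*pi" "r \<le> 2*pi" "\<And>y. y \<in> S \<Longrightarrow> q x \<le> q y"
      using insert.prems(1) insert.prems(3)[of x] insert.hyps(2) by auto
    have "(\<Sum>a\<in>?T. \<Sum>b\<in>?T. ?d (min (q a) (q b)) r a b)
        = (\<Sum>a\<in>?T. \<Sum>b\<in>?T. ?d (min (q a) (q b)) (q x) a b) + (\<Sum>a\<in>?T. \<Sum>b\<in>?T. ?d (q x) r a b)"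
      unfolding sum.distrib[symmetric] by (intro sum.cong refl) (simp add: right_diff_distrib)
    also have "(\<Sum>a\<in>?T. \<Sum>b\<in>?T. ?d (min (q a) (q b)) (q x) a b)
        = (\<Sum>a\<in>S. \<Sum>b\<in>S. ?d (min (q a) (q b)) (q x) a b)"
    proof -
      have "(\<Sum>b\<in>?T. ?d (min (q a) (q b)) (q x) a b) = (\<Sum>b\<in>S. ?d (min (q a) (q b)) (q x) a b)"
        if "a \<in> ?T" for a
        using False insert.hyps(1) that qx(5) by (auto simp: min.absorb1 min.absorb2)
      moreover have "(\<Sum>b\<in>S. ?d (min (q x) (q b)) (q x) x b) = 0"
        using qx(5) by (intro sum.neutral) (simp add: min.absorb1)
      ultimately show ?thesis using False insert.hyps(1) by simp
    qed
    finally have eq: "(\<Sum>a\<in>?T. \<Sum>b\<in>?T. ?d (min (q a) (q b)) r a b)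
        = (\<Sum>a\<in>S. \<Sum>b\<in>S. ?d (min (q a) (q b)) (q x) a b) + (\<Sum>a\<in>?T. \<Sum>b\<in>?T. ?d (q x) r a b)" .
    have 1: "0 \<le> (\<Sum>a\<in>S. \<Sum>b\<in>S. ?d (min (q a) (q b)) (q x) a b)"
      using insert.prems(3) qx by (intro insert.IH) simp_all
    have 2: "0 \<le> (\<Sum>a\<in>?T. \<Sum>b\<in>?T. ?d (q x) r a b)"
    proof (rule incr)
      show "r \<in> {0..2*pi}" "q x \<in> {0..2*pi}" using insert.prems(1) qx(1,3,4) by simp_all
    qed (use insert.prems(3) insert.hyps(1) qx(2) in auto)
    show ?thesis unfolding eq using 1 2 by (rule add_nonneg_nonneg)
  qed
qed simp

lemma diag_mono:
  assumes "s \<in> {0..2*pi}" "t \<in> {0..2*pi}" "s \<le> t" "k < N"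
  shows "m s k k \<le> m t k k"
  using incr[OF assms(1-3), of "{0}" "\<lambda>_. k" "\<lambda>_. 1"] assms(4) by simp

lemma left_seq:
  assumes t: "t \<in> {0..2*pi}" and s: "\<And>i. 0 \<le> s i \<and> s i \<le> t" "s \<longlonglongrightarrow> t" and kj: "k < N" "j < N"
  shows "(\<lambda>i. m (s i) k j) \<longlonglongrightarrow> m t k j"
proof (cases "t = 0")
  case True
  then have "s i = 0" for i using s(1)[of i] by auto
  then show ?thesis using True by simp
next
  case False
  then have t0: "t \<in> {0<..2*pi}" using t by auto
  show ?thesis
  proof (rule LIMSEQ_I)
    fix e :: real assume "e > 0"
    then have "eventually (\<lambda>s. dist (m s k j) (m t k j) < e) (at_left t)"
      using tendstoD[OF left[OF t0 kj]] by blast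
    then obtain b where b: "b < t" "\<And>s. b < s \<Longrightarrow> s < t \<Longrightarrow> dist (m s k j) (m t k j) < e"
      unfolding eventually_at_left_field by auto
    have "eventually (\<lambda>i. b < s i) sequentially" using s(2) b(1) by (rule order_tendstoD(1))
    then obtain i0 where i0: "\<And>i. i \<ge> i0 \<Longrightarrow> b < s i" by (auto simp: eventually_sequentially)
    have "norm (m (s i) k j - m t k j) < e" if "i \<ge> i0" for i
      using b(2)[of "s i"] i0[OF that] s(1)[of i] \<open>e > 0\<close>
      by (cases "s i = t") (auto simp: dist_norm)
    then show "\<exists>i0. \<forall>i\<ge>i0. norm (m (s i) k j - m t k j) < e" by blast
  qed
qed

lemma rational_left_seq:
  fixes t :: real
  assumes "0 \<le> t"
  shows "\<exists>\<rho> :: nat \<Rightarrow> rat. (\<forall>i. 0 \<le> (of_rat (\<rho> i) :: real) \<and> of_rat (\<rho> i) \<le> t) \<and> (\<lambda>i. of_rat (\<rho> i)) \<longlonglongrightarrow> t"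
proof (cases "t = 0")
  case True
  then show ?thesis by (intro exI[of _ "\<lambda>_. 0 :: rat"]) simp
next
  case False
  have "\<exists>q. max 0 (t - 1 / Suc i) < of_rat q \<and> of_rat q < t" for i :: nat
    using False assms by (intro of_rat_dense) auto
  then obtain \<rho> :: "nat \<Rightarrow> rat" where \<rho>: "\<And>i. max 0 (t - 1 / Suc i) < of_rat (\<rho> i) \<and> of_rat (\<rho> i) < t"
    by metis
  have \<rho>': "t - 1 / Suc i \<le> of_rat (\<rho> i)" "of_rat (\<rho> i) \<le> t" "0 \<le> (of_rat (\<rho> i) :: real)" for i
    using \<rho>[of i] by (simp_all only: max_less_iff_conj) linarith+
  have "(\<lambda>i. t - 1 / Suc i) \<longlonglongrightarrow> t - 0"
    by (rule tendsto_diff[OF tendsto_const LIMSEQ_Suc[OF lim_1_over_n]])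
  then have lo: "(\<lambda>i. t - 1 / Suc i) \<longlonglongrightarrow> t" by simp
  have "(\<lambda>i. of_rat (\<rho> i)) \<longlonglongrightarrow> t"
    by (rule tendsto_sandwich[OF _ _ lo tendsto_const]; rule always_eventually; rule allI; rule \<rho>')
  then show ?thesis using \<rho>' by blast
qed

lemma gram_family_exists:
  assumes "inner_space (H :: 'a hspace)" "x0 \<in> carrier H" "x0 \<noteq> \<zero>\<^bsub>H\<^esub>"
  shows "\<exists>(K :: 'a hspace) e. hilbert_space K \<and>
    (\<forall>t\<in>{0..2*pi}. \<forall>k<N. e t k \<in> carrier K) \<and>
    (\<forall>s\<in>{0..2*pi}. \<forall>t\<in>{0..2*pi}. \<forall>k<N. \<forall>j<N. sprod K (e s k) (e t j) = m (min s t) k j)"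
proof -
  \<comment> \<open>Clipping to [0, 2 pi] and reducing modulo N make every natural number code an
    admissible pair, so the kernel is total. \<open>idx\<close> below recovers the code of a given
    pair.\<close>
  define q where "q n = min (2*pi) (max 0 (of_rat (fst (from_nat n :: rat \<times> nat))))" for n
  define \<kappa> where "\<kappa> n = snd (from_nat n :: rat \<times> nat) mod N" for n
  have q: "0 \<le> q n" "q n \<le> 2*pi" and \<kappa>: "\<kappa> n < N" for n
    using N_pos by (auto simp: q_def \<kappa>_def)
  define ker where "ker a b = m (min (q a) (q b)) (\<kappa> a) (\<kappa> b)" for a b
  have "psd_kernel ker"
    unfolding psd_kernel_def
  proof (intro allI impI)
    fix A :: "nat set" and c :: "nat \<Rightarrow> complex" assume "finite A"
    from kernel_nonneg[OF this, of 0 q \<kappa> c] show "0 \<le> (\<Sum>a\<in>A. \<Sum>b\<in>A. c a * cnj (c b) * ker a b)"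
      using q \<kappa> by (simp add: ker_def at_zero)
  qed
  from psd_kernel_gram[OF assms this] obtain K :: "'a hspace" and e0
    where K: "hilbert_space K" and e0': "\<forall>n. e0 n \<in> carrier K" "\<forall>a b. sprod K (e0 a) (e0 b) = ker a b"
    by (elim exE conjE)
  note e0 = e0'(1)[rule_format] e0'(2)[rule_format]
  interpret hilbert_space K by fact
  define idx where "idx r k = to_nat (r :: rat, k :: nat)" for r k
  have idx: "q (idx r k) = of_rat r" "\<kappa> (idx r k) = k"
    if "0 \<le> (of_rat r :: real)" "of_rat r \<le> 2*pi" "k < N" for r k
    using that by (auto simp: q_def \<kappa>_def idx_def)
  have "\<forall>t\<in>{0::real..}. \<exists>\<rho> :: nat \<Rightarrow> rat. (\<forall>i. 0 \<le> (of_rat (\<rho> i) :: real) \<and> of_rat (\<rho> i) \<le> t) \<and>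
      (\<lambda>i. of_rat (\<rho> i)) \<longlonglongrightarrow> t"
    by (rule ballI) (rule rational_left_seq, simp)
  from bchoice[OF this] obtain \<rho> :: "real \<Rightarrow> nat \<Rightarrow> rat" where
    \<rho>': "\<forall>t\<in>{0::real..}. (\<forall>i. 0 \<le> (of_rat (\<rho> t i) :: real) \<and> of_rat (\<rho> t i) \<le> t) \<and>
      (\<lambda>i. of_rat (\<rho> t i)) \<longlonglongrightarrow> t" by (rule exE)
  have \<rho>: "0 \<le> (of_rat (\<rho> t i) :: real) \<and> of_rat (\<rho> t i) \<le> t"
    "(\<lambda>i. of_rat (\<rho> t i)) \<longlonglongrightarrow> t" if "0 \<le> t" for t i
    using \<rho>'[rule_format, of t] that by auto
  have gram: "sprod K (e0 (idx (\<rho> s i) k)) (e0 (idx (\<rho> t i') j)) = m (min (of_rat (\<rho> s i)) (of_rat (\<rho> t i'))) k j"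
    if "s \<in> {0..2*pi}" "t \<in> {0..2*pi}" "k < N" "j < N" for s t i i' k j
    using that \<rho>(1)[of s i] \<rho>(1)[of t i'] by (simp add: e0 ker_def idx)
  have lim: "\<exists>l. converges (\<lambda>i. e0 (idx (\<rho> t i) k)) l" if t: "t \<in> {0..2*pi}" and k: "k < N" for t k
  proof (rule Cauchy_converges, unfold Cauchy_seq_def, intro conjI allI impI e0)
    fix \<epsilon> :: real assume \<epsilon>: "\<epsilon> > 0"
    let ?s = "\<lambda>i. of_rat (\<rho> t i) :: real"
    have s: "0 \<le> ?s i" "?s i \<le> 2*pi" for i using \<rho>(1)[of t i] t by auto
    have "(\<lambda>i. m (?s i) k k) \<longlonglongrightarrow> m t k k"
      by (rule left_seq) (use \<rho>[of t] t k in simp_all)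
    then have "Cauchy (\<lambda>i. m (?s i) k k)" by (rule LIMSEQ_imp_Cauchy)
    then have "\<exists>i0. \<forall>i\<ge>i0. \<forall>i'\<ge>i0. dist (m (?s i) k k) (m (?s i') k k) < \<epsilon>\<^sup>2"
      by (rule metric_CauchyD) (use \<epsilon> in simp)
    then obtain i0 where i0: "\<forall>i\<ge>i0. \<forall>i'\<ge>i0. dist (m (?s i) k k) (m (?s i') k k) < \<epsilon>\<^sup>2"
      by (rule exE)
    \<comment> \<open>The minimum is one of the two times, so the four terms of the squared norm
      collapse to one difference of diagonal entries, controlled by the convergence of m along the
      sequence.\<close>
    have sq: "(hnorm K (e0 (idx (\<rho> t i) k) \<ominus>\<^bsub>K\<^esub> e0 (idx (\<rho> t i') k)))\<^sup>2
        \<le> cmod (m (?s i) k k - m (?s i') k k)" for i i'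
    proof -
      let ?m = "\<lambda>u. m u k k"
      have "(hnorm K (e0 (idx (\<rho> t i) k) \<ominus>\<^bsub>K\<^esub> e0 (idx (\<rho> t i') k)))\<^sup>2
          = Re (?m (?s i) - ?m (min (?s i) (?s i')) - ?m (min (?s i') (?s i)) + ?m (?s i'))"
        using e0(1) gram[OF t t k k] by (simp add: hnorm_sq)
      also have "\<dots> = Re (if ?s i \<le> ?s i' then ?m (?s i') - ?m (?s i) else ?m (?s i) - ?m (?s i'))"
        by (simp add: min_def)
      also have "\<dots> \<le> cmod (?m (?s i) - ?m (?s i'))"
        using complex_Re_le_cmod[of "?m (?s i) - ?m (?s i')"]
          complex_Re_le_cmod[of "?m (?s i') - ?m (?s i)"]
        by (simp only: norm_minus_commute[of "?m (?s i')"] split: if_split) simp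
      finally show ?thesis .
    qed
    have "hnorm K (e0 (idx (\<rho> t i) k) \<ominus>\<^bsub>K\<^esub> e0 (idx (\<rho> t i') k)) < \<epsilon>" if "i \<ge> i0" "i' \<ge> i0" for i i'
    proof (rule power2_less_imp_less)
      show "(hnorm K (e0 (idx (\<rho> t i) k) \<ominus>\<^bsub>K\<^esub> e0 (idx (\<rho> t i') k)))\<^sup>2 < \<epsilon>\<^sup>2"
        using sq[of i i'] i0[rule_format, OF that] by (simp add: dist_norm)
    qed (use \<epsilon> in simp)
    then show "\<exists>i0. \<forall>i\<ge>i0. \<forall>i'\<ge>i0.
        hnorm K (e0 (idx (\<rho> t i) k) \<ominus>\<^bsub>K\<^esub> e0 (idx (\<rho> t i') k)) < \<epsilon>" by blast
  qed
  define e where "e t k = (SOME l. converges (\<lambda>i. e0 (idx (\<rho> t i) k)) l)" for t k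
  have e: "converges (\<lambda>i. e0 (idx (\<rho> t i) k)) (e t k)" if "t \<in> {0..2*pi}" "k < N" for t k
    unfolding e_def by (rule someI_ex[OF lim[OF that]])
  show ?thesis
  proof (rule exI[of _ K], rule exI[of _ e], intro conjI ballI allI impI)
    show "hilbert_space K" by (rule K)
    show "e t k \<in> carrier K" if "t \<in> {0..2*pi}" "k < N" for t k
      using converges_carrier(1)[OF e[OF that]] .
    fix s t k j assume st: "s \<in> {0..2*pi}" "t \<in> {0..2*pi}" and kj: "k < N" "j < N"
    \<comment> \<open>The two times are approximated separately, but the minimum of the
      approximations still tends to min s t from below, so left continuity applies.\<close>
    have "(\<lambda>i. m (min (of_rat (\<rho> s i)) (of_rat (\<rho> t i))) k j) \<longlonglongrightarrow> m (min s t) k j"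
    proof (rule left_seq)
      show "(\<lambda>i. min (of_rat (\<rho> s i)) (of_rat (\<rho> t i))) \<longlonglongrightarrow> min s t"
        using st by (intro tendsto_min \<rho>(2)) auto
      show "0 \<le> min (of_rat (\<rho> s i) :: real) (of_rat (\<rho> t i)) \<and>
          min (of_rat (\<rho> s i)) (of_rat (\<rho> t i)) \<le> min s t" for i
        using st \<rho>(1)[of s i] \<rho>(1)[of t i] by (auto simp: min_def)
    qed (use st kj in auto)
    then have "(\<lambda>i. sprod K (e0 (idx (\<rho> s i) k)) (e0 (idx (\<rho> t i) j))) \<longlonglongrightarrow> m (min s t) k j"
      using st kj by (simp add: gram)
    then show "sprod K (e s k) (e t j) = m (min s t) k j"
      by (rule LIMSEQ_unique[OF converges_sprod2[OF e[OF st(1) kj(1)] e[OF st(2) kj(2)]]])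
  qed
qed

end

section \<open>The resolution of unity generated by a Gram family of curves\<close>

locale gram_family = hilbert_space H + increasing_function N m
  for H :: "'a hspace" and N m +
  fixes e :: "real \<Rightarrow> nat \<Rightarrow> 'a"
  assumes e_carrier: "\<lbrakk>t \<in> {0..2*pi}; k < N\<rbrakk> \<Longrightarrow> e t k \<in> carrier H"
    and e_gram: "\<lbrakk>s \<in> {0..2*pi}; t \<in> {0..2*pi}; k < N; j < N\<rbrakk> \<Longrightarrow> sprod H (e s k) (e t j) = m (min s t) k j"
begin

text \<open>For \<open>t > 0\<close> this is the closed span of the \<open>e s k\<close> with \<open>s \<le> t\<close>, plus the complement of
  all \<open>e s k\<close>, which would otherwise spoil \<open>F (2 * pi) = id\<close>.\<close>

definition L :: "real \<Rightarrow> 'a set" where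
  "L t = {v \<in> carrier H. \<forall>s\<in>{t..2*pi}. \<forall>k<N. sprod H v (e s k) = sprod H v (e t k)}"

text \<open>\<open>L 0\<close> consists of the vectors orthogonal to all \<open>e s k\<close>, so
  the value zero at time 0 has to be imposed. The complement then enters immediately after time 0,
  where left continuity asks for nothing, and the unitary operator acts on it as the
  identity.\<close>

definition F :: "real \<Rightarrow> 'a \<Rightarrow> 'a" where
  "F t v = (if t = 0 then \<zero>\<^bsub>H\<^esub> else proj_onto H (L t) v)"

lemma L_carrier: "v \<in> L t \<Longrightarrow> v \<in> carrier H"
  by (simp add: L_def)

lemma sprod_L_e:
  assumes "v \<in> L t" "t \<le> s" "s \<le> 2*pi" "k < N"
  shows "sprod H v (e s k) = sprod H v (e t k)"
proof -
  have "\<forall>s\<in>{t..2*pi}. \<forall>k<N. sprod H v (e s k) = sprod H v (e t k)"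
    using assms(1) unfolding L_def by blast
  from this[rule_format, of s k] assms show ?thesis by simp
qed

lemma L_I:
  assumes "v \<in> carrier H"
    "\<And>s k. \<lbrakk>t \<le> s; s \<le> 2*pi; k < N\<rbrakk> \<Longrightarrow> sprod H v (e s k) = sprod H v (e t k)"
  shows "v \<in> L t"
  unfolding L_def
proof (intro CollectI conjI ballI allI impI assms(1))
  fix s k assume "s \<in> {t..2*pi}" "k < N"
  then show "sprod H v (e s k) = sprod H v (e t k)" by (intro assms(2)) simp_all
qed

text \<open>\<open>L t\<close> is the orthogonal complement of the increments of the curves after
  time t.\<close>

lemma L_closed:
  assumes "t \<in> {0..2*pi}"
  shows "closed_subspace (L t)"
proof -
  let ?S = "{e s k \<ominus>\<^bsub>H\<^esub> e t k | s k. s \<in> {t..2*pi} \<and> k < N}"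
  have c: "e s k \<in> carrier H" if "s \<in> {t..2*pi}" "k < N" for s k
    using that assms by (intro e_carrier) auto
  have "L t = {v \<in> carrier H. \<forall>w\<in>?S. sprod H v w = 0}"
  proof (intro equalityI subsetI)
    fix v assume v: "v \<in> L t"
    then have vc: "v \<in> carrier H" by (rule L_carrier)
    have "sprod H v (e s k \<ominus>\<^bsub>H\<^esub> e t k) = 0" if "s \<in> {t..2*pi}" "k < N" for s k
      using sprod_L_e[OF v, of s k] vc c[OF that] c[of t k] that assms by simp
    then show "v \<in> {v \<in> carrier H. \<forall>w\<in>?S. sprod H v w = 0}" using vc by blast
  next
    fix v assume v: "v \<in> {v \<in> carrier H. \<forall>w\<in>?S. sprod H v w = 0}"
    then have vc: "v \<in> carrier H" by simp
    show "v \<in> L t"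
    proof (rule L_I[OF vc])
      fix s k assume s: "t \<le> s" "s \<le> 2*pi" "k < N"
      then have "sprod H v (e s k \<ominus>\<^bsub>H\<^esub> e t k) = 0" using v by auto
      then show "sprod H v (e s k) = sprod H v (e t k)"
        using vc c[of s k] c[of t k] s assms by simp
    qed
  qed
  moreover have "?S \<subseteq> carrier H" using c assms by force
  ultimately show ?thesis using closed_subspace_orth[of ?S] by simp
qed

lemma L_mono:
  assumes "s \<le> t" "t \<le> 2*pi"
  shows "L s \<subseteq> L t"
proof
  fix v assume v: "v \<in> L s"
  show "v \<in> L t"
  proof (rule L_I[OF L_carrier[OF v]])
    fix u k assume "t \<le> u" "u \<le> 2*pi" "k < N"
    then show "sprod H v (e u k) = sprod H v (e t k)"
      using sprod_L_e[OF v, of u k] sprod_L_e[OF v, of t k] assms by simp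
  qed
qed

lemma L_full: "L (2*pi) = carrier H"
proof (intro equalityI subsetI)
  fix v assume "v \<in> carrier H"
  then show "v \<in> L (2*pi)"
  proof (rule L_I)
    fix s k assume "2*pi \<le> s" "s \<le> 2*pi"
    then have "s = 2*pi" by (intro antisym)
    then show "sprod H v (e s k) = sprod H v (e (2*pi) k)" by simp
  qed
qed (rule L_carrier)

lemma e_in_L:
  assumes "s \<in> {0..2*pi}" "k < N"
  shows "e s k \<in> L s"
  by (rule L_I) (use assms in \<open>simp_all add: e_carrier e_gram min.absorb1\<close>)

lemma F_projection:
  assumes "t \<in> {0..2*pi}"
  shows "orth_projection H (F t)"
proof (cases "t = 0")
  case True
  then have "F t = (\<lambda>v. \<zero>\<^bsub>H\<^esub>)" by (simp add: F_def fun_eq_iff)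
  moreover have "c \<odot>\<^bsub>H\<^esub> \<zero>\<^bsub>H\<^esub> = \<zero>\<^bsub>H\<^esub>" for c
    by (rule vec_eqI) simp_all
  ultimately show ?thesis
    unfolding orth_projection_def
    by (intro conjI ballI linear_mapI inner_space_axioms) simp_all
next
  case False
  then have "F t = proj_onto H (L t)" by (simp add: F_def fun_eq_iff)
  then show ?thesis using orth_projection_proj_onto[OF L_closed[OF assms]] by simp
qed

lemmas F_proj_facts = orth_projection_facts[OF F_projection]

lemma F_in_L: "0 < t \<Longrightarrow> t \<le> 2*pi \<Longrightarrow> v \<in> carrier H \<Longrightarrow> F t v \<in> L t"
  using proj_onto_props(1)[OF L_closed] by (simp add: F_def)

lemma sprod_F_L:
  assumes "0 < t" "t \<le> 2*pi" "v \<in> carrier H" "z \<in> L t"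
  shows "sprod H (F t v) z = sprod H v z"
  using assms proj_onto_props(2)[OF L_closed, of t v z] by (simp add: F_def)

lemmas sprod_F_self = sprod_projection_self[OF F_projection]

lemma hnorm_F_le:
  assumes "t \<in> {0..2*pi}" "v \<in> carrier H"
  shows "hnorm H (F t v) \<le> hnorm H v"
proof -
  have Fc: "F t v \<in> carrier H" using assms F_proj_facts(1) by simp
  have "sprod H (F t v) (F t v) = sprod H (F t v) v"
    unfolding sprod_F_self[OF assms] by (rule sprod_self[OF Fc])
  then have "cmod (sprod H (F t v) (F t v)) \<le> hnorm H v * hnorm H (F t v)"
    using Cauchy_Schwarz[OF Fc assms(2)] by (simp add: mult.commute)
  then show ?thesis using assms Fc by (intro hnorm_le_of_sprod_le) auto
qed

lemma F_F_mono:
  assumes "0 \<le> s" "s \<le> t" "t \<le> 2*pi" "v \<in> carrier H"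
  shows "F s (F t v) = F s v"
proof (cases "s = 0")
  case False
  then have s: "0 < s" "0 < t" "s \<le> 2*pi" using assms by auto
  have c: "F t v \<in> carrier H" "F s v \<in> carrier H" using assms F_proj_facts(1) by auto
  have "proj_onto H (L s) (F t v) = F s v"
  proof (rule proj_onto_eqI)
    show "closed_subspace (L s)" using assms by (intro L_closed) auto
    show "F s v \<in> L s" using s assms by (intro F_in_L) auto
    fix z assume z: "z \<in> L s"
    then have "z \<in> L t" using L_mono[of s t] assms by auto
    then show "sprod H (F t v) z = sprod H (F s v) z"
      using z s assms by (simp add: sprod_F_L)
  qed (use c in simp)
  then show ?thesis using False by (simp add: F_def)
qed (simp add: F_def)

lemma hnorm_F_mono:
  assumes "0 \<le> s" "s \<le> t" "t \<le> 2*pi" "v \<in> carrier H"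
  shows "hnorm H (F s v) \<le> hnorm H (F t v)"
  using hnorm_F_le[of s "F t v"] assms F_proj_facts(1) by (simp add: F_F_mono)

lemma hnorm_F_diff:
  assumes "0 \<le> s" "s \<le> t" "t \<le> 2*pi" "v \<in> carrier H"
  shows "(hnorm H (F t v \<ominus>\<^bsub>H\<^esub> F s v))\<^sup>2 = (hnorm H (F t v))\<^sup>2 - (hnorm H (F s v))\<^sup>2"
proof -
  have c: "F t v \<in> carrier H" "F s v \<in> carrier H" using assms F_proj_facts(1) by auto
  have "sprod H (F s v) (F t v) = sprod H v (F s (F t v))"
    using assms c F_proj_facts(5)[of s v "F t v"] by simp
  also have "\<dots> = sprod H (F s v) v"
    using assms F_proj_facts(5)[of s v v] by (simp add: F_F_mono)
  also have "\<dots> = sprod H (F s v) (F s v)"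
    using assms c by (simp add: sprod_F_self sprod_self)
  finally have 1: "sprod H (F s v) (F t v) = sprod H (F s v) (F s v)" .
  have 2: "sprod H (F t v) (F s v) = sprod H (F s v) (F s v)"
    unfolding sprod_commute[OF c(2) c(1)] 1 using c by (simp add: sprod_self)
  show ?thesis using c by (simp add: hnorm_sq 1 2)
qed

text \<open>Along a sequence \<sigma> increasing to t, the norms of the projections increase and are
  bounded, so by Pythagoras the projections converge to some l. The defect w = F_t v - l lies in
  \<open>L t\<close> and is orthogonal to every \<open>L (\<sigma> n)\<close>. Left continuity of
  the curves makes w orthogonal to \<open>e t k\<close> as well, which places w in
  \<open>L (\<sigma> 0)\<close> and forces w = 0.\<close>

lemma F_left_continuous:
  assumes t: "t \<in> {0<..2*pi}" and v: "v \<in> carrier H"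
  shows "((\<lambda>s. hnorm H (F s v \<ominus>\<^bsub>H\<^esub> F t v)) \<longlongrightarrow> 0) (at_left t)"
proof -
  \<comment> \<open>The offset \<open>Suc (Suc n)\<close> gives \<sigma> 0 = t / 2 and keeps all
    terms positive, away from the exceptional value of \<open>F\<close> at 0.\<close>
  define \<sigma> where "\<sigma> n = t - t / real (Suc (Suc n))" for n
  have \<sigma>: "0 < \<sigma> n" "\<sigma> n < t" "\<sigma> n \<le> 2*pi" "0 \<le> \<sigma> n" "\<sigma> n \<le> t" for n
  proof -
    have "t / real (Suc (Suc n)) < t / 1" using t by (intro divide_strict_left_mono) auto
    then show p: "0 < \<sigma> n" by (simp add: \<sigma>_def)
    have "0 < t / real (Suc (Suc n))" using t by simp
    then show l: "\<sigma> n < t" unfolding \<sigma>_def by linarith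
    show "\<sigma> n \<le> 2*pi" "0 \<le> \<sigma> n" "\<sigma> n \<le> t" using t l p by auto
  qed
  have "(\<lambda>n. t - t * (1 / real (Suc (Suc n)))) \<longlonglongrightarrow> t - t * 0"
    by (intro tendsto_intros LIMSEQ_Suc[OF LIMSEQ_Suc[OF lim_1_over_n]])
  then have \<sigma>_lim: "\<sigma> \<longlonglongrightarrow> t" by (simp add: \<sigma>_def[abs_def])
  have \<sigma>_mono: "\<sigma> i \<le> \<sigma> n" if "i \<le> n" for i n
    unfolding \<sigma>_def using t that by (intro diff_left_mono divide_left_mono) auto
  define y where "y n = F (\<sigma> n) v" for n
  have yc: "y n \<in> carrier H" and Ftc: "F t v \<in> carrier H" for n
    using t v \<sigma>[of n] F_proj_facts(1) by (auto simp: y_def)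
  have ym: "(hnorm H (y n))\<^sup>2 \<le> (hnorm H (y n'))\<^sup>2" if "n \<le> n'" for n n'
    unfolding y_def using \<sigma>[of n] \<sigma>[of n'] \<sigma>_mono[OF that] v
    by (intro power_mono hnorm_F_mono hnorm_nonneg F_proj_facts(1)) auto
  have Cy: "Cauchy (\<lambda>n. (hnorm H (y n))\<^sup>2)"
  proof (rule convergent_Cauchy, rule Bseq_mono_convergent)
    show "Bseq (\<lambda>n. (hnorm H (y n))\<^sup>2)"
    proof (rule BseqI')
      fix n
      show "norm ((hnorm H (y n))\<^sup>2) \<le> (hnorm H v)\<^sup>2"
        unfolding y_def using \<sigma>[of n] v F_proj_facts(1)[of "\<sigma> n" v]
        by (simp add: power_mono hnorm_F_le)
    qed
    show "\<forall>n n'. n \<le> n' \<longrightarrow> (hnorm H (y n))\<^sup>2 \<le> (hnorm H (y n'))\<^sup>2" by (intro allI impI ym)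
  qed
  have "Cauchy_seq y"
    unfolding Cauchy_seq_def
  proof (intro conjI allI impI yc)
    fix \<epsilon> :: real assume \<epsilon>: "\<epsilon> > 0"
    then have "\<epsilon>\<^sup>2 > 0" by simp
    from metric_CauchyD[OF Cy this] obtain n0
      where n0: "\<forall>i\<ge>n0. \<forall>n\<ge>n0. dist ((hnorm H (y i))\<^sup>2) ((hnorm H (y n))\<^sup>2) < \<epsilon>\<^sup>2"
      by (rule exE)
    have le: "hnorm H (y n \<ominus>\<^bsub>H\<^esub> y i) < \<epsilon>" if "i \<ge> n0" "n \<ge> i" for i n
    proof (rule power2_less_imp_less)
      have "(hnorm H (y n \<ominus>\<^bsub>H\<^esub> y i))\<^sup>2 = (hnorm H (y n))\<^sup>2 - (hnorm H (y i))\<^sup>2"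
        unfolding y_def using \<sigma>[of i] \<sigma>[of n] \<sigma>_mono[OF that(2)] v by (intro hnorm_F_diff) auto
      also have "\<dots> \<le> dist ((hnorm H (y i))\<^sup>2) ((hnorm H (y n))\<^sup>2)" by (simp add: dist_real_def)
      also have "\<dots> < \<epsilon>\<^sup>2" using n0 that by auto
      finally show "(hnorm H (y n \<ominus>\<^bsub>H\<^esub> y i))\<^sup>2 < \<epsilon>\<^sup>2" .
    qed (use \<epsilon> in simp)
    have "hnorm H (y n \<ominus>\<^bsub>H\<^esub> y i) < \<epsilon>" if "i \<ge> n0" "n \<ge> n0" for i n
    proof (cases "i \<le> n")
      case False
      then show ?thesis using le[of n i] that hnorm_minus_commute[OF yc yc, of n i] by simp
    qed (use le that in simp)
    then show "\<exists>n0. \<forall>n\<ge>n0. \<forall>i\<ge>n0. hnorm H (y n \<ominus>\<^bsub>H\<^esub> y i) < \<epsilon>" by blast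
  qed
  then obtain l where l: "converges y l" using Cauchy_converges by blast
  have lc: "l \<in> carrier H" using l converges_carrier by blast
  note LD = closed_subspaceD[OF L_closed]
  have "l \<in> L t"
  proof (rule LD(5)[OF _ _ l])
    show "y n \<in> L t" for n
      unfolding y_def
      by (rule subsetD[OF L_mono F_in_L]) (use \<sigma>[of n] v t in auto)
  qed (use t in auto)
  define w where "w = F t v \<ominus>\<^bsub>H\<^esub> l"
  have wL: "w \<in> L t"
    unfolding w_def using t v \<open>l \<in> L t\<close> by (intro LD(6) F_in_L) auto
  have wc: "w \<in> carrier H" using Ftc lc by (simp add: w_def)
  have orth: "sprod H w z = 0" if z: "z \<in> L (\<sigma> i)" for i z
  proof -
    have zc: "z \<in> carrier H" using z by (rule L_carrier)
    have zt: "z \<in> L t" by (rule subsetD[OF L_mono z]) (use \<sigma>[of i] t in auto)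
    have "(\<lambda>n. sprod H (y n) z) \<longlonglongrightarrow> sprod H l z" by (rule converges_sprod[OF l zc])
    moreover have "eventually (\<lambda>n. sprod H (y n) z = sprod H v z) sequentially"
    proof (rule eventually_sequentiallyI[of i])
      fix n assume "i \<le> n"
      then have "z \<in> L (\<sigma> n)" by (intro subsetD[OF L_mono z] \<sigma>_mono \<sigma>)
      then show "sprod H (y n) z = sprod H v z" using \<sigma>[of n] v by (simp add: y_def sprod_F_L)
    qed
    ultimately have "sprod H l z = sprod H v z"
      by (rule LIMSEQ_unique[OF _ tendsto_eventually])
    then show ?thesis using zt t v zc lc Ftc by (simp add: w_def sprod_F_L)
  qed
  have e0: "sprod H w (e t k) = 0" if k: "k < N" for k
  proof -
    have ec: "e s k \<in> carrier H" if "0 \<le> s" "s \<le> 2*pi" for s using that k by (intro e_carrier) auto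
    have ec': "e (\<sigma> n) k \<in> carrier H" "e t k \<in> carrier H" for n
      using ec[of "\<sigma> n"] ec[of t] \<sigma>[of n] t by simp_all
    have "(\<lambda>n. hnorm H (e (\<sigma> n) k \<ominus>\<^bsub>H\<^esub> e t k)) \<longlonglongrightarrow> 0"
    proof -
      have "(\<lambda>n. Re (m t k k) - Re (m (\<sigma> n) k k)) \<longlonglongrightarrow> Re (m t k k) - Re (m t k k)"
        using t by (intro tendsto_intros left_seq \<sigma>_lim conjI \<sigma> k) simp
      moreover have "(hnorm H (e (\<sigma> n) k \<ominus>\<^bsub>H\<^esub> e t k))\<^sup>2 = Re (m t k k) - Re (m (\<sigma> n) k k)" for n
        using \<sigma>[of n] t k ec'(1)[of n] ec'(2)
        by (simp add: hnorm_sq e_gram min.absorb1 min.absorb2)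
      ultimately have "(\<lambda>n. sqrt ((hnorm H (e (\<sigma> n) k \<ominus>\<^bsub>H\<^esub> e t k))\<^sup>2)) \<longlonglongrightarrow> sqrt 0"
        by (intro tendsto_real_sqrt) simp
      then show ?thesis by (simp add: ec')
    qed
    then have conv: "converges (\<lambda>n. e (\<sigma> n) k) (e t k)"
      by (simp add: converges_def ec')
    have "(\<lambda>n. sprod H (e (\<sigma> n) k) w) \<longlonglongrightarrow> sprod H (e t k) w"
      by (rule converges_sprod[OF conv wc])
    moreover have "sprod H (e (\<sigma> n) k) w = 0" for n
    proof -
      have "sprod H w (e (\<sigma> n) k) = 0"
        using \<sigma>[of n] k by (intro orth[of _ n] e_in_L) auto
      then show ?thesis unfolding sprod_commute[OF wc ec'(1)] by simp
    qed
    ultimately have "sprod H (e t k) w = 0" by (simp add: LIMSEQ_const_iff)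
    then show ?thesis unfolding sprod_commute[OF ec'(2) wc] by simp
  qed
  \<comment> \<open>All products of w with curves from time \<sigma> 0 on are zero, in particular
    constant, which is the condition for \<open>L (\<sigma> 0)\<close>. As w is also orthogonal to
    that space, it is orthogonal to itself.\<close>
  have "w \<in> L (\<sigma> 0)"
  proof (rule L_I[OF wc])
    have 0: "sprod H w (e s k) = 0" if "s \<in> {\<sigma> 0..2*pi}" "k < N" for s k
    proof (cases "s < t")
      case True
      have "eventually (\<lambda>n. s < \<sigma> n) sequentially" by (rule order_tendstoD(1)[OF \<sigma>_lim True])
      then obtain n where "s < \<sigma> n" by (auto simp: eventually_sequentially)
      moreover have "0 < s" using that(1) \<sigma>(1)[of 0] by auto
      ultimately have "e s k \<in> L (\<sigma> n)"
        using \<sigma>[of n] that by (intro subsetD[OF L_mono e_in_L]) auto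
      then show ?thesis by (rule orth)
    next
      case False
      then show ?thesis using sprod_L_e[OF wL, of s k] e0[of k] that by simp
    qed
    fix s k assume "\<sigma> 0 \<le> s" "s \<le> 2*pi" "k < N"
    then show "sprod H w (e s k) = sprod H w (e (\<sigma> 0) k)"
      using 0[of s k] 0[of "\<sigma> 0" k] by simp
  qed
  then have "sprod H w w = 0" by (rule orth)
  then have "w = \<zero>\<^bsub>H\<^esub>" by (rule sprod_definite[OF wc])
  then have leq: "F t v = l" using minus_eq_zero_iff[OF Ftc lc] by (simp add: w_def)
  show ?thesis
  proof (rule tendstoI)
    fix \<epsilon> :: real assume \<epsilon>: "\<epsilon> > 0"
    have "(\<lambda>n. hnorm H (y n \<ominus>\<^bsub>H\<^esub> F t v)) \<longlonglongrightarrow> 0" using l leq by (simp add: converges_def)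
    then have "eventually (\<lambda>n. hnorm H (y n \<ominus>\<^bsub>H\<^esub> F t v) < \<epsilon>) sequentially"
      by (rule order_tendstoD(2)[OF _ \<epsilon>])
    then obtain n where n: "hnorm H (y n \<ominus>\<^bsub>H\<^esub> F t v) < \<epsilon>"
      by (auto simp: eventually_sequentially)
    show "eventually (\<lambda>s. dist (hnorm H (F s v \<ominus>\<^bsub>H\<^esub> F t v)) 0 < \<epsilon>) (at_left t)"
      unfolding eventually_at_left_field
    proof (intro exI[of _ "\<sigma> n"] conjI allI impI)
      show "\<sigma> n < t" by (rule \<sigma>)
      fix s assume s: "\<sigma> n < s" "s < t"
      then have s': "0 \<le> s" "s \<le> t" "t \<le> 2*pi" "\<sigma> n \<le> s" using \<sigma>(1)[of n] t by auto
      have Fs: "F s v \<in> carrier H" using s' v F_proj_facts(1) by auto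
      \<comment> \<open>From the sequence to arbitrary s: by Pythagoras and monotonicity the
        distance to F_t v does not increase with s, so one term of the sequence controls all s
        between it and t.\<close>
      have "(hnorm H (F t v \<ominus>\<^bsub>H\<^esub> F s v))\<^sup>2 = (hnorm H (F t v))\<^sup>2 - (hnorm H (F s v))\<^sup>2"
        using s' v by (intro hnorm_F_diff)
      also have "\<dots> \<le> (hnorm H (F t v))\<^sup>2 - (hnorm H (y n))\<^sup>2"
        unfolding y_def using s' v \<sigma>[of n] F_proj_facts(1)[of "\<sigma> n" v]
        by (intro diff_left_mono power_mono hnorm_F_mono hnorm_nonneg) auto
      also have "\<dots> = (hnorm H (F t v \<ominus>\<^bsub>H\<^esub> y n))\<^sup>2"
        unfolding y_def using \<sigma>[of n] t v by (intro hnorm_F_diff[symmetric]) auto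
      finally have "hnorm H (F t v \<ominus>\<^bsub>H\<^esub> F s v) \<le> hnorm H (F t v \<ominus>\<^bsub>H\<^esub> y n)"
        by (rule power2_le_imp_le) (use Ftc yc in simp)
      then show "dist (hnorm H (F s v \<ominus>\<^bsub>H\<^esub> F t v)) 0 < \<epsilon>"
        using n hnorm_minus_commute[OF Ftc Fs] hnorm_minus_commute[OF Ftc yc[of n]]
          hnorm_nonneg[of "F s v \<ominus>\<^bsub>H\<^esub> F t v"] Ftc Fs by (simp add: dist_real_def)
    qed
  qed
qed

text \<open>Elements of \<open>L t\<close> have, by definition, equal products with
  \<open>e (2*pi) k\<close> and \<open>e t k\<close>, and the latter lies in \<open>L t\<close>; so
  it is the projection. At t = 0 it has squared norm m 0 k k = 0, in agreement with
  \<open>F 0\<close>.\<close>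

lemma F_e:
  assumes t: "t \<in> {0..2*pi}" and k: "k < N"
  shows "F t (e (2*pi) k) = e t k"
proof (cases "t = 0")
  case True
  have "sprod H (e 0 k) (e 0 k) = 0" using k by (simp add: e_gram at_zero)
  then have "e 0 k = \<zero>\<^bsub>H\<^esub>" by (intro sprod_definite e_carrier k) simp_all
  then show ?thesis using True by (simp add: F_def)
next
  case False
  have c: "e t k \<in> carrier H" "e (2*pi) k \<in> carrier H" using t k by (auto intro!: e_carrier)
  have "proj_onto H (L t) (e (2*pi) k) = e t k"
  proof (rule proj_onto_eqI)
    fix z assume z: "z \<in> L t"
    then have zc: "z \<in> carrier H" by (rule L_carrier)
    have "sprod H z (e (2*pi) k) = sprod H z (e t k)"
      using sprod_L_e[OF z, of "2*pi" k] t k by simp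
    then show "sprod H (e (2*pi) k) z = sprod H (e t k) z"
      unfolding sprod_commute[OF zc c(1)] sprod_commute[OF zc c(2)] by simp
  next
    show "closed_subspace (L t)" by (rule L_closed[OF t])
    show "e t k \<in> L t" by (rule e_in_L[OF t k])
  qed (rule c)
  then show ?thesis using False by (simp add: F_def)
qed

lemma spectral_family_F: "hilbert_spectral_family H F"
proof unfold_locales
  show "orth_projection H (F t)" if "t \<in> {0..2*pi}" for t using F_projection[OF that] .
  show "sprod H (F s v) v \<le> sprod H (F t v) v"
    if "s \<in> {0..2*pi}" "t \<in> {0..2*pi}" "s \<le> t" "v \<in> carrier H" for s t v
  proof -
    have "(hnorm H (F s v))\<^sup>2 \<le> (hnorm H (F t v))\<^sup>2"
      using that F_proj_facts(1)[of s v] by (intro power_mono hnorm_F_mono hnorm_nonneg) auto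
    then show ?thesis unfolding sprod_F_self[OF that(1,4)] sprod_F_self[OF that(2,4)]
      by (simp add: less_eq_complex_def del: of_real_power)
  qed
  show "F 0 v = \<zero>\<^bsub>H\<^esub>" if "v \<in> carrier H" for v by (simp add: F_def)
  show "F (2*pi) v = v" if "v \<in> carrier H" for v
  proof -
    have "proj_onto H (L (2*pi)) v = v"
      by (rule proj_onto_eqI[OF L_closed]) (use that in \<open>simp_all add: L_full\<close>)
    then show ?thesis by (simp add: F_def)
  qed
qed

end

theorem (in increasing_function) dilation_exists:
  assumes "inner_space (H :: 'a hspace)" "x0 \<in> carrier H" "x0 \<noteq> \<zero>\<^bsub>H\<^esub>"
  shows "\<exists>(K :: 'a hspace) y U F. hilbert_space K \<and> (\<forall>k<N. y k \<in> carrier K) \<and> unitary_op K U \<and>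
    resolution_of_unity K U F \<and>
    (\<forall>t\<in>{0..2*pi}. \<forall>k<N. \<forall>j<N. sprod K (F t (y k)) (y j) = m t k j)"
proof -
  obtain K :: "'a hspace" and e where K: "hilbert_space K"
    and e: "\<forall>t\<in>{0..2*pi}. \<forall>k<N. e t k \<in> carrier K"
      "\<forall>s\<in>{0..2*pi}. \<forall>t\<in>{0..2*pi}. \<forall>k<N. \<forall>j<N. sprod K (e s k) (e t j) = m (min s t) k j"
    using gram_family_exists[OF assms] by (elim exE conjE)
  interpret K: hilbert_space K by fact
  interpret G: gram_family K N m e
    by unfold_locales (use e in \<open>simp_all only:\<close>)
  interpret S: hilbert_spectral_family K G.F by (rule G.spectral_family_F)
  let ?f = "\<lambda>t. exp (\<i> * complex_of_real t)"
  obtain U where U: "S.integrates ?f U"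
    using S.integrates_exists[of ?f] exp_i_Lipschitz by blast
  have un: "unitary_op K U"
    by (rule S.integrates_unitary_op[OF exp_i_Lipschitz _ U]) simp
  have res: "resolution_of_unity K U G.F"
    unfolding resolution_of_unity_def
  proof (intro conjI ballI impI)
    show "has_RS_integral ?f (\<lambda>t. sprod K (G.F t v) w) 0 (2*pi) (sprod K (U v) w)"
      if "v \<in> carrier K" "w \<in> carrier K" for v w
      using U that by (simp add: S.integrates_def)
  qed (simp_all only: G.F_left_continuous S.proj S.mono S.zero S.full)
  have "sprod K (G.F t (e (2*pi) k)) (e (2*pi) j) = m t k j"
    if "t \<in> {0..2*pi}" "k < N" "j < N" for t k j
    using that G.F_e[OF that(1,2)] e(2) by (simp add: min.absorb1)
  moreover have "e (2*pi) k \<in> carrier K" if "k < N" for k using e(1) that by simp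
  ultimately show ?thesis
    using K un res by blast
qed

section \<open>Gram matrices and isometries\<close>

context inner_space
begin

definition lin_comb :: "(nat \<Rightarrow> complex) \<Rightarrow> (nat \<Rightarrow> 'a) \<Rightarrow> nat \<Rightarrow> 'a" where
  "lin_comb \<alpha> x n = (\<Oplus>k\<in>{..<n}. \<alpha> k \<odot> x k)"

lemma lin_comb_carrier:
  "(\<And>k. k < n \<Longrightarrow> x k \<in> carrier H) \<Longrightarrow> lin_comb \<alpha> x n \<in> carrier H"
  unfolding lin_comb_def by (intro finsum_carrier) auto

lemma sprod_lin_comb_left:
  assumes "\<And>k. k < n \<Longrightarrow> x k \<in> carrier H" "w \<in> carrier H"
  shows "sprod H (lin_comb \<alpha> x n) w = (\<Sum>k<n. \<alpha> k * sprod H (x k) w)"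
  unfolding lin_comb_def using assms by (subst sprod_finsum_left) auto

lemma sprod_lin_comb_right:
  assumes "\<And>k. k < n \<Longrightarrow> x k \<in> carrier H" "w \<in> carrier H"
  shows "sprod H w (lin_comb \<alpha> x n) = (\<Sum>k<n. cnj (\<alpha> k) * sprod H w (x k))"
  unfolding lin_comb_def using assms by (subst sprod_finsum_right) auto

lemma sprod_lin_comb:
  assumes "\<And>k. k < n \<Longrightarrow> x k \<in> carrier H" "\<And>k. k < n' \<Longrightarrow> y k \<in> carrier H"
  shows "sprod H (lin_comb \<alpha> x n) (lin_comb \<beta> y n')
    = (\<Sum>k<n. \<Sum>j<n'. \<alpha> k * cnj (\<beta> j) * sprod H (x k) (y j))"
proof -
  have "sprod H (lin_comb \<alpha> x n) (lin_comb \<beta> y n') = (\<Sum>k<n. \<alpha> k * sprod H (x k) (lin_comb \<beta> y n'))"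
    using assms by (intro sprod_lin_comb_left lin_comb_carrier)
  also have "\<dots> = (\<Sum>k<n. \<Sum>j<n'. \<alpha> k * cnj (\<beta> j) * sprod H (x k) (y j))"
    using assms
    by (intro sum.cong refl) (simp add: sprod_lin_comb_right sum_distrib_left mult.assoc)
  finally show ?thesis .
qed

lemma lin_comb_add:
  assumes "\<And>k. k < n \<Longrightarrow> x k \<in> carrier H"
  shows "lin_comb \<alpha> x n \<oplus> lin_comb \<beta> x n = lin_comb (\<lambda>k. \<alpha> k + \<beta> k) x n"
proof (rule vec_eqI)
  fix z assume "z \<in> carrier H"
  then show "sprod H (lin_comb \<alpha> x n \<oplus> lin_comb \<beta> x n) z
      = sprod H (lin_comb (\<lambda>k. \<alpha> k + \<beta> k) x n) z"
    using assms by (simp add: sprod_lin_comb_left lin_comb_carrier sum.distrib distrib_right)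
qed (use assms in \<open>simp_all add: lin_comb_carrier\<close>)

lemma lin_comb_smult:
  assumes "\<And>k. k < n \<Longrightarrow> x k \<in> carrier H"
  shows "c \<odot> lin_comb \<alpha> x n = lin_comb (\<lambda>k. c * \<alpha> k) x n"
proof (rule vec_eqI)
  fix z assume "z \<in> carrier H"
  then show "sprod H (c \<odot> lin_comb \<alpha> x n) z = sprod H (lin_comb (\<lambda>k. c * \<alpha> k) x n) z"
    using assms by (simp add: sprod_lin_comb_left lin_comb_carrier sum_distrib_left mult.assoc)
qed (use assms in \<open>simp_all add: lin_comb_carrier\<close>)

lemma lin_comb_unit:
  assumes "\<And>k. k < n \<Longrightarrow> x k \<in> carrier H" "i < n"
  shows "lin_comb (\<lambda>k. if k = i then 1 else 0) x n = x i"
proof (rule vec_eqI)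
  fix z assume z: "z \<in> carrier H"
  have "(\<Sum>k<n. (if k = i then 1 else 0) * sprod H (x k) z)
      = (\<Sum>k<n. if k = i then sprod H (x k) z else 0)"
    by (rule sum.cong) auto
  then show "sprod H (lin_comb (\<lambda>k. if k = i then 1 else 0) x n) z = sprod H (x i) z"
    using assms z by (simp add: sprod_lin_comb_left)
qed (use assms in \<open>simp_all add: lin_comb_carrier\<close>)

text \<open>The span is taken of an image set, in which equal x k collapse. Coefficient sequences
  keep the indices apart, as the definition of the shift requires.\<close>

lemma lin_hull_eq:
  assumes x: "\<And>k. k < n \<Longrightarrow> x k \<in> carrier H"
  shows "lin_hull H x n = range (\<lambda>\<alpha>. lin_comb \<alpha> x n)"
proof
  have "submodule (class_ring :: complex ring) (range (\<lambda>\<alpha>. lin_comb \<alpha> x n)) H"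
  proof (rule submodule.intro)
    show "module (class_ring :: complex ring) H" by (rule module_axioms)
    show "range (\<lambda>\<alpha>. lin_comb \<alpha> x n) \<subseteq> carrier H" using x lin_comb_carrier by auto
    have "lin_comb (\<lambda>k. 0) x n = \<zero>"
      by (rule vec_eqI) (use x in \<open>simp_all add: lin_comb_carrier sprod_lin_comb_left\<close>)
    then show "\<zero> \<in> range (\<lambda>\<alpha>. lin_comb \<alpha> x n)" by (metis rangeI)
    show "v \<oplus> w \<in> range (\<lambda>\<alpha>. lin_comb \<alpha> x n)"
      if "v \<in> range (\<lambda>\<alpha>. lin_comb \<alpha> x n)" "w \<in> range (\<lambda>\<alpha>. lin_comb \<alpha> x n)" for v w
      using that lin_comb_add[OF x] by auto
    show "c \<odot> v \<in> range (\<lambda>\<alpha>. lin_comb \<alpha> x n)"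
      if "v \<in> range (\<lambda>\<alpha>. lin_comb \<alpha> x n)" for c v
      using that lin_comb_smult[OF x] by auto
  qed
  moreover have "x ` {..<n} \<subseteq> range (\<lambda>\<alpha>. lin_comb \<alpha> x n)"
  proof
    fix v assume "v \<in> x ` {..<n}"
    then obtain i where i: "i < n" "v = x i" by auto
    then have "v = lin_comb (\<lambda>k. if k = i then 1 else 0) x n" using lin_comb_unit[OF x] by simp
    then show "v \<in> range (\<lambda>\<alpha>. lin_comb \<alpha> x n)" by blast
  qed
  ultimately show "lin_hull H x n \<subseteq> range (\<lambda>\<alpha>. lin_comb \<alpha> x n)"
    unfolding lin_hull_def by (intro span_is_subset)
  have xc: "x ` {..<n} \<subseteq> carrier H" using x by auto
  interpret S: submodule "class_ring :: complex ring" "span (x ` {..<n})" H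
    by (rule span_is_submodule[OF xc])
  have xs: "x k \<in> span (x ` {..<n})" if "k < n" for k
    using in_own_span[OF xc] that by auto
  have "(\<Oplus>k\<in>A. \<alpha> k \<odot> x k) \<in> span (x ` {..<n})" if "finite A" "A \<subseteq> {..<n}" for \<alpha> A
    using that
  proof (induction A)
    case (insert k A)
    then have "(\<Oplus>k\<in>insert k A. \<alpha> k \<odot> x k) = \<alpha> k \<odot> x k \<oplus> (\<Oplus>k\<in>A. \<alpha> k \<odot> x k)"
      using x by (intro finsum_insert) (auto simp: Pi_def)
    then show ?case using insert xs by simp
  qed simp
  then show "range (\<lambda>\<alpha>. lin_comb \<alpha> x n) \<subseteq> lin_hull H x n"
    unfolding lin_hull_def lin_comb_def by auto
qed

end

lemma lin_comb_linear_map: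
  assumes "inner_space H" "inner_space K" and J: "linear_map class_ring H K J"
    and x: "\<And>k. k < n \<Longrightarrow> x k \<in> carrier H"
  shows "J (inner_space.lin_comb H \<alpha> x n) = inner_space.lin_comb K \<alpha> (\<lambda>k. J (x k)) n"
proof -
  interpret H: inner_space H by fact
  interpret K: inner_space K by fact
  note Jf = linear_map_facts[OF J]
  have z: "J \<zero>\<^bsub>H\<^esub> = \<zero>\<^bsub>K\<^esub>"
  proof (rule K.vec_eqI)
    show "J \<zero>\<^bsub>H\<^esub> \<in> carrier K" by (rule Jf(1)) simp
    have "0 \<odot>\<^bsub>H\<^esub> \<zero>\<^bsub>H\<^esub> = \<zero>\<^bsub>H\<^esub>" by (rule H.vec_eqI) simp_all
    then have "J \<zero>\<^bsub>H\<^esub> = 0 \<odot>\<^bsub>K\<^esub> J \<zero>\<^bsub>H\<^esub>" using Jf(3)[of "\<zero>\<^bsub>H\<^esub>" 0] by simp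
    then show "sprod K (J \<zero>\<^bsub>H\<^esub>) w = sprod K \<zero>\<^bsub>K\<^esub> w" if "w \<in> carrier K" for w
      using that K.sprod_smult_left[OF Jf(1)[OF H.zero_closed] that, of 0] by simp
  qed simp
  have "J (\<Oplus>\<^bsub>H\<^esub>k\<in>A. \<alpha> k \<odot>\<^bsub>H\<^esub> x k) = (\<Oplus>\<^bsub>K\<^esub>k\<in>A. \<alpha> k \<odot>\<^bsub>K\<^esub> J (x k))"
    if "finite A" "A \<subseteq> {..<n}" for A
    using that
  proof (induction A)
    case (insert k A)
    have c: "\<alpha> i \<odot>\<^bsub>H\<^esub> x i \<in> carrier H" "\<alpha> i \<odot>\<^bsub>K\<^esub> J (x i) \<in> carrier K" if "i \<in> insert k A" for i
      using that insert.prems x Jf(1) by auto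
    have "(\<Oplus>\<^bsub>H\<^esub>k\<in>insert k A. \<alpha> k \<odot>\<^bsub>H\<^esub> x k) = \<alpha> k \<odot>\<^bsub>H\<^esub> x k \<oplus>\<^bsub>H\<^esub> (\<Oplus>\<^bsub>H\<^esub>k\<in>A. \<alpha> k \<odot>\<^bsub>H\<^esub> x k)"
      using c insert.hyps by (intro H.finsum_insert) (auto simp: Pi_def)
    moreover have "(\<Oplus>\<^bsub>K\<^esub>k\<in>insert k A. \<alpha> k \<odot>\<^bsub>K\<^esub> J (x k))
        = \<alpha> k \<odot>\<^bsub>K\<^esub> J (x k) \<oplus>\<^bsub>K\<^esub> (\<Oplus>\<^bsub>K\<^esub>k\<in>A. \<alpha> k \<odot>\<^bsub>K\<^esub> J (x k))"
      using c insert.hyps by (intro K.finsum_insert) (auto simp: Pi_def)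
    moreover have "(\<Oplus>\<^bsub>H\<^esub>k\<in>A. \<alpha> k \<odot>\<^bsub>H\<^esub> x k) \<in> carrier H"
      using c by (intro H.finsum_carrier) auto
    ultimately show ?case
      using insert c[of k] x[of k] by (simp add: Jf)
  qed (simp add: z)
  then show ?thesis by (simp add: H.lin_comb_def K.lin_comb_def)
qed

text \<open>The squared norm of a difference of linear combinations depends only on the Gram matrix,
  so every linear relation among the x k also holds among the y k. Well-definedness of
  \<open>shift_op\<close> and of the embedding in \<open>isometry_of_gram\<close> rests on
  this.\<close>

lemma lin_comb_eq_of_gram:
  assumes "inner_space H" "inner_space K"
    and x: "\<And>k. k < n \<Longrightarrow> x k \<in> carrier H" and y: "\<And>k. k < n \<Longrightarrow> y k \<in> carrier K"
    and gram: "\<And>i j. i < n \<Longrightarrow> j < n \<Longrightarrow> sprod K (y i) (y j) = sprod H (x i) (x j)"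
    and eq: "inner_space.lin_comb H \<alpha> x n = inner_space.lin_comb H \<beta> x n"
  shows "inner_space.lin_comb K \<alpha> y n = inner_space.lin_comb K \<beta> y n"
proof -
  interpret H: inner_space H by fact
  interpret K: inner_space K by fact
  have iso: "sprod K (K.lin_comb a y n) (K.lin_comb b y n) = sprod H (H.lin_comb a x n) (H.lin_comb b x n)"
    for a b
    using x y gram by (simp add: H.sprod_lin_comb K.sprod_lin_comb)
  let ?u = "K.lin_comb \<alpha> y n" and ?v = "K.lin_comb \<beta> y n"
  have c: "?u \<in> carrier K" "?v \<in> carrier K" using y by (auto intro: K.lin_comb_carrier)
  have "sprod K (?u \<ominus>\<^bsub>K\<^esub> ?v) (?u \<ominus>\<^bsub>K\<^esub> ?v) = 0"
    using c by (simp add: iso eq)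
  then have "?u \<ominus>\<^bsub>K\<^esub> ?v = \<zero>\<^bsub>K\<^esub>" using c by (intro K.sprod_definite) auto
  then show ?thesis using K.minus_eq_zero_iff[OF c] by simp
qed

lemma isometry_of_gram:
  assumes H: "inner_space H" and K: "inner_space K"
    and x: "\<And>k. k < n \<Longrightarrow> x k \<in> carrier H" and y: "\<And>k. k < n \<Longrightarrow> y k \<in> carrier K"
    and gram: "\<And>i j. i < n \<Longrightarrow> j < n \<Longrightarrow> sprod K (y i) (y j) = sprod H (x i) (x j)"
    and span: "carrier H = lin_hull H x n"
  shows "\<exists>J. isometric_embedding H K J \<and> (\<forall>i<n. J (x i) = y i)"
proof -
  interpret H: inner_space H by fact
  interpret K: inner_space K by fact
  define J where "J v = K.lin_comb (SOME \<alpha>. v = H.lin_comb \<alpha> x n) y n" for v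
  have J: "J (H.lin_comb \<alpha> x n) = K.lin_comb \<alpha> y n" for \<alpha>
  proof -
    let ?\<beta> = "SOME \<beta>. H.lin_comb \<alpha> x n = H.lin_comb \<beta> x n"
    have "H.lin_comb \<alpha> x n = H.lin_comb ?\<beta> x n" by (rule someI[of _ \<alpha>]) simp
    then show ?thesis unfolding J_def
      by (intro lin_comb_eq_of_gram[OF H K x y gram]) simp_all
  qed
  have ex: "\<exists>\<alpha>. v = H.lin_comb \<alpha> x n" if "v \<in> carrier H" for v
    using that span H.lin_hull_eq[of n x, OF x] by blast
  have "isometric_embedding H K J"
    unfolding isometric_embedding_def
  proof (intro conjI ballI linear_mapI H K)
    fix v w assume "v \<in> carrier H" "w \<in> carrier H"
    then obtain \<alpha> \<beta> where [simp]: "v = H.lin_comb \<alpha> x n" "w = H.lin_comb \<beta> x n" using ex by blast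
    show "J (v \<oplus>\<^bsub>H\<^esub> w) = J v \<oplus>\<^bsub>K\<^esub> J w"
      using x y by (simp add: H.lin_comb_add K.lin_comb_add J)
    show "sprod K (J v) (J w) = sprod H v w"
      using x y gram by (simp add: J H.sprod_lin_comb K.sprod_lin_comb)
  next
    fix v assume "v \<in> carrier H"
    then obtain \<alpha> where [simp]: "v = H.lin_comb \<alpha> x n" using ex by blast
    show "J v \<in> carrier K" using y by (simp add: J K.lin_comb_carrier)
    show "J (c \<odot>\<^bsub>H\<^esub> v) = c \<odot>\<^bsub>K\<^esub> J v" for c
      using x y by (simp add: H.lin_comb_smult K.lin_comb_smult J)
  qed
  moreover have "J (x i) = y i" if "i < n" for i
    using J[of "\<lambda>k. if k = i then 1 else 0"] H.lin_comb_unit[OF x that] K.lin_comb_unit[OF y that]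
    by simp
  ultimately show ?thesis by blast
qed

lemma isometric_embedding_facts:
  assumes "isometric_embedding H K J"
  shows "v \<in> carrier H \<Longrightarrow> J v \<in> carrier K"
    "v \<in> carrier H \<Longrightarrow> w \<in> carrier H \<Longrightarrow> J (v \<oplus>\<^bsub>H\<^esub> w) = J v \<oplus>\<^bsub>K\<^esub> J w"
    "v \<in> carrier H \<Longrightarrow> J (c \<odot>\<^bsub>H\<^esub> v) = c \<odot>\<^bsub>K\<^esub> J v"
    "v \<in> carrier H \<Longrightarrow> w \<in> carrier H \<Longrightarrow> sprod K (J v) (J w) = sprod H v w"
  using assms linear_map_facts[of H K J] by (auto simp: isometric_embedding_def)

text \<open>A convergent sequence in the image pulls back to a Cauchy sequence in H, and
  completeness of H brings its limit back into the image. Closedness is what makes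
  \<open>proj_onto\<close> meaningful there.\<close>

lemma closed_subspace_isometric_image:
  assumes "hilbert_space H" "inner_space K" and J: "isometric_embedding H K J"
  shows "inner_space.closed_subspace K (J ` carrier H)" "inj_on J (carrier H)"
proof -
  interpret H: hilbert_space H by fact
  interpret K: inner_space K by fact
  note Jf = isometric_embedding_facts[OF J]
  have diff: "hnorm K (J v \<ominus>\<^bsub>K\<^esub> J w) = hnorm H (v \<ominus>\<^bsub>H\<^esub> w)" if "v \<in> carrier H" "w \<in> carrier H" for v w
    using that Jf by (simp add: hnorm_def)
  show inj: "inj_on J (carrier H)"
  proof (rule inj_onI)
    fix v w assume v: "v \<in> carrier H" and w: "w \<in> carrier H" and eq: "J v = J w"
    have "hnorm H (v \<ominus>\<^bsub>H\<^esub> w) = 0"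
      unfolding diff[OF v w, symmetric] eq K.hnorm_eq_0[OF K.minus_carrier[OF Jf(1)[OF w] Jf(1)[OF w]]]
      using K.minus_eq_zero_iff[OF Jf(1)[OF w] Jf(1)[OF w]] by simp
    then show "v = w"
      using H.hnorm_eq_0[OF H.minus_carrier[OF v w]] H.minus_eq_zero_iff[OF v w] by simp
  qed
  have lim: "l \<in> J ` carrier H" if \<sigma>: "\<And>n. \<sigma> n \<in> J ` carrier H" and l: "K.converges \<sigma> l" for \<sigma> l
  proof -
    have "\<forall>n. \<exists>h. h \<in> carrier H \<and> \<sigma> n = J h" using \<sigma> by blast
    from choice[OF this] obtain h where h: "\<forall>n. h n \<in> carrier H \<and> \<sigma> n = J (h n)" by (rule exE)
    have "H.Cauchy_seq h"
      using K.converges_Cauchy[OF l] h by (simp add: H.Cauchy_seq_def K.Cauchy_seq_def diff)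
    then obtain g where g: "H.converges h g" using H.Cauchy_converges by blast
    then have "K.converges \<sigma> (J g)"
      using h Jf(1) by (simp add: H.converges_def K.converges_def diff)
    then have "l = J g" by (rule K.converges_unique[OF l])
    then show ?thesis using H.converges_carrier(1)[OF g] by blast
  qed
  show "K.closed_subspace (J ` carrier H)"
    unfolding K.closed_subspace_def
  proof (intro conjI ballI allI impI)
    show "J ` carrier H \<subseteq> carrier K" using Jf(1) by auto
    have "J \<zero>\<^bsub>H\<^esub> = \<zero>\<^bsub>K\<^esub>"
      using Jf(1)[of "\<zero>\<^bsub>H\<^esub>"] Jf(4)[of "\<zero>\<^bsub>H\<^esub>" "\<zero>\<^bsub>H\<^esub>"] by (intro K.sprod_definite) auto
    then show "\<zero>\<^bsub>K\<^esub> \<in> J ` carrier H" by (metis H.zero_closed imageI)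
    show "v \<oplus>\<^bsub>K\<^esub> w \<in> J ` carrier H" if v: "v \<in> J ` carrier H" and w: "w \<in> J ` carrier H" for v w
    proof -
      obtain a b where "a \<in> carrier H" "b \<in> carrier H" "v = J a" "w = J b" using v w by blast
      then have "v \<oplus>\<^bsub>K\<^esub> w = J (a \<oplus>\<^bsub>H\<^esub> b)" "a \<oplus>\<^bsub>H\<^esub> b \<in> carrier H" by (simp_all add: Jf)
      then show ?thesis by blast
    qed
    show "c \<odot>\<^bsub>K\<^esub> v \<in> J ` carrier H" if v: "v \<in> J ` carrier H" for c v
    proof -
      obtain a where "a \<in> carrier H" "v = J a" using v by blast
      then have "c \<odot>\<^bsub>K\<^esub> v = J (c \<odot>\<^bsub>H\<^esub> a)" "c \<odot>\<^bsub>H\<^esub> a \<in> carrier H" by (simp_all add: Jf)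
      then show ?thesis by blast
    qed
    show "l \<in> J ` carrier H" if "\<forall>n. \<sigma> n \<in> J ` carrier H" "K.converges \<sigma> l" for \<sigma> l
      using lim that by blast
  qed
qed

text \<open>The map from u to v is the adjoint of J, so a spectral function has the form J* F_t J.
  The scalar products of spectral functions below are all computed through this identity.\<close>

lemma compression:
  assumes H: "hilbert_space H" and K: "hilbert_space K" and J: "isometric_embedding H K J"
    and u: "u \<in> carrier K" and w: "w \<in> carrier H"
  defines "v \<equiv> inv_into (carrier H) J (proj_onto K (J ` carrier H) u)"
  shows "v \<in> carrier H" "sprod H v w = sprod K u (J w)"
proof -
  interpret H: hilbert_space H by fact
  interpret K: hilbert_space K by fact
  note Jf = isometric_embedding_facts[OF J]
  note L = closed_subspace_isometric_image(1)[OF H K.inner_space_axioms J]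
  have p: "proj_onto K (J ` carrier H) u \<in> J ` carrier H" by (rule K.proj_onto_props(1)[OF L u])
  show v: "v \<in> carrier H" unfolding v_def by (rule inv_into_into[OF p])
  have "sprod H v w = sprod K (J v) (J w)" using Jf(4)[OF v w] by simp
  also have "J v = proj_onto K (J ` carrier H) u" unfolding v_def by (rule f_inv_into_f[OF p])
  also have "sprod K \<dots> (J w) = sprod K u (J w)"
    using w by (intro K.proj_onto_props(2)[OF L u]) simp
  finally show "sprod H v w = sprod K u (J w)" .
qed

section \<open>Unitary extensions of the shift\<close>

text \<open>Of the block Toeplitz structure this keeps the invariance of the Gram matrix under a
  shift by one block, which makes the shift well defined and isometric.\<close>

locale shift_system = hilbert_space H for H :: "'a hspace" +
  fixes x :: "nat \<Rightarrow> 'a" and N d :: nat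
  assumes N_pos: "0 < N"
    and x_carrier: "n < (d + 1) * N \<Longrightarrow> x n \<in> carrier H"
    and shift_invariant: "\<lbrakk>n < d * N; m < d * N\<rbrakk> \<Longrightarrow> sprod H (x (n + N)) (x (m + N)) = sprod H (x n) (x m)"
    and span_x: "carrier H = lin_hull H x ((d + 1) * N)"
begin

lemma x_carrier': "n < d * N \<Longrightarrow> x n \<in> carrier H" "n < d * N \<Longrightarrow> x (n + N) \<in> carrier H"
  by (simp_all add: x_carrier)

lemma domain_eq: "lin_hull H x (d * N) = range (\<lambda>\<alpha>. lin_comb \<alpha> x (d * N))"
  by (rule lin_hull_eq) (rule x_carrier'(1))

lemma x_in_domain: "n < d * N \<Longrightarrow> x n \<in> lin_hull H x (d * N)"
  using lin_comb_unit[of "d * N" x n] x_carrier'(1) unfolding domain_eq by (metis rangeI)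

text \<open>The coefficients of a vector need not be unique, but any two choices give the same
  image, because the shifted vectors have the same Gram matrix as the original ones.\<close>

lemma shift_op_lin_comb:
  "shift_op H x N (d * N) (lin_comb \<alpha> x (d * N)) = lin_comb \<alpha> (\<lambda>k. x (k + N)) (d * N)"
  unfolding shift_op_def
proof (rule the_equality)
  show "\<exists>\<beta>. lin_comb \<alpha> x (d * N) = (\<Oplus>\<^bsub>H\<^esub>k\<in>{..<d * N}. \<beta> k \<odot>\<^bsub>H\<^esub> x k) \<and>
      lin_comb \<alpha> (\<lambda>k. x (k + N)) (d * N) = (\<Oplus>\<^bsub>H\<^esub>k\<in>{..<d * N}. \<beta> k \<odot>\<^bsub>H\<^esub> x (k + N))"
    by (rule exI[of _ \<alpha>]) (simp add: lin_comb_def)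
  fix w assume "\<exists>\<beta>. lin_comb \<alpha> x (d * N) = (\<Oplus>\<^bsub>H\<^esub>k\<in>{..<d * N}. \<beta> k \<odot>\<^bsub>H\<^esub> x k) \<and>
      w = (\<Oplus>\<^bsub>H\<^esub>k\<in>{..<d * N}. \<beta> k \<odot>\<^bsub>H\<^esub> x (k + N))"
  then obtain \<beta> where \<beta>: "lin_comb \<beta> x (d * N) = lin_comb \<alpha> x (d * N)"
    "w = lin_comb \<beta> (\<lambda>k. x (k + N)) (d * N)" by (auto simp: lin_comb_def)
  show "w = lin_comb \<alpha> (\<lambda>k. x (k + N)) (d * N)"
    unfolding \<beta>(2)
    by (rule lin_comb_eq_of_gram[OF inner_space_axioms inner_space_axioms _ _ _ \<beta>(1)])
      (simp_all add: x_carrier' shift_invariant)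
qed

lemma shift_op_x:
  assumes "n < d * N"
  shows "shift_op H x N (d * N) (x n) = x (n + N)"
  using shift_op_lin_comb[of "\<lambda>k. if k = n then 1 else 0"]
    lin_comb_unit[of "d * N" x n] lin_comb_unit[of "d * N" "\<lambda>k. x (k + N)" n] x_carrier' assms
  by simp

end

locale unitary_extension = shift_system H x N d + K: hilbert_spectral_family K F
  for H :: "'a hspace" and x N d and K :: "'b hspace" and F +
  fixes J :: "'a \<Rightarrow> 'b" and U :: "'b \<Rightarrow> 'b"
  assumes J: "isometric_embedding H K J" and U: "unitary_op K U"
    and ext: "v \<in> lin_hull H x (d * N) \<Longrightarrow> U (J v) = J (shift_op H x N (d * N) v)"
    and res: "resolution_of_unity K U F"
begin

definition E :: "real \<Rightarrow> 'a \<Rightarrow> 'a" where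
  "E = (\<lambda>t\<in>{0..2*pi}. \<lambda>v\<in>carrier H.
     inv_into (carrier H) J (proj_onto K (J ` carrier H) (F t (J v))))"

lemmas Jf = isometric_embedding_facts[OF J]
lemmas Uf = isometric_embedding_facts[OF U[unfolded unitary_op_def, THEN conjunct1]]

lemma E_carrier: "t \<in> {0..2*pi} \<Longrightarrow> v \<in> carrier H \<Longrightarrow> E t v \<in> carrier H"
  and sprod_E: "\<lbrakk>t \<in> {0..2*pi}; v \<in> carrier H; w \<in> carrier H\<rbrakk> \<Longrightarrow> sprod H (E t v) w = sprod K (F t (J v)) (J w)"
  using compression[OF hilbert_space_axioms K.hilbert_space_axioms J K.F_facts(1)[OF _ Jf(1)]]
  by (simp_all add: E_def)

lemma integrates_U: "K.integrates (\<lambda>t. exp (\<i> * complex_of_real t)) U"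
  using res Uf(1) by (simp add: K.integrates_def resolution_of_unity_def)

lemma U_J_x: "n < d * N \<Longrightarrow> U (J (x n)) = J (x (n + N))"
  using ext[OF x_in_domain] shift_op_x by simp

lemma U_pow_J_x:
  assumes "k < N"
  shows "n \<le> d \<Longrightarrow> (U ^^ n) (J (x k)) = J (x (k + n * N))"
proof (induction n)
  case (Suc n)
  have "k + n * N < Suc n * N" using assms by simp
  also have "\<dots> \<le> d * N" using Suc.prems by (intro mult_right_mono) auto
  finally show ?case using Suc by (simp add: U_J_x algebra_simps)
qed simp

lemma moment_integral:
  assumes "n \<le> d" "k < N" "j < N"
  shows "has_RS_integral (\<lambda>t. exp (\<i> * complex_of_real t) ^ n) (\<lambda>t. sprod H (E t (x k)) (x j)) 0 (2*pi)
    (sprod H (x (k + n * N)) (x j))"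
proof -
  have "k < d * N + N" "j < d * N + N" using assms by auto
  then have c: "x k \<in> carrier H" "x j \<in> carrier H" by (simp_all add: x_carrier)
  have "k + n * N < N + n * N" using assms by simp
  also have "\<dots> \<le> (d + 1) * N" using assms(1) by simp
  finally have cn: "x (k + n * N) \<in> carrier H" by (rule x_carrier)
  have "has_RS_integral (\<lambda>t. exp (\<i> * complex_of_real t) ^ n) (\<lambda>t. sprod K (F t (J (x k))) (J (x j))) 0 (2*pi)
    (sprod K ((U ^^ n) (J (x k))) (J (x j)))"
  proof (rule K.has_RS_integral_power[OF exp_i_Lipschitz _ integrates_U])
    show "hnorm K (U v) = hnorm K v" if "v \<in> carrier K" for v
      using Uf(4)[OF that that] by (simp add: hnorm_def)
  qed (simp_all add: Jf(1) c)
  then have *: "has_RS_integral (\<lambda>t. exp (\<i> * complex_of_real t) ^ n) (\<lambda>t. sprod K (F t (J (x k))) (J (x j))) 0 (2*pi)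
    (sprod H (x (k + n * N)) (x j))"
    using assms c cn by (simp add: U_pow_J_x Jf(4))
  show ?thesis
    by (rule has_RS_integral_cong[THEN iffD1, OF _ _ *]) (simp_all add: sprod_E c)
qed

text \<open>Moving F_t to the other argument turns (F_t U J x_n, J x_m) into the product of U J x_n
  with the test vector F_t J x_m. The weak integral for U applies, and \<open>sprod_F_F\<close>
  produces the minimum.\<close>

lemma step_integral:
  assumes "n < d * N" "m < (d + 1) * N" "t \<in> {0..2*pi}"
  shows "has_RS_integral (\<lambda>\<tau>. exp (\<i> * complex_of_real \<tau>)) (\<lambda>\<tau>. sprod H (E (min \<tau> t) (x n)) (x m)) 0 (2*pi)
    (sprod H (E t (x (n + N))) (x m))"
proof -
  have c: "x n \<in> carrier H" "x m \<in> carrier H" "x (n + N) \<in> carrier H"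
    using assms x_carrier' x_carrier by auto
  have Fc: "F t (J (x m)) \<in> carrier K" by (rule K.F_facts(1)[OF assms(3) Jf(1)[OF c(2)]])
  have "has_RS_integral (\<lambda>\<tau>. exp (\<i> * complex_of_real \<tau>)) (\<lambda>\<tau>. sprod K (F \<tau> (J (x n))) (F t (J (x m)))) 0 (2*pi)
    (sprod K (U (J (x n))) (F t (J (x m))))"
    using integrates_U Jf(1)[OF c(1)] Fc by (simp add: K.integrates_def)
  also have "sprod K (U (J (x n))) (F t (J (x m))) = sprod K (F t (J (x (n + N)))) (J (x m))"
    using assms c by (simp add: U_J_x K.F_facts(5) Jf(1))
  also have "\<dots> = sprod H (E t (x (n + N))) (x m)"
    using assms c by (simp add: sprod_E)
  finally have *: "has_RS_integral (\<lambda>\<tau>. exp (\<i> * complex_of_real \<tau>)) (\<lambda>\<tau>. sprod K (F \<tau> (J (x n))) (F t (J (x m)))) 0 (2*pi)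
    (sprod H (E t (x (n + N))) (x m))" .
  show ?thesis
  proof (rule has_RS_integral_cong[THEN iffD1, OF _ _ *])
    fix \<tau> :: real assume \<tau>: "\<tau> \<in> {0..2*pi}"
    then have "min \<tau> t \<in> {0..2*pi}" using assms(3) by auto
    then show "sprod K (F \<tau> (J (x n))) (F t (J (x m))) = sprod H (E (min \<tau> t) (x n)) (x m)"
      using \<tau> assms c by (simp only: sprod_E K.sprod_F_F Jf(1))
  qed simp
qed

lemma sprod_E_commute:
  assumes "t \<in> {0..2*pi}" "n < (d + 1) * N" "m < (d + 1) * N"
  shows "sprod H (E t (x n)) (x m) = cnj (sprod H (E t (x m)) (x n))"
proof -
  have c: "J (x n) \<in> carrier K" "J (x m) \<in> carrier K" using assms x_carrier Jf(1) by auto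
  have "sprod K (F t (J (x n))) (J (x m)) = sprod K (J (x n)) (F t (J (x m)))"
    by (rule K.F_facts(5)[OF assms(1) c])
  also have "\<dots> = cnj (sprod K (F t (J (x m))) (J (x n)))"
    by (rule K.sprod_commute) (use K.F_facts(1)[OF assms(1)] c in auto)
  finally show ?thesis using assms x_carrier by (simp add: sprod_E)
qed

lemma form_nonneg:
  assumes "s \<in> {0..2*pi}" "t \<in> {0..2*pi}" "s \<le> t"
  shows "0 \<le> (\<Sum>k<N. \<Sum>j<N. c k * cnj (c j) * (sprod H (E t (x k)) (x j) - sprod H (E s (x k)) (x j)))"
proof -
  have xc: "x k \<in> carrier H" if "k < N" for k using that by (intro x_carrier) auto
  have yc: "J (x k) \<in> carrier K" if "k < N" for k using Jf(1) xc that by simp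
  define u where "u = K.lin_comb c (\<lambda>k. J (x k)) N"
  have u: "u \<in> carrier K" unfolding u_def by (rule K.lin_comb_carrier) (rule yc)
  have form: "sprod K (F t u) u = (\<Sum>k<N. \<Sum>j<N. c k * cnj (c j) * sprod H (E t (x k)) (x j))"
    if t: "t \<in> {0..2*pi}" for t
  proof -
    have lin: "linear_map class_ring K K (F t)" using K.proj[OF t] by (simp add: orth_projection_def)
    have "F t u = K.lin_comb c (\<lambda>k. F t (J (x k))) N"
      unfolding u_def
      by (rule lin_comb_linear_map[OF K.inner_space_axioms K.inner_space_axioms lin]) (rule yc)
    moreover have "F t (J (x k)) \<in> carrier K" if "k < N" for k
      by (rule K.F_facts(1)[OF t yc[OF that]])
    ultimately have "sprod K (F t u) u
        = (\<Sum>k<N. \<Sum>j<N. c k * cnj (c j) * sprod K (F t (J (x k))) (J (x j)))"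
      using yc by (simp add: u_def K.sprod_lin_comb)
    also have "\<dots> = (\<Sum>k<N. \<Sum>j<N. c k * cnj (c j) * sprod H (E t (x k)) (x j))"
      using t xc by (intro sum.cong refl) (simp add: sprod_E)
    finally show ?thesis .
  qed
  have "0 \<le> sprod K (F t u) u - sprod K (F s u) u"
    using K.mono[OF assms u] by simp
  then show ?thesis
    unfolding form[OF assms(1)] form[OF assms(2)] sum_subtractf[symmetric] right_diff_distrib .
qed

lemma E_zero: "v \<in> carrier H \<Longrightarrow> w \<in> carrier H \<Longrightarrow> sprod H (E 0 v) w = 0"
  by (simp add: sprod_E K.zero Jf(1))

lemma E_left_continuous:
  assumes t: "t \<in> {0<..2*pi}" and v: "v \<in> carrier H" and w: "w \<in> carrier H"
  shows "((\<lambda>s. sprod H (E s v) w) \<longlongrightarrow> sprod H (E t v) w) (at_left t)"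
proof -
  have lim: "((\<lambda>s. hnorm K (F s (J v) \<ominus>\<^bsub>K\<^esub> F t (J v))) \<longlongrightarrow> 0) (at_left t)"
    using res t Jf(1)[OF v] by (simp add: resolution_of_unity_def)
  then have lim': "((\<lambda>s. hnorm K (F s (J v) \<ominus>\<^bsub>K\<^esub> F t (J v)) * hnorm K (J w)) \<longlongrightarrow> 0) (at_left t)"
    by (rule tendsto_mult_left_zero)
  have ev: "eventually (\<lambda>s. s \<in> {0<..<t}) (at_left t)"
    using t by (intro eventually_at_left_real) simp
  have "((\<lambda>s. sprod H (E s v) w - sprod H (E t v) w) \<longlongrightarrow> 0) (at_left t)"
  proof (rule Lim_null_comparison[OF _ lim'])
    show "eventually (\<lambda>s. norm (sprod H (E s v) w - sprod H (E t v) w)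
        \<le> hnorm K (F s (J v) \<ominus>\<^bsub>K\<^esub> F t (J v)) * hnorm K (J w)) (at_left t)"
      using ev
    proof (rule eventually_mono)
      fix s assume "s \<in> {0<..<t}"
      then have st: "s \<in> {0..2*pi}" "t \<in> {0..2*pi}" using t by auto
      have c: "F s (J v) \<in> carrier K" "F t (J v) \<in> carrier K"
        using K.F_facts(1)[OF st(1) Jf(1)[OF v]] K.F_facts(1)[OF st(2) Jf(1)[OF v]] by auto
      show "norm (sprod H (E s v) w - sprod H (E t v) w)
        \<le> hnorm K (F s (J v) \<ominus>\<^bsub>K\<^esub> F t (J v)) * hnorm K (J w)"
        using K.Cauchy_Schwarz[OF K.minus_carrier[OF c] Jf(1)[OF w]] st v w c Jf(1)
        by (simp add: sprod_E)
    qed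
  qed
  then show ?thesis by (simp add: Lim_null[symmetric])
qed

end

text \<open>The two extension spaces may have different types.\<close>

lemma unitary_extension_unique:
  assumes "unitary_extension H x N d K F J U" "unitary_extension H x N d K' F' J' U'"
    and eq: "\<And>t k j. \<lbrakk>t \<in> {0..2*pi}; k < N; j < N\<rbrakk> \<Longrightarrow>
      sprod H (unitary_extension.E H K F J t (x k)) (x j)
      = sprod H (unitary_extension.E H K' F' J' t (x k)) (x j)"
  shows "unitary_extension.E H K F J = unitary_extension.E H K' F' J'"
proof -
  interpret A: unitary_extension H x N d K F J U by fact
  interpret B: unitary_extension H x N d K' F' J' U' by fact
  \<comment> \<open>Induction by blocks with x m fixed. The statement covers all t at once, because
    the integral for x (i + N) at one time uses the values for x i at all times.\<close>
  have step: "\<forall>t\<in>{0..2*pi}. sprod H (A.E t (x n)) (x m) = sprod H (B.E t (x n)) (x m)"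
    if m: "m < (d + 1) * N" and base: "\<And>n t. n < N \<Longrightarrow> t \<in> {0..2*pi} \<Longrightarrow>
        sprod H (A.E t (x n)) (x m) = sprod H (B.E t (x n)) (x m)"
      and n: "n < (d + 1) * N" for n m
    using n
  proof (induction n rule: less_induct)
    case (less n)
    show ?case
    proof (cases "n < N")
      case False
      define i where "i = n - N"
      have i: "n = i + N" "i < d * N" "i < n" using False less.prems A.N_pos by (auto simp: i_def)
      have IH: "sprod H (A.E t (x i)) (x m) = sprod H (B.E t (x i)) (x m)" if "t \<in> {0..2*pi}" for t
        using less.IH[OF i(3)] less.prems i(3) that by auto
      show ?thesis
      proof
        fix t :: real assume t: "t \<in> {0..2*pi}"
        note a = A.step_integral[OF i(2) m t] and b = B.step_integral[OF i(2) m t]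
        have "has_RS_integral (\<lambda>\<tau>. exp (\<i> * complex_of_real \<tau>)) (\<lambda>\<tau>. sprod H (B.E (min \<tau> t) (x i)) (x m)) 0 (2*pi)
          (sprod H (A.E t (x (i + N))) (x m))"
          by (rule has_RS_integral_cong[THEN iffD1, OF refl _ a], rule IH) (use t in auto)
        from has_RS_integral_unique[OF this b]
        show "sprod H (A.E t (x n)) (x m) = sprod H (B.E t (x n)) (x m)" by (simp add: i(1))
      qed
    qed (use base in blast)
  qed
  have lt: "k < (d + 1) * N" if "k < N" for k using that by simp
  have 1: "sprod H (A.E t (x n)) (x m) = sprod H (B.E t (x n)) (x m)"
    if "n < (d + 1) * N" "m < N" "t \<in> {0..2*pi}" for n m t
    using step[of m n] eq that lt by blast
  \<comment> \<open>\<open>1\<close> leaves the second index restricted to the first block.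
    Exchanging the arguments by Hermitian symmetry turns it into the base case for an arbitrary
    second index.\<close>
  have 2: "sprod H (A.E t (x n)) (x m) = sprod H (B.E t (x n)) (x m)"
    if nm: "n < (d + 1) * N" "m < (d + 1) * N" and t: "t \<in> {0..2*pi}" for n m t
  proof (rule step[OF nm(2) _ nm(1), THEN bspec, OF _ t])
    fix k t assume k: "k < N" and t: "(t::real) \<in> {0..2*pi}"
    show "sprod H (A.E t (x k)) (x m) = sprod H (B.E t (x k)) (x m)"
      unfolding A.sprod_E_commute[OF t lt[OF k] nm(2)] B.sprod_E_commute[OF t lt[OF k] nm(2)]
        1[OF nm(2) k t] ..
  qed
  let ?n = "(d + 1) * N"
  have gen: "\<exists>\<alpha>. v = A.lin_comb \<alpha> x ?n" if "v \<in> carrier H" for v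
    using that A.span_x A.lin_hull_eq[of ?n x, OF A.x_carrier] by blast
  have "A.E t v = B.E t v" if t: "t \<in> {0..2*pi}" and v: "v \<in> carrier H" for t v
  proof (rule A.vec_eqI)
    show "A.E t v \<in> carrier H" "B.E t v \<in> carrier H" using t v A.E_carrier B.E_carrier by auto
    fix w assume w: "w \<in> carrier H"
    obtain \<alpha> \<beta> where ab: "v = A.lin_comb \<alpha> x ?n" "w = A.lin_comb \<beta> x ?n" using gen v w by blast
    \<comment> \<open>Expansion over the generators, with linearity taken from the embedding I and
      the projection G t. It is stated for any extension so that it serves both.\<close>
    have form: "sprod H (unitary_extension.E H L G I t v) w
        = (\<Sum>k<?n. \<Sum>j<?n. \<alpha> k * cnj (\<beta> j) * sprod H (unitary_extension.E H L G I t (x k)) (x j))"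
      if "unitary_extension H x N d L G I V" for L G I V
    proof -
      interpret C: unitary_extension H x N d L G I V by fact
      note xc = A.x_carrier
      have Jx: "I (x k) \<in> carrier L" if "k < ?n" for k using C.Jf(1) xc that by blast
      have J: "I (A.lin_comb a x ?n) = C.K.lin_comb a (\<lambda>k. I (x k)) ?n" for a
        using C.J xc
        by (intro lin_comb_linear_map A.inner_space_axioms C.K.inner_space_axioms)
          (auto simp: isometric_embedding_def)
      have F: "G t (C.K.lin_comb \<alpha> (\<lambda>k. I (x k)) ?n) = C.K.lin_comb \<alpha> (\<lambda>k. G t (I (x k))) ?n"
        using C.K.proj[OF t] Jx
        by (intro lin_comb_linear_map C.K.inner_space_axioms) (auto simp: orth_projection_def)
      have GJ: "G t (I (x k)) \<in> carrier L" if "k < ?n" for k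
        by (rule C.K.F_facts(1)[OF t Jx[OF that]])
      have "sprod H (C.E t v) w = sprod L (G t (I v)) (I w)" by (rule C.sprod_E[OF t v w])
      also have "\<dots> = (\<Sum>k<?n. \<Sum>j<?n. \<alpha> k * cnj (\<beta> j) * sprod L (G t (I (x k))) (I (x j)))"
        unfolding ab J F by (rule C.K.sprod_lin_comb[OF GJ Jx])
      also have "\<dots> = (\<Sum>k<?n. \<Sum>j<?n. \<alpha> k * cnj (\<beta> j) * sprod H (C.E t (x k)) (x j))"
        using t xc by (intro sum.cong refl) (simp add: C.sprod_E)
      finally show ?thesis .
    qed
    show "sprod H (A.E t v) w = sprod H (B.E t v) w"
      unfolding form[OF assms(1)] form[OF assms(2)] using 2 t by (intro sum.cong refl) simp
  qed
  then show ?thesis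
    unfolding A.E_def B.E_def by (intro restrict_ext) (simp add: A.E_def B.E_def)
qed

section \<open>Matrix-valued solutions\<close>

text \<open>The matrix form conjugates the coefficient of the row index, the kernel form that of the
  column index; hence the substitution \<open>c k = cnj (v $ k)\<close>.\<close>

lemma psd_iff_form:
  assumes B: "B \<in> carrier_mat N N"
  shows "psd N B \<longleftrightarrow> (\<forall>c. 0 \<le> (\<Sum>k<N. \<Sum>j<N. c k * cnj (c j) * B $$ (k, j)))"
proof -
  have form: "(B *\<^sub>v v) \<bullet>c v = (\<Sum>k<N. \<Sum>j<N. cnj (v $ k) * cnj (cnj (v $ j)) * B $$ (k, j))"
    if v: "v \<in> carrier_vec N" for v
  proof -
    have "(B *\<^sub>v v) \<bullet>c v = (\<Sum>k<N. (\<Sum>j<N. B $$ (k, j) * v $ j) * cnj (v $ k))"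
      using v B by (auto simp: scalar_prod_def lessThan_atLeast0 conjugate_complex_def intro!: sum.cong)
    also have "\<dots> = (\<Sum>k<N. \<Sum>j<N. cnj (v $ k) * cnj (cnj (v $ j)) * B $$ (k, j))"
      by (simp add: sum_distrib_left sum_distrib_right mult_ac)
    finally show ?thesis .
  qed
  show ?thesis
  proof
    assume psd: "psd N B"
    show "\<forall>c. 0 \<le> (\<Sum>k<N. \<Sum>j<N. c k * cnj (c j) * B $$ (k, j))"
    proof
      fix c :: "nat \<Rightarrow> complex"
      define v where "v = vec N (\<lambda>i. cnj (c i))"
      have v: "v \<in> carrier_vec N" by (simp add: v_def)
      have "0 \<le> (B *\<^sub>v v) \<bullet>c v" using psd v by (simp add: psd_def)
      also have "\<dots> = (\<Sum>k<N. \<Sum>j<N. c k * cnj (c j) * B $$ (k, j))"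
        unfolding form[OF v] by (intro sum.cong refl) (simp add: v_def)
      finally show "0 \<le> (\<Sum>k<N. \<Sum>j<N. c k * cnj (c j) * B $$ (k, j))" .
    qed
  next
    assume c: "\<forall>c. 0 \<le> (\<Sum>k<N. \<Sum>j<N. c k * cnj (c j) * B $$ (k, j))"
    show "psd N B"
      unfolding psd_def
    proof (intro conjI ballI B)
      fix v :: "complex vec" assume v: "v \<in> carrier_vec N"
      show "0 \<le> (B *\<^sub>v v) \<bullet>c v"
        unfolding form[OF v] using spec[OF c, of "\<lambda>k. cnj (v $ k)"] .
    qed
  qed
qed

text \<open>Coefficients belonging to the same index \<kappa> a are added up, which turns the form
  over A into the form of the matrix.\<close>

lemma psd_form_reindexed:
  assumes B: "psd N B" and A: "finite A" "\<And>a. a \<in> A \<Longrightarrow> \<kappa> a < N"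
  shows "0 \<le> (\<Sum>a\<in>A. \<Sum>b\<in>A. c a * cnj (c b) * B $$ (\<kappa> a, \<kappa> b))"
proof -
  have group: "(\<Sum>a\<in>A. f a * g (\<kappa> a)) = (\<Sum>k<N. (\<Sum>a\<in>{a \<in> A. \<kappa> a = k}. f a) * g k)"
    for f and g :: "nat \<Rightarrow> complex"
  proof -
    have "(\<Sum>a\<in>A. f a * g (\<kappa> a)) = (\<Sum>k<N. \<Sum>a\<in>{a \<in> A. \<kappa> a = k}. f a * g (\<kappa> a))"
      by (rule sum.group[symmetric]) (use A in auto)
    also have "\<dots> = (\<Sum>k<N. (\<Sum>a\<in>{a \<in> A. \<kappa> a = k}. f a) * g k)"
      unfolding sum_distrib_right by (intro sum.cong refl) auto
    finally show ?thesis .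
  qed
  define C where "C k = (\<Sum>a\<in>{a \<in> A. \<kappa> a = k}. c a)" for k
  have C': "(\<Sum>a\<in>{a \<in> A. \<kappa> a = k}. cnj (c a)) = cnj (C k)" for k
    by (simp add: C_def)
  have "(\<Sum>a\<in>A. \<Sum>b\<in>A. c a * cnj (c b) * B $$ (\<kappa> a, \<kappa> b))
      = (\<Sum>a\<in>A. c a * (\<Sum>b\<in>A. cnj (c b) * B $$ (\<kappa> a, \<kappa> b)))"
    by (simp add: sum_distrib_left mult.assoc)
  also have "\<dots> = (\<Sum>a\<in>A. c a * (\<Sum>j<N. cnj (C j) * B $$ (\<kappa> a, j)))"
  proof (rule sum.cong[OF refl])
    fix a
    show "c a * (\<Sum>b\<in>A. cnj (c b) * B $$ (\<kappa> a, \<kappa> b)) = c a * (\<Sum>j<N. cnj (C j) * B $$ (\<kappa> a, j))"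
      unfolding group[of "\<lambda>b. cnj (c b)" "\<lambda>j. B $$ (\<kappa> a, j)"] C' ..
  qed
  also have "\<dots> = (\<Sum>k<N. C k * (\<Sum>j<N. cnj (C j) * B $$ (k, j)))"
    unfolding C_def by (rule group[of c "\<lambda>k. \<Sum>j<N. cnj (\<Sum>b\<in>{b \<in> A. \<kappa> b = j}. c b) * B $$ (k, j)"])
  also have "\<dots> = (\<Sum>k<N. \<Sum>j<N. C k * cnj (C j) * B $$ (k, j))"
    by (simp add: sum_distrib_left mult.assoc)
  finally show ?thesis
    using B psd_iff_form[of B N] by (simp add: psd_def)
qed

lemma has_RS_integral_one:
  assumes "a \<le> b"
  shows "has_RS_integral (\<lambda>t. 1) g a b (g b - g a)"
  unfolding has_RS_integral_def
proof (intro allI impI)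
  fix e :: real assume e: "e > 0"
  show "\<exists>\<delta>>0. \<forall>p. p tagged_division_of {a..b} \<and> (\<lambda>x. ball x \<delta>) fine p \<longrightarrow>
      cmod ((\<Sum>(x, K)\<in>p. 1 * (g (Sup K) - g (Inf K))) - (g b - g a)) < e"
  proof (rule exI[of _ 1], intro conjI allI impI)
    fix p assume "p tagged_division_of {a..b} \<and> (\<lambda>x. ball x 1) fine p"
    then have "(\<Sum>(x, K)\<in>p. 1 * (g (Sup K) - g (Inf K))) = g b - g a"
      using additive_tagged_division_1[OF assms, of p g] by simp
    then show "cmod ((\<Sum>(x, K)\<in>p. 1 * (g (Sup K) - g (Inf K))) - (g b - g a)) < e"
      using e by simp
  qed simp
qed

text \<open>Monotonicity squeezes the diagonal at time t to 0, and a positive semidefinite kernel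
  with zero diagonal vanishes. Reduction modulo N extends the matrix to a kernel on all natural
  numbers.\<close>

lemma (in increasing_function) eq_zero:
  assumes full: "\<And>k. k < N \<Longrightarrow> m (2*pi) k k = 0" and t: "t \<in> {0..2*pi}" and kj: "k < N" "j < N"
  shows "m t k j = 0"
proof -
  have diag: "m t i i = 0" if i: "i < N" for i
    using diag_mono[of 0 t i] diag_mono[of t "2*pi" i] t i full[OF i] at_zero[OF i i]
    by (simp add: order.antisym)
  have "psd_kernel (\<lambda>a b. m t (a mod N) (b mod N))"
    unfolding psd_kernel_def
  proof (intro allI impI)
    fix A :: "nat set" and c :: "nat \<Rightarrow> complex" assume A: "finite A"
    have "0 \<le> (\<Sum>a\<in>A. \<Sum>b\<in>A. c a * cnj (c b) * (m t (a mod N) (b mod N) - m 0 (a mod N) (b mod N)))"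
      using t N_pos by (intro incr A) auto
    then show "0 \<le> (\<Sum>a\<in>A. \<Sum>b\<in>A. c a * cnj (c b) * m t (a mod N) (b mod N))"
      using N_pos by (simp add: at_zero)
  qed
  from psd_kernel_zero[OF this, of j k] show ?thesis using kj diag by simp
qed

lemma solution_increasing_function:
  assumes M: "M \<in> solutions N d S" and N: "0 < N"
  shows "increasing_function N (\<lambda>t k j. M t $$ (k, j))"
proof
  have car: "M t \<in> carrier_mat N N" if "t \<in> {0..2*pi}" for t
    using M that unfolding solutions_def by (auto dest: PiE_mem)
  fix s t :: real and A :: "nat set" and \<kappa> :: "nat \<Rightarrow> nat" and c :: "nat \<Rightarrow> complex"
  assume st: "s \<in> {0..2*pi}" "t \<in> {0..2*pi}" "s \<le> t" and A: "finite A" "\<And>a. a \<in> A \<Longrightarrow> \<kappa> a < N"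
  have "psd N (M t - M s)" using M st by (simp add: solutions_def)
  from psd_form_reindexed[OF this A, where c = c]
  have "0 \<le> (\<Sum>a\<in>A. \<Sum>b\<in>A. c a * cnj (c b) * (M t - M s) $$ (\<kappa> a, \<kappa> b))" .
  also have "\<dots> = (\<Sum>a\<in>A. \<Sum>b\<in>A. c a * cnj (c b) * (M t $$ (\<kappa> a, \<kappa> b) - M s $$ (\<kappa> a, \<kappa> b)))"
    using car[OF st(1)] car[OF st(2)] A(2) by (intro sum.cong refl) simp
  finally show "0 \<le> (\<Sum>a\<in>A. \<Sum>b\<in>A. c a * cnj (c b) * (M t $$ (\<kappa> a, \<kappa> b) - M s $$ (\<kappa> a, \<kappa> b)))" .
next
  show "M 0 $$ (k, j) = 0" if "k < N" "j < N" for k j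
    using M that by (simp add: solutions_def)
  show "((\<lambda>s. M s $$ (k, j)) \<longlongrightarrow> M t $$ (k, j)) (at_left t)"
    if "t \<in> {0<..2*pi}" "k < N" "j < N" for t k j
    using M that by (simp add: solutions_def)
qed (rule N)

lemma block_toeplitz_shift:
  assumes "0 < N" "n < d * N" "m < d * N"
  shows "block_toeplitz N d S $$ (n + N, m + N) = block_toeplitz N d S $$ (n, m)"
  using assms by (simp add: block_toeplitz_def)

lemma block_toeplitz_moment:
  assumes "n \<le> d" "k < N" "j < N"
  shows "block_toeplitz N d S $$ (k + n * N, j) = S n $$ (k, j)"
proof -
  have "k + n * N < N + n * N" using assms by simp
  also have "\<dots> \<le> N + d * N" using assms(1) by simp
  finally show ?thesis
    using assms by (simp add: block_toeplitz_def moment_def)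
qed

section \<open>Spectral functions versus solutions of the moment problem\<close>

locale moment_system = shift_system H x N d for H :: "'a hspace" and x N d +
  fixes S :: "nat \<Rightarrow> complex mat"
  assumes gram: "\<lbrakk>n \<le> d; k < N; j < N\<rbrakk> \<Longrightarrow> sprod H (x (k + n * N)) (x j) = S n $$ (k, j)"
begin

abbreviation (input) spec :: "'b itself \<Rightarrow> (real \<Rightarrow> 'a \<Rightarrow> 'a) set" where
  "spec ty \<equiv> spectral_functions ty H (lin_hull H x (d * N)) (shift_op H x N (d * N))"

lemma spectral_functions_iff:
  "E \<in> spec TYPE('b) \<longleftrightarrow> (\<exists>(K :: 'b hspace) F J U. unitary_extension H x N d K F J U \<and>
     E = unitary_extension.E H K F J)"
proof
  assume "E \<in> spec TYPE('b)"
  then obtain K :: "'b hspace" and J U F where K: "hilbert_space K" and J: "isometric_embedding H K J"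
    and U: "unitary_op K U" "\<forall>v\<in>lin_hull H x (d * N). U (J v) = J (shift_op H x N (d * N) v)"
    and F: "resolution_of_unity K U F"
    and E: "E = (\<lambda>t\<in>{0..2*pi}. \<lambda>v\<in>carrier H.
               inv_into (carrier H) J (proj_onto K (J ` carrier H) (F t (J v))))"
    unfolding spectral_functions_def mem_Collect_eq by (elim exE conjE)
  interpret K: hilbert_space K by (rule K)
  interpret S: spectral_family K F by (rule K.resolution_spectral_family[OF F])
  interpret hilbert_spectral_family K F ..
  interpret X: unitary_extension H x N d K F J U
    by unfold_locales (use J U F in simp_all)
  have "E = X.E" unfolding E X.E_def ..
  then show "\<exists>(K :: 'b hspace) F J U. unitary_extension H x N d K F J U \<and>
     E = unitary_extension.E H K F J"
    by (intro exI conjI) (rule X.unitary_extension_axioms)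
next
  assume "\<exists>(K :: 'b hspace) F J U. unitary_extension H x N d K F J U \<and>
     E = unitary_extension.E H K F J"
  then obtain K :: "'b hspace" and F J U where X: "unitary_extension H x N d K F J U"
    and E: "E = unitary_extension.E H K F J" by (elim exE conjE)
  interpret X: unitary_extension H x N d K F J U by (rule X)
  show "E \<in> spec TYPE('b)"
    unfolding spectral_functions_def mem_Collect_eq E X.E_def
    using X.K.hilbert_space_axioms X.J X.U X.ext X.res by blast
qed

lemma x_carrier_first: "k < N \<Longrightarrow> x k \<in> carrier H"
  by (rule x_carrier) simp

lemma spectral_matrix_index:
  assumes "t \<in> {0..2*pi}" "k < N" "j < N"
  shows "spectral_matrix H x N E t $$ (k, j) = sprod H (E t (x k)) (x j)"
  using assms by (simp add: spectral_matrix_def)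

lemma spectral_matrix_solution:
  assumes "E \<in> spec TYPE('b)"
  shows "spectral_matrix H x N E \<in> solutions N d S"
proof -
  obtain K :: "'b hspace" and F J U where X: "unitary_extension H x N d K F J U"
    and E: "E = unitary_extension.E H K F J"
    using assms unfolding spectral_functions_iff by (elim exE conjE)
  interpret X: unitary_extension H x N d K F J U by (rule X)
  let ?M = "spectral_matrix H x N X.E"
  have car: "?M t \<in> carrier_mat N N" if "t \<in> {0..2*pi}" for t
    using that by (simp add: spectral_matrix_def)
  show ?thesis
    unfolding E solutions_def mem_Collect_eq
  proof (intro conjI ballI allI impI)
    show "?M \<in> {0..2*pi} \<rightarrow>\<^sub>E carrier_mat N N"
      using car by (auto simp: spectral_matrix_def)
    show "?M 0 = 0\<^sub>m N N"
    proof (rule eq_matI)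
      show "?M 0 $$ (k, j) = 0\<^sub>m N N $$ (k, j)" if "k < dim_row (0\<^sub>m N N)" "j < dim_col (0\<^sub>m N N)" for k j
        using that by (simp add: spectral_matrix_index X.E_zero x_carrier_first)
    qed (use car[of 0] in auto)
    fix s t :: real assume st: "s \<in> {0..2*pi}" "t \<in> {0..2*pi}" "s \<le> t"
    have d: "?M t - ?M s \<in> carrier_mat N N" by (rule minus_carrier_mat[OF car[OF st(1)]])
    have "0 \<le> (\<Sum>k<N. \<Sum>j<N. c k * cnj (c j) * (?M t - ?M s) $$ (k, j))" for c
    proof -
      have "(\<Sum>k<N. \<Sum>j<N. c k * cnj (c j) * (?M t - ?M s) $$ (k, j))
        = (\<Sum>k<N. \<Sum>j<N. c k * cnj (c j) * (sprod H (X.E t (x k)) (x j) - sprod H (X.E s (x k)) (x j)))"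
        using st car[OF st(1)] car[OF st(2)]
        by (intro sum.cong refl) (simp add: spectral_matrix_index)
      then show ?thesis using X.form_nonneg[OF st] by simp
    qed
    then show "psd N (?M t - ?M s)" unfolding psd_iff_form[OF d] by blast
  next
    fix t :: real and k l assume t: "t \<in> {0<..2*pi}" and kl: "k < N" "l < N"
    have ev: "eventually (\<lambda>s. s \<in> {0<..<t}) (at_left t)"
      using t by (intro eventually_at_left_real) simp
    have "((\<lambda>s. sprod H (X.E s (x k)) (x l)) \<longlongrightarrow> sprod H (X.E t (x k)) (x l)) (at_left t)"
      by (intro X.E_left_continuous t x_carrier_first kl)
    then have "((\<lambda>s. ?M s $$ (k, l)) \<longlongrightarrow> sprod H (X.E t (x k)) (x l)) (at_left t)"
    proof (rule Lim_transform_eventually)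
      show "eventually (\<lambda>s. sprod H (X.E s (x k)) (x l) = ?M s $$ (k, l)) (at_left t)"
        using ev by (rule eventually_mono) (use t kl in \<open>simp add: spectral_matrix_index\<close>)
    qed
    then show "((\<lambda>s. ?M s $$ (k, l)) \<longlongrightarrow> ?M t $$ (k, l)) (at_left t)"
      using t kl by (simp add: spectral_matrix_index)
  next
    fix n k l assume n: "n \<le> d" and kl: "k < N" "l < N"
    show "has_RS_integral (\<lambda>t. exp (\<i> * of_nat n * complex_of_real t)) (\<lambda>t. ?M t $$ (k, l)) 0 (2*pi) (S n $$ (k, l))"
    proof (rule has_RS_integral_cong[THEN iffD1, OF _ _ X.moment_integral[OF n kl, unfolded gram[OF n kl]]])
      show "exp (\<i> * complex_of_real t) ^ n = exp (\<i> * of_nat n * complex_of_real t)" for t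
        by (simp add: exp_of_nat_mult[symmetric] mult_ac)
    qed (use kl in \<open>simp add: spectral_matrix_index\<close>)
  qed
qed

text \<open>Different types for the two extension spaces are what later allows a spectral function
  over an arbitrary type to be identified with one over the type of \<open>H\<close>.\<close>

lemma spectral_matrix_inj:
  assumes E: "E \<in> spec TYPE('b)" "E' \<in> spec TYPE('c)"
    and eq: "spectral_matrix H x N E = spectral_matrix H x N E'"
  shows "E = E'"
proof -
  obtain K :: "'b hspace" and F J U where X: "unitary_extension H x N d K F J U"
    and E1: "E = unitary_extension.E H K F J"
    using E(1) unfolding spectral_functions_iff by (elim exE conjE)
  obtain K' :: "'c hspace" and F' J' U' where X': "unitary_extension H x N d K' F' J' U'"
    and E2: "E' = unitary_extension.E H K' F' J'"
    using E(2) unfolding spectral_functions_iff by (elim exE conjE)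
  show ?thesis
    unfolding E1 E2
  proof (rule unitary_extension_unique[OF X X'])
    show "sprod H (unitary_extension.E H K F J t (x k)) (x j)
        = sprod H (unitary_extension.E H K' F' J' t (x k)) (x j)"
      if "t \<in> {0..2*pi}" "k < N" "j < N" for t k j
      using spectral_matrix_index[OF that] eq unfolding E1 E2 by metis
  qed
qed

lemma solution_eq_spectral_matrix:
  assumes M: "M \<in> solutions N d S" and E: "\<And>t k j. \<lbrakk>t \<in> {0..2*pi}; k < N; j < N\<rbrakk> \<Longrightarrow>
    sprod H (E t (x k)) (x j) = M t $$ (k, j)"
  shows "M = spectral_matrix H x N E"
proof (rule extensionalityI)
  have P: "M \<in> {0..2*pi} \<rightarrow>\<^sub>E carrier_mat N N" using M by (simp add: solutions_def)
  then show "M \<in> extensional {0..2*pi}" by (simp add: PiE_def)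
  show "spectral_matrix H x N E \<in> extensional {0..2*pi}" by (simp add: spectral_matrix_def)
  fix t :: real assume t: "t \<in> {0..2*pi}"
  have car: "M t \<in> carrier_mat N N" by (rule PiE_mem[OF P t])
  show "M t = spectral_matrix H x N E t"
    by (rule eq_matI) (use car t E in \<open>auto simp: spectral_matrix_def\<close>)
qed

text \<open>Without a nonzero vector, the type of \<open>H\<close> need not have room for
  \<open>l2\<close>. Here the zeroth moment is 0, so M (2 pi) has zero diagonal and M vanishes; H
  itself serves as the extension space, with the identity as unitary operator.\<close>

lemma solution_degenerate:
  assumes M: "M \<in> solutions N d S" and triv: "carrier H = {\<zero>\<^bsub>H\<^esub>}"
  shows "\<exists>E\<in>spec TYPE('a). M = spectral_matrix H x N E"
proof -
  interpret I: increasing_function N "\<lambda>t k j. M t $$ (k, j)"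
    by (rule solution_increasing_function[OF M N_pos])
  have all: "v = \<zero>\<^bsub>H\<^esub>" if "v \<in> carrier H" for v using that triv by simp
  have sp: "sprod H v w = 0" if "v \<in> carrier H" "w \<in> carrier H" for v w
    unfolding all[OF that(1)] by (rule sprod_zero_left[OF that(2)])
  have "M (2*pi) $$ (k, k) = 0" if k: "k < N" for k
  proof -
    have "\<forall>n\<le>d. \<forall>k<N. \<forall>l<N. has_RS_integral (\<lambda>t. exp (\<i> * of_nat n * complex_of_real t))
        (\<lambda>t. M t $$ (k, l)) 0 (2*pi) (S n $$ (k, l))"
      using M unfolding solutions_def mem_Collect_eq by (elim conjE)
    from this[rule_format, of 0 k k] k
    have "has_RS_integral (\<lambda>t. 1) (\<lambda>t. M t $$ (k, k)) 0 (2*pi) (S 0 $$ (k, k))" by simp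
    from has_RS_integral_unique[OF has_RS_integral_one this]
    have "M (2*pi) $$ (k, k) - M 0 $$ (k, k) = S 0 $$ (k, k)" by simp
    moreover have "S 0 $$ (k, k) = 0"
      using gram[of 0 k k] k sp[OF x_carrier_first x_carrier_first, of k k] by simp
    ultimately show ?thesis using I.at_zero[OF k k] by simp
  qed
  note M0 = I.eq_zero[OF this]
  define F where "F = (\<lambda>(t::real) (v::'a). \<zero>\<^bsub>H\<^esub>)"
  have sums: "has_RS_integral f (\<lambda>t. 0) 0 (2*pi) 0" for f
    unfolding has_RS_integral_def by (intro allI impI exI[of _ 1]) (simp add: case_prod_unfold)
  have lin: "linear_map class_ring H H f" if "\<And>v. v \<in> carrier H \<Longrightarrow> f v \<in> carrier H" for f
  proof (rule linear_mapI[OF inner_space_axioms inner_space_axioms that])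
    fix v w c assume v: "v \<in> carrier H" and w: "w \<in> carrier H"
    show "f (v \<oplus>\<^bsub>H\<^esub> w) = f v \<oplus>\<^bsub>H\<^esub> f w"
      by (rule trans[OF all sym[OF all]]) (use that v w in simp_all)
  next
    fix v c assume v: "v \<in> carrier H"
    show "f (c \<odot>\<^bsub>H\<^esub> v) = c \<odot>\<^bsub>H\<^esub> f v"
      by (rule trans[OF all sym[OF all]]) (use that v in simp_all)
  qed
  have pr: "orth_projection H (F t)" for t
    unfolding orth_projection_def by (intro conjI ballI lin) (simp_all add: F_def)
  interpret hilbert_spectral_family H F
  proof
    show "F (2*pi) v = v" if "v \<in> carrier H" for v unfolding F_def by (rule all[OF that, symmetric])
  qed (simp_all add: F_def pr[unfolded F_def])
  have "unitary_extension H x N d H F (\<lambda>v. v) (\<lambda>v. v)"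
  proof
    show iso: "isometric_embedding H H (\<lambda>v. v)"
      unfolding isometric_embedding_def by (intro conjI ballI lin) simp_all
    then show "unitary_op H (\<lambda>v. v)" by (simp add: unitary_op_def)
    show "v = shift_op H x N (d * N) v" if v: "v \<in> lin_hull H x (d * N)" for v
    proof -
      obtain \<alpha> where \<alpha>: "v = lin_comb \<alpha> x (d * N)"
        using v unfolding domain_eq by (rule rangeE)
      have "v \<in> carrier H" "shift_op H x N (d * N) v \<in> carrier H"
        unfolding \<alpha> shift_op_lin_comb using x_carrier' by (auto intro!: lin_comb_carrier)
      from all[OF this(1)] all[OF this(2)] show ?thesis by (rule trans[OF _ sym])
    qed
    show "resolution_of_unity H (\<lambda>v. v) F"
      unfolding resolution_of_unity_def
    proof (intro conjI ballI impI)
      show "has_RS_integral (\<lambda>t. exp (\<i> * complex_of_real t)) (\<lambda>t. sprod H (F t v) w) 0 (2*pi) (sprod H v w)"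
        if "v \<in> carrier H" "w \<in> carrier H" for v w
        using sums sp[OF that] that by (simp add: F_def)
      show "((\<lambda>s. hnorm H (F s v \<ominus>\<^bsub>H\<^esub> F t v)) \<longlongrightarrow> 0) (at_left t)" for t v
        unfolding F_def minus_zero[OF zero_closed] hnorm_zero by (rule tendsto_const)
    qed (rule proj mono zero full; assumption)+
  qed
  then interpret X: unitary_extension H x N d H F "\<lambda>v. v" "\<lambda>v. v" .
  have "X.E \<in> spec TYPE('a)"
    unfolding spectral_functions_iff
    by (intro exI conjI) (rule X.unitary_extension_axioms, rule refl)
  moreover have "M = spectral_matrix H x N X.E"
    by (rule solution_eq_spectral_matrix[OF M]) (simp add: M0 sp X.E_carrier x_carrier_first)
  ultimately show ?thesis by blast
qed

lemma solution_is_spectral_matrix: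
  assumes M: "M \<in> solutions N d S"
  shows "\<exists>E\<in>spec TYPE('a). M = spectral_matrix H x N E"
proof (cases "carrier H = {\<zero>\<^bsub>H\<^esub>}")
  case False
  then obtain x0 where x0: "x0 \<in> carrier H" "x0 \<noteq> \<zero>\<^bsub>H\<^esub>" using zero_closed by blast
  interpret I: increasing_function N "\<lambda>t k j. M t $$ (k, j)"
    by (rule solution_increasing_function[OF M N_pos])
  obtain K :: "'a hspace" and y0 U F where K: "hilbert_space K" and y0: "\<forall>k<N. y0 k \<in> carrier K"
    and U: "unitary_op K U" and F: "resolution_of_unity K U F"
    and m: "\<forall>t\<in>{0..2*pi}. \<forall>k<N. \<forall>j<N. sprod K (F t (y0 k)) (y0 j) = M t $$ (k, j)"
    using I.dilation_exists[OF inner_space_axioms x0] by (elim exE conjE)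
  interpret K: hilbert_space K by (rule K)
  interpret S: spectral_family K F by (rule K.resolution_spectral_family[OF F])
  interpret S: hilbert_spectral_family K F ..
  note Uf = isometric_embedding_facts[OF U[unfolded unitary_op_def, THEN conjunct1]]
  have Uc: "(U ^^ n) v \<in> carrier K" if "v \<in> carrier K" for n v
    using that by (induction n) (simp_all add: Uf(1))
  have integ: "S.integrates (\<lambda>t. exp (\<i> * complex_of_real t)) U"
    using F Uf(1) by (simp add: S.integrates_def resolution_of_unity_def)
  \<comment> \<open>Both sides are integrals of the n-th power of the exponential against the same
    function, one by the spectral family and one by the moment condition on M.\<close>
  have mom: "sprod K ((U ^^ n) (y0 k)) (y0 j) = S n $$ (k, j)" if n: "n \<le> d" and kj: "k < N" "j < N" for n k j
  proof -
    have "has_RS_integral (\<lambda>t. exp (\<i> * complex_of_real t) ^ n) (\<lambda>t. sprod K (F t (y0 k)) (y0 j)) 0 (2*pi)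
      (sprod K ((U ^^ n) (y0 k)) (y0 j))"
    proof (rule S.has_RS_integral_power[OF exp_i_Lipschitz _ integ])
      show "hnorm K (U v) = hnorm K v" if "v \<in> carrier K" for v
        using Uf(4)[OF that that] by (simp add: hnorm_def)
    qed (use y0 kj in simp_all)
    moreover have "has_RS_integral (\<lambda>t. exp (\<i> * complex_of_real t) ^ n) (\<lambda>t. sprod K (F t (y0 k)) (y0 j)) 0 (2*pi)
      (S n $$ (k, j))"
    proof -
      have "\<forall>n\<le>d. \<forall>k<N. \<forall>l<N. has_RS_integral (\<lambda>t. exp (\<i> * of_nat n * complex_of_real t))
          (\<lambda>t. M t $$ (k, l)) 0 (2*pi) (S n $$ (k, l))"
        using M unfolding solutions_def mem_Collect_eq by (elim conjE)
      from this[rule_format, OF n kj] show ?thesis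
      proof (rule has_RS_integral_cong[THEN iffD1, rotated -1])
        show "exp (\<i> * of_nat n * complex_of_real t) = exp (\<i> * complex_of_real t) ^ n" for t
          by (simp add: exp_of_nat_mult[symmetric] mult_ac)
        show "M t $$ (k, j) = sprod K (F t (y0 k)) (y0 j)" if "t \<in> {0..2*pi}" for t
          using m that kj by simp
      qed
    qed
    ultimately show ?thesis by (rule has_RS_integral_unique)
  qed
  have Ui: "sprod K ((U ^^ i) v) ((U ^^ i) w) = sprod K v w" if "v \<in> carrier K" "w \<in> carrier K" for i v w
    using that by (induction i) (simp_all add: Uf(4) Uc)
  define y where "y n = (U ^^ (n div N)) (y0 (n mod N))" for n
  have yc: "y n \<in> carrier K" for n using Uc y0 N_pos by (simp add: y_def)
  have Uy: "U (y n) = y (n + N)" for n using N_pos by (simp add: y_def)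
  have y_first: "y k = y0 k" if "k < N" for k using that by (simp add: y_def)
  let ?n = "(d + 1) * N"
  \<comment> \<open>Moments are given for nonnegative orders, so the block row is assumed to be at
    least the block column; the other half follows by Hermitian symmetry. Isometry of U cancels the
    common power U^j.\<close>
  have gram_le: "sprod K (y n) (y n') = sprod H (x n) (x n')" if n: "n < ?n" and le: "n' div N \<le> n div N" for n n'
  proof -
    define i k j p where "i = n div N" and "k = n mod N" and "j = n' div N" and "p = n' mod N"
    have kp: "k < N" "p < N" using N_pos by (auto simp: k_def p_def)
    have ij: "j \<le> i" "i \<le> d"
      using le n less_mult_imp_div_less[of n "d + 1" N] by (auto simp: i_def j_def)
    have nn: "n = (k + (i - j) * N) + j * N" "n' = p + j * N"
      using ij(1) by (simp_all add: i_def k_def j_def p_def add.assoc distrib_right[symmetric])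
    have "(U ^^ i) (y0 k) = (U ^^ j) ((U ^^ (i - j)) (y0 k))"
      using ij(1) by (simp add: funpow_add[symmetric, THEN fun_cong, unfolded o_def])
    then have "sprod K (y n) (y n') = sprod K ((U ^^ j) ((U ^^ (i - j)) (y0 k))) ((U ^^ j) (y0 p))"
      by (simp add: y_def i_def j_def k_def p_def)
    also have "\<dots> = sprod K ((U ^^ (i - j)) (y0 k)) (y0 p)"
      using y0 kp Uc by (intro Ui) auto
    also have "\<dots> = sprod H (x (k + (i - j) * N)) (x p)"
      using ij kp by (simp add: mom gram)
    also have "\<dots> = sprod H (x n) (x n')"
    proof -
      have bound: "k + (i - j) * N + q * N < d * N" if "q < j" for q
      proof -
        have "k + (i - j) * N + q * N < N + (i - j) * N + q * N" using kp by simp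
        also have "\<dots> = (1 + (i - j) + q) * N" by (simp add: algebra_simps)
        also have "\<dots> \<le> d * N" using that ij by (intro mult_right_mono) auto
        finally show ?thesis .
      qed
      have bound': "p + q * N < d * N" if "q < j" for q
      proof -
        have "p + q * N < N + q * N" using kp by simp
        also have "\<dots> = (1 + q) * N" by simp
        also have "\<dots> \<le> d * N" using that ij by (intro mult_right_mono) auto
        finally show ?thesis .
      qed
      \<comment> \<open>The counterpart in H of cancelling U^j: shift invariance applied j times,
        with \<open>bound\<close> and \<open>bound'\<close> keeping the indices below d N at each
        application.\<close>
      have "q \<le> j \<Longrightarrow> sprod H (x (k + (i - j) * N + q * N)) (x (p + q * N)) = sprod H (x (k + (i - j) * N)) (x p)" for q
      proof (induction q)
        case (Suc q)
        have "sprod H (x (k + (i - j) * N + q * N + N)) (x (p + q * N + N))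
            = sprod H (x (k + (i - j) * N + q * N)) (x (p + q * N))"
          using Suc.prems by (intro shift_invariant bound bound') auto
        then show ?case using Suc by (simp add: add.assoc add.commute[of N])
      qed simp
      from this[of j] show ?thesis unfolding nn by simp
    qed
    finally show ?thesis .
  qed
  have gram_y: "sprod K (y n) (y n') = sprod H (x n) (x n')" if n: "n < ?n" "n' < ?n" for n n'
  proof (cases "n' div N \<le> n div N")
    case False
    have "sprod K (y n) (y n') = cnj (sprod K (y n') (y n))" by (rule K.sprod_commute[OF yc yc])
    also have "sprod K (y n') (y n) = sprod H (x n') (x n)"
      using False by (intro gram_le n) simp
    also have "cnj \<dots> = sprod H (x n) (x n')"
      by (rule sprod_commute[OF x_carrier[OF n(2)] x_carrier[OF n(1)], symmetric])
    finally show ?thesis .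
  qed (rule gram_le[OF n(1)])
  obtain J where J: "isometric_embedding H K J" and Jx: "\<forall>i<?n. J (x i) = y i"
    using isometry_of_gram[OF inner_space_axioms K.inner_space_axioms x_carrier yc gram_y span_x] by blast
  have lin: "linear_map class_ring H K J" "linear_map class_ring K K U"
    using J U by (auto simp: isometric_embedding_def unitary_op_def)
  have "unitary_extension H x N d K F J U"
  proof
    show "U (J v) = J (shift_op H x N (d * N) v)" if v: "v \<in> lin_hull H x (d * N)" for v
    proof -
      obtain \<alpha> where \<alpha>: "v = lin_comb \<alpha> x (d * N)"
        using v unfolding domain_eq by (rule rangeE)
      have cong: "K.lin_comb \<alpha> f (d * N) = K.lin_comb \<alpha> g (d * N)"
        if "\<And>k. k < d * N \<Longrightarrow> f k = g k" "\<And>k. g k \<in> carrier K" for f g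
        unfolding K.lin_comb_def using that by (intro K.finsum_cong') (auto simp: Pi_def)
      have "J v = K.lin_comb \<alpha> (\<lambda>k. J (x k)) (d * N)"
        unfolding \<alpha> using x_carrier'(1)
        by (intro lin_comb_linear_map inner_space_axioms K.inner_space_axioms lin)
      also have "\<dots> = K.lin_comb \<alpha> y (d * N)"
        using Jx yc by (intro cong) auto
      finally have "U (J v) = K.lin_comb \<alpha> (\<lambda>k. U (y k)) (d * N)"
        using lin_comb_linear_map[OF K.inner_space_axioms K.inner_space_axioms lin(2), of "d * N" y \<alpha>] yc
        by simp
      also have "\<dots> = K.lin_comb \<alpha> (\<lambda>k. y (k + N)) (d * N)" by (simp add: Uy)
      also have "\<dots> = K.lin_comb \<alpha> (\<lambda>k. J (x (k + N))) (d * N)"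
        using Jx yc by (intro cong[symmetric]) auto
      also have "\<dots> = J (lin_comb \<alpha> (\<lambda>k. x (k + N)) (d * N))"
        using x_carrier'(2)
        by (intro lin_comb_linear_map[symmetric] inner_space_axioms K.inner_space_axioms lin)
      finally show ?thesis by (simp add: \<alpha> shift_op_lin_comb)
    qed
  qed (rule J U F)+
  then interpret X: unitary_extension H x N d K F J U .
  have "X.E \<in> spec TYPE('a)"
    unfolding spectral_functions_iff
    by (intro exI conjI) (rule X.unitary_extension_axioms, rule refl)
  moreover have "M = spectral_matrix H x N X.E"
  proof (rule solution_eq_spectral_matrix[OF M])
    fix t :: real and k j assume t: "t \<in> {0..2*pi}" and kj: "k < N" "j < N"
    then have "k < ?n" "j < ?n" by simp_all
    then have "J (x k) = y0 k" "J (x j) = y0 j" using Jx kj by (auto simp: y_first)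
    then show "sprod H (X.E t (x k)) (x j) = M t $$ (k, j)"
      using t kj m x_carrier_first by (simp add: X.sprod_E)
  qed
  ultimately show ?thesis by blast
qed (rule solution_degenerate[OF M])

end

theorem theorem2:
  fixes N d :: nat
    and S :: "nat \<Rightarrow> complex mat"
    and H :: "'a hspace"
    and x :: "nat \<Rightarrow> 'a"
  assumes "1 \<le> N" and "1 \<le> d"
    and "\<And>n. n \<le> d \<Longrightarrow> S n \<in> carrier_mat N N"
    and "psd ((d + 1) * N) (block_toeplitz N d S)"
    and "hilbert_space H"
    and "\<And>n. n < (d + 1) * N \<Longrightarrow> x n \<in> carrier H"
    and "\<And>n m. n < (d + 1) * N \<Longrightarrow> m < (d + 1) * N \<Longrightarrow>
           sprod H (x n) (x m) = block_toeplitz N d S $$ (n, m)"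
    and "carrier H = lin_hull H x ((d + 1) * N)"
  defines "D \<equiv> lin_hull H x (d * N)"
    and "A \<equiv> shift_op H x N (d * N)"
  shows "(\<forall>M \<in> solutions N d S. \<exists>E \<in> spectral_functions TYPE('a) H D A.
            M = spectral_matrix H x N E) \<and>
         (\<forall>E \<in> spectral_functions TYPE('b) H D A. spectral_matrix H x N E \<in> solutions N d S) \<and>
         bij_betw (spectral_matrix H x N) (spectral_functions TYPE('a) H D A) (solutions N d S) \<and>
         spectral_functions TYPE('b) H D A \<subseteq> spectral_functions TYPE('a) H D A"
proof -
  interpret hilbert_space H by fact
  have N: "0 < N" using assms(1) by simp
  interpret moment_system H x N d S
  proof
    show "sprod H (x (n + N)) (x (m + N)) = sprod H (x n) (x m)" if "n < d * N" "m < d * N" for n m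
      using that assms(7) by (simp add: block_toeplitz_shift[OF N])
    fix n k j assume n: "n \<le> d" and kj: "k < N" "j < N"
    have "k + n * N < N + n * N" using kj by simp
    also have "\<dots> \<le> (d + 1) * N" using n by simp
    finally show "sprod H (x (k + n * N)) (x j) = S n $$ (k, j)"
      using assms(7)[of "k + n * N" j] n kj by (simp add: block_toeplitz_moment)
  qed (use N assms(6,8) in auto)
  let ?a = "spectral_functions TYPE('a) H D A" and ?b = "spectral_functions TYPE('b) H D A"
  have surj: "\<exists>E\<in>?a. M = spectral_matrix H x N E" if "M \<in> solutions N d S" for M
    unfolding D_def A_def by (rule solution_is_spectral_matrix[OF that])
  have solb: "spectral_matrix H x N E \<in> solutions N d S" if "E \<in> ?b" for E
    using that unfolding D_def A_def by (rule spectral_matrix_solution)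
  have sola: "spectral_matrix H x N E \<in> solutions N d S" if "E \<in> ?a" for E
    using that unfolding D_def A_def by (rule spectral_matrix_solution)
  have "bij_betw (spectral_matrix H x N) ?a (solutions N d S)"
  proof (rule bij_betw_imageI)
    show "inj_on (spectral_matrix H x N) ?a"
      unfolding D_def A_def by (rule inj_onI) (rule spectral_matrix_inj)
    show "spectral_matrix H x N ` ?a = solutions N d S"
      using surj sola by blast
  qed
  \<comment> \<open>The solution generated by E is also generated by some \<open>E'\<close> over the
    type of \<open>H\<close>, and injectivity across the two types identifies them.\<close>
  moreover have "?b \<subseteq> ?a"
  proof
    fix E assume E: "E \<in> ?b"
    obtain E' where E': "E' \<in> ?a" "spectral_matrix H x N E = spectral_matrix H x N E'"
      using surj[OF solb[OF E]] by blast
    have "E = E'" using E E' unfolding D_def A_def by (intro spectral_matrix_inj)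
    then show "E \<in> ?a" using E' by simp
  qed
  ultimately show ?thesis using surj solb by blast
qed

end
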